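(* Let $n\in\mathbb N$ and $\boldsymbol\alpha=(\alpha_1,\alpha_2,\alpha_3)$ with $\alpha_i>-1$ for $i=1,2,3$. Consider the following procedure, in which an entry $e^{\boldsymbol k}_{\boldsymbol l}$ with $\boldsymbol k\notin\Theta_n$ or $\boldsymbol l\notin\Theta_n$ is taken to be $0$. Step 1. For $l_1=0,1,\dots,n$ and $l_2=0,1,\dots,n-l_1$: compute, by Clenshaw's algorithm, \[ e^{(0,0)}_{(l_1,l_2)}:=\frac{(-1)^{l_1}(|\boldsymbol\alpha|+3)_n}{n!\,(\alpha_1+2)_{l_1}}\sum_{i=0}^{n-l_1}C^\ast_i\,h_i(l_2;\alpha_2,\alpha_3,n-l_1), \] and put $e^{(l_1,l_2)}_{(0,0)}:=e^{(0,0)}_{(l_1,l_2)}$. Step 2. For $k_1=0,1,\dots,n-1$: (1) for $k_2=0,1,\dots,n-k_1-1$, $l_1=k_1,k_1+1,\dots,n$, $l_2=0,1,\dots,n-l_1$: with $\boldsymbol k=(k_1,k_2)$, $\boldsymbol l=(l_1,l_2)$, $\boldsymbol v_2=(0,1)$, compute \[ e^{\boldsymbol k+\boldsymbol v_2}_{\boldsymbol l}:=\Big([\sigma_1(\boldsymbol k)-\sigma_1(\boldsymbol l)]e^{\boldsymbol k}_{\boldsymbol l}-\sigma_2(\boldsymbol k)e^{\boldsymbol k-\boldsymbol v_2}_{\boldsymbol l}+\sigma_0(\boldsymbol l)e^{\boldsymbol k}_{\boldsymbol l+\boldsymbol v_2}+\sigma_2(\boldsymbol l)e^{\boldsymbol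 k}_{\boldsymbol l-\boldsymbol v_2}\Big)/\sigma_0(\boldsymbol k), \] and put $e^{\boldsymbol l}_{\boldsymbol k+\boldsymbol v_2}:=e^{\boldsymbol k+\boldsymbol v_2}_{\boldsymbol l}$; (2) for $l_1=k_1+1,\dots,n$, $l_2=0,1,\dots,n-l_1$: with $\boldsymbol k=(k_1,0)$, $\boldsymbol l=(l_1,l_2)$, $\boldsymbol v_1=(1,0)$, compute \[ e^{\boldsymbol k+\boldsymbol v_1}_{\boldsymbol l}:=\Big([\tau_1(\boldsymbol k)-\tau_1(\boldsymbol l)]e^{\boldsymbol k}_{\boldsymbol l}-\tau_2(\boldsymbol k)e^{\boldsymbol k-\boldsymbol v_1}_{\boldsymbol l}+\tau_0(\boldsymbol l)e^{\boldsymbol k}_{\boldsymbol l+\boldsymbol v_1}+\tau_2(\boldsymbol l)e^{\boldsymbol k}_{\boldsymbol l-\boldsymbol v_1}\Big)/\tau_0(\boldsymbol k), \] and put $e^{\boldsymbol l}_{\boldsymbol k+\boldsymbol v_1}:=e^{\boldsymbol k+\boldsymbol v_1}_{\boldsymbol l}$. Then this procedure computes the complete set of the Bézier coefficients $e^{\boldsymbol k}_{\boldsymbol l}(\boldsymbol\alpha,n)$, $\boldsymbol k,\boldsymbol l\in\Theta_n$, of the dual bivariate Bernstein polynomials, and it requires $O(n^4)$ arithmetic operations, i.e. its cost is proportional to the total number of these coefficients.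
   Context: $\mathbb N$ includes $0$. $|\boldsymbol y|$ is the sum of the components of $\boldsymbol y$; $(a)_0:=1$, $(a)_k:=a(a+1)\cdots(a+k-1)$. $\Theta_n:=\{(k_1,k_2)\in\mathbb N^2: 0\le k_1+k_2\le n\}$. $T:=\{(x_1,x_2): x_1,x_2\ge0,\ x_1+x_2\le1\}$, and $\Pi_n^2$ is the space of bivariate real polynomials of total degree at most $n$. The bivariate Bernstein basis is \[B^n_{\boldsymbol k}(\boldsymbol x):=\frac{n!}{k_1!k_2!(n-|\boldsymbol k|)!}x_1^{k_1}x_2^{k_2}(1-|\boldsymbol x|)^{n-|\boldsymbol k|},\quad \boldsymbol k\in\Theta_n.\] The inner product is $\langle f,g\rangle_{\boldsymbol\alpha}:=\iint_T w_{\boldsymbol\alpha}fg\,d\boldsymbol x$, with $w_{\boldsymbol\alpha}(\boldsymbol x):=A_{\boldsymbol\alpha}x_1^{\alpha_1}x_2^{\alpha_2}(1-|\boldsymbol x|)^{\alpha_3}$ and $A_{\boldsymbol\alpha}:=\Gamma(|\boldsymbol\alpha|+3)\prod_{i=1}^3\Gamma(\alpha_i+1)^{-1}$. The dual bivariate Bernstein polynomials $D^n_{\boldsymbol k}(\cdot;\boldsymbol\alpha)\in\Pi^2_n$ are defined by $\langle D^n_{\boldsymbol k},B^n_{\boldsymbol l}\rangle_{\boldsymbol\alpha}=\delta_{\boldsymbol k,\boldsymbol l}$ ($\boldsymbol k,\boldsymbol l\in\Theta_n$), and their Bézier coefficients by $D^n_{\boldsymbol k}(\boldsymbol x;\boldsymbol\alpha)=\sum_{\boldsymbol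 l\in\Theta_n}e^{\boldsymbol k}_{\boldsymbol l}(\boldsymbol\alpha,n)B^n_{\boldsymbol l}(\boldsymbol x)$. Recurrence coefficients, for $\boldsymbol t=(t_1,t_2)$: $\sigma_0(\boldsymbol t):=(|\boldsymbol t|-n)(t_2+\alpha_2+1)$, $\sigma_2(\boldsymbol t):=t_2(|\boldsymbol t|-\alpha_3-n-1)$, $\sigma_1:=\sigma_0+\sigma_2$; $\tau_0(\boldsymbol t):=(|\boldsymbol t|-n)(t_1+\alpha_1+1)$, $\tau_2(\boldsymbol t):=t_1(|\boldsymbol t|-\alpha_3-n-1)$, $\tau_1:=\tau_0+\tau_2$. Coefficients in Step 1 (depending on $l_1$): \[C^\ast_0:=\frac{(\alpha_1+2)_n}{(\alpha_2+\alpha_3+2)_{n-l_1}},\qquad C^\ast_i:=(-1)^i\frac{(2i+\alpha_2+\alpha_3+1)(\alpha_1+2)_{n-i}(|\boldsymbol\alpha|+n+3)_i}{i!\,(\alpha_3+1)_i(\alpha_2+\alpha_3+i+1)_{n-l_1+1}}\quad(i\ge1).\] Univariate Hahn polynomials: $h_l(t;a,b,M):=(a+1)_l(-M)_l\,{}_3F_2\!\left(-l,\,l+a+b+1,\,-t;\ a+1,\,-M;\ 1\right)$, where ${}_3F_2$ is the generalised hypergeometric series (here a finite sum). Clenshaw's algorithm for a sum $\sum_{i=0}^N\gamma_ih_i(t;a,b,M)$: put $V_{N+1}=V_{N+2}=0$, compute $V_i:=\gamma_i+A_iV_{i+1}+B_{i+1}V_{i+2}$ for $i=N,N-1,\dots,0$;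 the sum is $V_0$. Here $A_l=C_l(2l+s-1)_2\,t-D_l-E_l$, $B_l=-D_lE_{l-1}$, with $s:=a+b+1$, $C_l:=(2l+s+1)/[(l+s)(2l+s-1)]$, $D_l:=C_l\,l(l+M+s)(l+b)$, $E_l:=(l+a+1)(M-l)$; for $l=0$ these are read, after cancellation, as $D_0=0$ and $A_0=(a+b+2)t-(a+1)M$. *)

theory Defs
  imports "HOL-Analysis.Analysis" "HOL-Library.Landau_Symbols"
begin

section \<open>Dual bivariate Bernstein polynomials\<close>

definition triangle :: "(real \<times> real) set" where
  "triangle = {(x1, x2). 0 \<le> x1 \<and> 0 \<le> x2 \<and> x1 + x2 \<le> 1}"

definition idx :: "nat \<Rightarrow> (nat \<times> nat) set" where
  "idx n = {(k1, k2). k1 + k2 \<le> n}"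

text \<open>Polynomials are represented by the functions they induce on the whole real plane.\<close>

definition poly_space :: "nat \<Rightarrow> (real \<times> real \<Rightarrow> real) set" where
  "poly_space n = {f. \<exists>c :: nat \<times> nat \<Rightarrow> real.
     \<forall>x1 x2. f (x1, x2) = (\<Sum>(i, j)\<in>idx n. c (i, j) * x1 ^ i * x2 ^ j)}"

fun bernstein :: "nat \<Rightarrow> nat \<times> nat \<Rightarrow> real \<times> real \<Rightarrow> real" where
  "bernstein n (k1, k2) (x1, x2) =
     fact n / (fact k1 * fact k2 * fact (n - (k1 + k2)))
       * x1 ^ k1 * x2 ^ k2 * (1 - (x1 + x2)) ^ (n - (k1 + k2))"

definition weight :: "real \<Rightarrow> real \<Rightarrow> real \<Rightarrow> real \<times> real \<Rightarrow> real" where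
  "weight \<alpha>1 \<alpha>2 \<alpha>3 = (\<lambda>(x1, x2).
     Gamma (\<alpha>1 + \<alpha>2 + \<alpha>3 + 3) / (Gamma (\<alpha>1 + 1) * Gamma (\<alpha>2 + 1) * Gamma (\<alpha>3 + 1))
       * x1 powr \<alpha>1 * x2 powr \<alpha>2 * (1 - (x1 + x2)) powr \<alpha>3)"

definition jacobi_inner ::
  "real \<Rightarrow> real \<Rightarrow> real \<Rightarrow> (real \<times> real \<Rightarrow> real) \<Rightarrow> (real \<times> real \<Rightarrow> real) \<Rightarrow> real" where
  "jacobi_inner \<alpha>1 \<alpha>2 \<alpha>3 f g =
     set_lebesgue_integral lborel triangle (\<lambda>x. weight \<alpha>1 \<alpha>2 \<alpha>3 x * f x * g x)"

definition is_dual_bernstein ::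
  "nat \<Rightarrow> real \<Rightarrow> real \<Rightarrow> real \<Rightarrow> nat \<times> nat \<Rightarrow> (real \<times> real \<Rightarrow> real) \<Rightarrow> bool" where
  "is_dual_bernstein n \<alpha>1 \<alpha>2 \<alpha>3 k D \<longleftrightarrow> D \<in> poly_space n \<and>
     (\<forall>l\<in>idx n. jacobi_inner \<alpha>1 \<alpha>2 \<alpha>3 D (bernstein n l) = (if k = l then 1 else 0))"

definition dual_bernstein ::
  "nat \<Rightarrow> real \<Rightarrow> real \<Rightarrow> real \<Rightarrow> nat \<times> nat \<Rightarrow> real \<times> real \<Rightarrow> real" where
  "dual_bernstein n \<alpha>1 \<alpha>2 \<alpha>3 k = (THE D. is_dual_bernstein n \<alpha>1 \<alpha>2 \<alpha>3 k D)"

text \<open>The value outside the index set is fixed only to make the coefficient family unique.\<close>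

definition is_bezier_form ::
  "nat \<Rightarrow> (real \<times> real \<Rightarrow> real) \<Rightarrow> (nat \<times> nat \<Rightarrow> real) \<Rightarrow> bool" where
  "is_bezier_form n f c \<longleftrightarrow>
     (\<forall>l. l \<notin> idx n \<longrightarrow> c l = 0) \<and> (\<forall>x. f x = (\<Sum>l\<in>idx n. c l * bernstein n l x))"

definition bezier_coeff ::
  "nat \<Rightarrow> real \<Rightarrow> real \<Rightarrow> real \<Rightarrow> nat \<times> nat \<Rightarrow> nat \<times> nat \<Rightarrow> real" where
  "bezier_coeff n \<alpha>1 \<alpha>2 \<alpha>3 k = (THE c. is_bezier_form n (dual_bernstein n \<alpha>1 \<alpha>2 \<alpha>3 k) c)"


section \<open>Hahn polynomials and the Step 1 formula\<close>

text \<open>When a parameter \<open>a1 = - l\<close> terminates the series, all terms with \<open>j > l\<close> vanish, also if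
  \<open>b2\<close> is a non-positive integer \<open>- M\<close> with \<open>M \<ge> l\<close>, since division by zero yields zero.\<close>

definition hypergeo_3F2 ::
  "real \<Rightarrow> real \<Rightarrow> real \<Rightarrow> real \<Rightarrow> real \<Rightarrow> real \<Rightarrow> real" where
  "hypergeo_3F2 a1 a2 a3 b1 b2 z =
     (\<Sum>j. pochhammer a1 j * pochhammer a2 j * pochhammer a3 j
            / (pochhammer b1 j * pochhammer b2 j) * z ^ j / fact j)"

definition hahn :: "nat \<Rightarrow> real \<Rightarrow> real \<Rightarrow> real \<Rightarrow> real \<Rightarrow> real" where
  "hahn l t a b M = pochhammer (a + 1) l * pochhammer (- M) l
     * hypergeo_3F2 (- real l) (real l + a + b + 1) (- t) (a + 1) (- M) 1"

definition c_star :: "nat \<Rightarrow> real \<Rightarrow> real \<Rightarrow> real \<Rightarrow> nat \<Rightarrow> nat \<Rightarrow> real" where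
  "c_star n \<alpha>1 \<alpha>2 \<alpha>3 l1 i =
     (if i = 0 then pochhammer (\<alpha>1 + 2) n / pochhammer (\<alpha>2 + \<alpha>3 + 2) (n - l1)
      else (- 1) ^ i
        * ((2 * real i + \<alpha>2 + \<alpha>3 + 1) * pochhammer (\<alpha>1 + 2) (n - i)
             * pochhammer (\<alpha>1 + \<alpha>2 + \<alpha>3 + real n + 3) i)
        / (fact i * pochhammer (\<alpha>3 + 1) i
             * pochhammer (\<alpha>2 + \<alpha>3 + real i + 1) (n - l1 + 1)))"

definition step1_value :: "nat \<Rightarrow> real \<Rightarrow> real \<Rightarrow> real \<Rightarrow> nat \<times> nat \<Rightarrow> real" where
  "step1_value n \<alpha>1 \<alpha>2 \<alpha>3 = (\<lambda>(l1, l2).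
     (- 1) ^ l1 * pochhammer (\<alpha>1 + \<alpha>2 + \<alpha>3 + 3) n / (fact n * pochhammer (\<alpha>1 + 2) l1)
       * (\<Sum>i = 0..n - l1. c_star n \<alpha>1 \<alpha>2 \<alpha>3 l1 i * hahn i (real l2) \<alpha>2 \<alpha>3 (real (n - l1))))"


section \<open>Arithmetic straight-line programs\<close>

text \<open>
  For each \<open>n\<close> the procedure unrolls to a list of assignments whose right-hand sides are
  explicit arithmetic expressions. Only integer constants (loop indices, \<open>n\<close>, numerals) and
  variables are available free of charge, so the number of arithmetic operations is the number
  of operation nodes. Loop control and copying are not counted. Reading a variable that
  has not been assigned and dividing by zero make the execution fail.
\<close>

datatype var =
    Alpha1 | Alpha2 | Alpha3
  | Coef "nat \<times> nat" "nat \<times> nat"  \<comment> \<open>\<open>Coef k l\<close> holds the entry with upper index \<open>k\<close> and lower index \<open>l\<close>\<close>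
  | Acc nat  \<comment> \<open>the \<open>V\<close>'s of Clenshaw's algorithm\<close>

datatype aexp =
    Const int
  | Var var
  | Add aexp aexp (infixl "\<oplus>" 65)
  | Sub aexp aexp (infixl "\<ominus>" 65)
  | Mul aexp aexp (infixl "\<otimes>" 70)
  | Quot aexp aexp (infixl "\<oslash>" 70)

datatype stmt = Assign var aexp (infix "\<leftarrow>" 60)

type_synonym state = "var \<Rightarrow> real option"

definition lift_op :: "(real \<Rightarrow> real \<Rightarrow> real) \<Rightarrow> real option \<Rightarrow> real option \<Rightarrow> real option" where
  "lift_op f u v = Option.bind u (\<lambda>x. map_option (f x) v)"

primrec eval_aexp :: "state \<Rightarrow> aexp \<Rightarrow> real option" where
  "eval_aexp s (Const c) = Some (of_int c)"
| "eval_aexp s (Var v) = s v"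
| "eval_aexp s (e \<oplus> f) = lift_op (+) (eval_aexp s e) (eval_aexp s f)"
| "eval_aexp s (e \<ominus> f) = lift_op (-) (eval_aexp s e) (eval_aexp s f)"
| "eval_aexp s (e \<otimes> f) = lift_op (*) (eval_aexp s e) (eval_aexp s f)"
| "eval_aexp s (e \<oslash> f) =
     (if eval_aexp s f = Some 0 then None else lift_op (/) (eval_aexp s e) (eval_aexp s f))"

primrec exec :: "stmt list \<Rightarrow> state \<Rightarrow> state option" where
  "exec [] s = Some s"
| "exec (st # sts) s =
     (case st of v \<leftarrow> e \<Rightarrow> Option.bind (eval_aexp s e) (\<lambda>x. exec sts (s(v := Some x))))"

primrec ops_aexp :: "aexp \<Rightarrow> nat" where
  "ops_aexp (Const c) = 0"
| "ops_aexp (Var v) = 0"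
| "ops_aexp (e \<oplus> f) = ops_aexp e + ops_aexp f + 1"
| "ops_aexp (e \<ominus> f) = ops_aexp e + ops_aexp f + 1"
| "ops_aexp (e \<otimes> f) = ops_aexp e + ops_aexp f + 1"
| "ops_aexp (e \<oslash> f) = ops_aexp e + ops_aexp f + 1"

primrec ops_stmt :: "stmt \<Rightarrow> nat" where
  "ops_stmt (v \<leftarrow> e) = ops_aexp e"

definition ops :: "stmt list \<Rightarrow> nat" where
  "ops p = sum_list (map ops_stmt p)"

definition init_state :: "real \<Rightarrow> real \<Rightarrow> real \<Rightarrow> state" where
  "init_state \<alpha>1 \<alpha>2 \<alpha>3 = [Alpha1 \<mapsto> \<alpha>1, Alpha2 \<mapsto> \<alpha>2, Alpha3 \<mapsto> \<alpha>3]"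

abbreviation loop :: "nat list \<Rightarrow> (nat \<Rightarrow> stmt list) \<Rightarrow> stmt list" where
  "loop xs body \<equiv> concat (map body xs)"

abbreviation nat_const :: "nat \<Rightarrow> aexp" where
  "nat_const k \<equiv> Const (int k)"

primrec power_exp :: "aexp \<Rightarrow> nat \<Rightarrow> aexp" where
  "power_exp e 0 = Const 1"
| "power_exp e (Suc k) = power_exp e k \<otimes> e"

primrec poch_exp :: "aexp \<Rightarrow> nat \<Rightarrow> aexp" where
  "poch_exp e 0 = Const 1"
| "poch_exp e (Suc k) = poch_exp e k \<otimes> (e \<oplus> nat_const k)"

abbreviation fact_exp :: "nat \<Rightarrow> aexp" where
  "fact_exp k \<equiv> poch_exp (Const 1) k"


section \<open>Clenshaw's algorithm for Hahn polynomials\<close>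

definition hahn_s :: "aexp \<Rightarrow> aexp \<Rightarrow> aexp" where
  "hahn_s a b = a \<oplus> b \<oplus> Const 1"

definition hahn_C :: "aexp \<Rightarrow> aexp \<Rightarrow> nat \<Rightarrow> aexp" where
  "hahn_C a b l = (Const 2 \<otimes> nat_const l \<oplus> hahn_s a b \<oplus> Const 1)
     \<oslash> ((nat_const l \<oplus> hahn_s a b) \<otimes> (Const 2 \<otimes> nat_const l \<oplus> hahn_s a b \<ominus> Const 1))"

definition hahn_D :: "aexp \<Rightarrow> aexp \<Rightarrow> aexp \<Rightarrow> nat \<Rightarrow> aexp" where
  "hahn_D a b M l = (if l = 0 then Const 0 else
     hahn_C a b l \<otimes> nat_const l \<otimes> (nat_const l \<oplus> M \<oplus> hahn_s a b) \<otimes> (nat_const l \<oplus> b))"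

definition hahn_E :: "aexp \<Rightarrow> aexp \<Rightarrow> nat \<Rightarrow> aexp" where
  "hahn_E a M l = (nat_const l \<oplus> a \<oplus> Const 1) \<otimes> (M \<ominus> nat_const l)"

definition hahn_A :: "aexp \<Rightarrow> aexp \<Rightarrow> aexp \<Rightarrow> aexp \<Rightarrow> nat \<Rightarrow> aexp" where
  "hahn_A t a b M l =
     (if l = 0 then (a \<oplus> b \<oplus> Const 2) \<otimes> t \<ominus> (a \<oplus> Const 1) \<otimes> M
      else hahn_C a b l \<otimes> poch_exp (Const 2 \<otimes> nat_const l \<oplus> hahn_s a b \<ominus> Const 1) 2 \<otimes> t
             \<ominus> hahn_D a b M l \<ominus> hahn_E a M l)"

text \<open>Clenshaw's algorithm uses the following coefficient for \<open>l \<ge> 1\<close> only.\<close>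

definition hahn_B :: "aexp \<Rightarrow> aexp \<Rightarrow> aexp \<Rightarrow> nat \<Rightarrow> aexp" where
  "hahn_B a b M l = Const 0 \<ominus> hahn_D a b M l \<otimes> hahn_E a M (l - 1)"

text \<open>Leaves the sum of \<open>\<gamma> i\<close> times the \<open>i\<close>-th Hahn polynomial, \<open>i \<le> N\<close>, in \<open>Acc 0\<close>.\<close>

definition clenshaw_hahn ::
  "nat \<Rightarrow> (nat \<Rightarrow> aexp) \<Rightarrow> aexp \<Rightarrow> aexp \<Rightarrow> aexp \<Rightarrow> aexp \<Rightarrow> stmt list" where
  "clenshaw_hahn N \<gamma> t a b M =
     [Acc (N + 1) \<leftarrow> Const 0, Acc (N + 2) \<leftarrow> Const 0] @
     loop (rev [0..<N + 1]) (\<lambda>i.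
       [Acc i \<leftarrow> \<gamma> i \<oplus> hahn_A t a b M i \<otimes> Var (Acc (i + 1))
                  \<oplus> hahn_B a b M (i + 1) \<otimes> Var (Acc (i + 2))])"


section \<open>The procedure\<close>

abbreviation abs_alpha :: aexp where
  "abs_alpha \<equiv> Var Alpha1 \<oplus> Var Alpha2 \<oplus> Var Alpha3"

definition c_star_exp :: "nat \<Rightarrow> nat \<Rightarrow> nat \<Rightarrow> aexp" where
  "c_star_exp n l1 i =
     (if i = 0 then
        poch_exp (Var Alpha1 \<oplus> Const 2) n
          \<oslash> poch_exp (Var Alpha2 \<oplus> Var Alpha3 \<oplus> Const 2) (n - l1)
      else
        power_exp (Const (- 1)) i
          \<otimes> ((Const 2 \<otimes> nat_const i \<oplus> Var Alpha2 \<oplus> Var Alpha3 \<oplus> Const 1)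
               \<otimes> poch_exp (Var Alpha1 \<oplus> Const 2) (n - i)
               \<otimes> poch_exp (abs_alpha \<oplus> nat_const n \<oplus> Const 3) i)
          \<oslash> (fact_exp i \<otimes> poch_exp (Var Alpha3 \<oplus> Const 1) i
               \<otimes> poch_exp (Var Alpha2 \<oplus> Var Alpha3 \<oplus> nat_const i \<oplus> Const 1) (n - l1 + 1)))"

definition step1 :: "nat \<Rightarrow> stmt list" where
  "step1 n =
     loop [0..<n + 1] (\<lambda>l1. loop [0..<n - l1 + 1] (\<lambda>l2.
       clenshaw_hahn (n - l1) (c_star_exp n l1)
         (nat_const l2) (Var Alpha2) (Var Alpha3) (nat_const (n - l1)) @
       [Coef (0, 0) (l1, l2) \<leftarrow>
          power_exp (Const (- 1)) l1 \<otimes> poch_exp (abs_alpha \<oplus> Const 3) n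
            \<oslash> (fact_exp n \<otimes> poch_exp (Var Alpha1 \<oplus> Const 2) l1) \<otimes> Var (Acc 0),
        Coef (l1, l2) (0, 0) \<leftarrow> Var (Coef (0, 0) (l1, l2))]))"

text \<open>The vectors \<open>t\<close>, \<open>k\<close>, \<open>l\<close>, \<open>v\<close> are integer ones, because indices such as \<open>k - v\<close> can leave
  the index set through negative components.\<close>

definition sigma0 :: "nat \<Rightarrow> int \<times> int \<Rightarrow> aexp" where
  "sigma0 n t = (Const (fst t) \<oplus> Const (snd t) \<ominus> nat_const n)
     \<otimes> (Const (snd t) \<oplus> Var Alpha2 \<oplus> Const 1)"

definition sigma2 :: "nat \<Rightarrow> int \<times> int \<Rightarrow> aexp" where
  "sigma2 n t = Const (snd t)
     \<otimes> (Const (fst t) \<oplus> Const (snd t) \<ominus> Var Alpha3 \<ominus> nat_const n \<ominus> Const 1)"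

definition sigma1 :: "nat \<Rightarrow> int \<times> int \<Rightarrow> aexp" where
  "sigma1 n t = sigma0 n t \<oplus> sigma2 n t"

definition tau0 :: "nat \<Rightarrow> int \<times> int \<Rightarrow> aexp" where
  "tau0 n t = (Const (fst t) \<oplus> Const (snd t) \<ominus> nat_const n)
     \<otimes> (Const (fst t) \<oplus> Var Alpha1 \<oplus> Const 1)"

definition tau2 :: "nat \<Rightarrow> int \<times> int \<Rightarrow> aexp" where
  "tau2 n t = Const (fst t)
     \<otimes> (Const (fst t) \<oplus> Const (snd t) \<ominus> Var Alpha3 \<ominus> nat_const n \<ominus> Const 1)"

definition tau1 :: "nat \<Rightarrow> int \<times> int \<Rightarrow> aexp" where
  "tau1 n t = tau0 n t \<oplus> tau2 n t"

definition in_idx :: "nat \<Rightarrow> int \<times> int \<Rightarrow> bool" where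
  "in_idx n k \<longleftrightarrow> 0 \<le> fst k \<and> 0 \<le> snd k \<and> fst k + snd k \<le> int n"

definition nat_pair :: "int \<times> int \<Rightarrow> nat \<times> nat" where
  "nat_pair k = (nat (fst k), nat (snd k))"

definition entry :: "nat \<Rightarrow> int \<times> int \<Rightarrow> int \<times> int \<Rightarrow> aexp" where
  "entry n k l = (if in_idx n k \<and> in_idx n l then Var (Coef (nat_pair k) (nat_pair l)) else Const 0)"

definition recurrence ::
  "nat \<Rightarrow> (int \<times> int \<Rightarrow> aexp) \<Rightarrow> (int \<times> int \<Rightarrow> aexp) \<Rightarrow> (int \<times> int \<Rightarrow> aexp)
     \<Rightarrow> int \<times> int \<Rightarrow> int \<times> int \<Rightarrow> int \<times> int \<Rightarrow> aexp" where
  "recurrence n c0 c1 c2 v k l =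
     ((c1 k \<ominus> c1 l) \<otimes> entry n k l \<ominus> c2 k \<otimes> entry n (k - v) l
        \<oplus> c0 l \<otimes> entry n k (l + v) \<oplus> c2 l \<otimes> entry n k (l - v)) \<oslash> c0 k"

definition step2 :: "nat \<Rightarrow> stmt list" where
  "step2 n =
     loop [0..<n] (\<lambda>k1.
       loop [0..<n - k1] (\<lambda>k2. loop [k1..<n + 1] (\<lambda>l1. loop [0..<n - l1 + 1] (\<lambda>l2.
         [Coef (k1, k2 + 1) (l1, l2) \<leftarrow>
            recurrence n (sigma0 n) (sigma1 n) (sigma2 n) (0, 1)
              (int k1, int k2) (int l1, int l2),
          Coef (l1, l2) (k1, k2 + 1) \<leftarrow> Var (Coef (k1, k2 + 1) (l1, l2))]))) @
       loop [k1 + 1..<n + 1] (\<lambda>l1. loop [0..<n - l1 + 1] (\<lambda>l2.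
         [Coef (k1 + 1, 0) (l1, l2) \<leftarrow>
            recurrence n (tau0 n) (tau1 n) (tau2 n) (1, 0)
              (int k1, 0) (int l1, int l2),
          Coef (l1, l2) (k1 + 1, 0) \<leftarrow> Var (Coef (k1 + 1, 0) (l1, l2))])))"

definition procedure :: "nat \<Rightarrow> stmt list" where
  "procedure n = step1 n @ step2 n"

end

theory Submission
  imports Defs
begin

text \<open>
  Write \<open>G\<close> for the Gram matrix of the Bernstein basis. Integrating a product of two Bernstein
  polynomials is a Dirichlet integral, so the entries of \<open>G\<close> are explicit products of Pochhammer
  symbols, and the Bezier coefficients of the dual basis are the entries of the inverse of \<open>G\<close>
  (\<open>dual_bernstein_iff\<close>, \<open>bezier_form_iff\<close>). From there on the argument is finite linear algebra.

  The recurrences of Step 2 say that the tridiagonal operator \<open>L\<close> with entries \<open>\<sigma>\<^sub>0\<close>, \<open>- \<sigma>\<^sub>1\<close>, \<open>\<sigma>\<^sub>2\<close> has the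
  same effect on the upper and on the lower index of the inverse. Equivalently \<open>L\<close> is self-adjoint
  with respect to \<open>G\<close>, and for the explicit \<open>G\<close> this is a short rational identity whose right-hand side is
  visibly symmetric (\<open>tridiag_adj_gram\<close>). The coefficients \<open>\<tau>\<close> arise by exchanging the two coordinates.

  Self-adjointness also gives the invertibility of \<open>G\<close>: a row vector \<open>c\<close> with \<open>c G = \<delta>\<^sub>k\<close> and one for the
  predecessor of \<open>k\<close> yield one for its successor (\<open>dual_row_step\<close>), so it suffices to have a row for the
  vertex index \<open>(0, 0)\<close>; a left inverse of a symmetric matrix is then symmetric and unique
  (\<open>dual_row_transpose\<close>).

  The row for \<open>(0, 0)\<close> is the formula of Step 1. The dual polynomial of index \<open>(0, 0)\<close> is the reproducing
  kernel at a vertex of the triangle, and the formula is its expansion in products of univariate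
  Jacobi polynomials. It is verified by pairing with \<open>x\<^sub>1\<^sup>k x\<^sub>2\<^sup>j (1 - x\<^sub>1)\<^bsup>n - k - j\<^esup>\<close> instead of the
  Bernstein basis (\<open>vertex_moment\<close>). For these test functions the sum over \<open>l\<^sub>2\<close> is evaluated by the
  Vandermonde and the Pfaff--Saalschuetz summations (\<open>hahn_moment\<close>), the sum over \<open>l\<^sub>1\<close> is a finite difference
  of a polynomial (\<open>alt_sum_poly\<close>) or of a polynomial over a linear factor
  (\<open>alt_sum_poly_over_linear\<close>), and the remaining sum over \<open>i\<close> telescopes (\<open>kernel_weight_delta\<close>).

  On the program side every assignment to an entry stores a true coefficient, so it only has to be tracked which entries
  are already available: before the pass for \<open>k\<^sub>1\<close>, all rows \<open>(j, 0)\<close> with \<open>j \<le> k\<^sub>1\<close> are known at the lower indices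
  whose first component is at least \<open>j\<close>, and symmetrically. Clenshaw's algorithm is
  justified by the three-term recurrence of the Hahn polynomials (\<open>hahn_recurrence\<close>). For the cost, the first
  recurrence of Step 2 is executed at least \<open>n\<^sup>4 / 8\<close> times, and crude bounds on the loops give the same order from above.
\<close>

section \<open>Finite differences and a summation of Pfaff and Saalschuetz\<close>

lemma pascal_sum:
  fixes f :: "nat \<Rightarrow> real"
  shows "(\<Sum>k\<le>Suc n. real (Suc n choose k) * f k)
       = (\<Sum>k\<le>n. real (n choose k) * f k) + (\<Sum>k\<le>n. real (n choose k) * f (Suc k))"
proof -
  have "(\<Sum>k\<le>Suc n. real (Suc n choose k) * f k)
      = f 0 + (\<Sum>k\<le>n. real (n choose Suc k) * f (Suc k)) + (\<Sum>k\<le>n. real (n choose k) * f (Suc k))"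
    by (subst sum.atMost_Suc_shift) (simp add: sum.distrib algebra_simps)
  also have "f 0 + (\<Sum>k\<le>n. real (n choose Suc k) * f (Suc k)) = (\<Sum>k\<le>Suc n. real (n choose k) * f k)"
    by (subst sum.atMost_Suc_shift) simp
  also have "\<dots> = (\<Sum>k\<le>n. real (n choose k) * f k)" by simp
  finally show ?thesis .
qed

definition alt_sum :: "nat \<Rightarrow> (nat \<Rightarrow> real) \<Rightarrow> real" where
  "alt_sum n f = (\<Sum>k\<le>n. real (n choose k) * ((- 1) ^ k * f k))"

lemma alt_sum_Suc: "alt_sum (Suc n) f = alt_sum n f - alt_sum n (\<lambda>k. f (Suc k))"
  unfolding alt_sum_def by (subst pascal_sum) (simp add: sum_negf)

lemma alt_sum_diff: "alt_sum n f - alt_sum n g = alt_sum n (\<lambda>k. f k - g k)"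
  unfolding alt_sum_def by (simp add: sum_subtractf algebra_simps)

lemma alt_sum_cmult: "alt_sum n (\<lambda>k. c * f k) = c * alt_sum n f"
  unfolding alt_sum_def by (simp add: sum_distrib_left algebra_simps)

lemma degree_shift_diff_less:
  fixes p :: "real poly"
  assumes "degree p > 0"
  shows "degree (p - pcompose p [:1, 1:]) < degree p"
proof (cases "p - pcompose p [:1, 1:] = 0")
  case True
  then show ?thesis using assms by (simp only: degree_0)
next
  case False
  show ?thesis
  proof (rule degree_less_if_less_eqI[OF _ _ False])
  show "degree (p - pcompose p [:1, 1:]) \<le> degree p"
    by (rule degree_diff_le) (simp_all add: degree_pcompose)
  show "coeff (p - pcompose p [:1, 1:]) (degree p) = 0"
    using lead_coeff_comp[of "[:1, 1:]" p] by (simp add: degree_pcompose)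
  qed
qed

text \<open>
  Each finite difference lowers the degree, so a difference of order above the degree vanishes.
\<close>

lemma alt_sum_poly: "degree p < n \<Longrightarrow> alt_sum n (\<lambda>k. poly p (real k)) = 0"
proof (induction n arbitrary: p)
  case 0
  then show ?case by simp
next
  case (Suc n)
  let ?q = "p - pcompose p [:1, 1:]"
  have "alt_sum (Suc n) (\<lambda>k. poly p (real k)) = alt_sum n (\<lambda>k. poly ?q (real k))"
    by (simp add: alt_sum_Suc alt_sum_diff poly_pcompose add_ac)
  also have "\<dots> = 0"
  proof (cases "degree p = 0")
    case True
    then obtain c where "p = [:c:]" by (rule degree_eq_zeroE)
    then show ?thesis by (simp add: alt_sum_def)
  next
    case False
    then show ?thesis using Suc.prems degree_shift_diff_less[of p] by (intro Suc.IH) simp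
  qed
  finally show ?case .
qed

text \<open>
  The partial fraction decomposition of \<open>fact n / pochhammer x (Suc n)\<close>.
\<close>

lemma alt_sum_reciprocal:
  "x > 0 \<Longrightarrow> alt_sum n (\<lambda>k. 1 / (x + real k)) = fact n / pochhammer x (Suc n)"
proof (induction n arbitrary: x)
  case 0
  then show ?case by (simp add: alt_sum_def)
next
  case (Suc n)
  have pos: "pochhammer (x + 1) n > 0" using Suc.prems by (intro pochhammer_pos) simp
  have "alt_sum (Suc n) (\<lambda>k. 1 / (x + real k))
      = fact n / pochhammer x (Suc n) - fact n / pochhammer (x + 1) (Suc n)"
    using Suc.IH[of x] Suc.IH[of "x + 1"] Suc.prems by (simp add: alt_sum_Suc add_ac)
  also have "\<dots> = fact (Suc n) / pochhammer x (Suc (Suc n))"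
  proof -
    have 1: "pochhammer x (Suc n) = x * pochhammer (x + 1) n" by (rule pochhammer_rec)
    have 2: "pochhammer (x + 1) (Suc n) = pochhammer (x + 1) n * (x + 1 + n)" by (rule pochhammer_Suc)
    have 3: "pochhammer x (Suc (Suc n)) = x * (pochhammer (x + 1) n * (x + 1 + n))"
      by (subst pochhammer_rec) (simp add: pochhammer_Suc)
    show ?thesis unfolding 1 2 3 using pos Suc.prems by (simp add: divide_simps) (simp add: algebra_simps)
  qed
  finally show ?case .
qed

text \<open>
  Division with remainder by \<open>x + k\<close>: the quotient has too small a degree to contribute, which leaves
  the remainder, the value at \<open>- x\<close>, times the partial fraction sum.
\<close>

lemma alt_sum_poly_over_linear:
  assumes "x > 0" "degree q \<le> n"
  shows "alt_sum n (\<lambda>k. poly q (real k) / (x + real k)) = poly q (- x) * fact n / pochhammer x (Suc n)"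
proof -
  define r where "r = synthetic_div q (- x)"
  have q: "[:x, 1:] * r + [:poly q (- x):] = q"
    using synthetic_div_correct'[of "- x" q] by (simp add: r_def)
  have eq: "poly q (real k) / (x + real k) - poly q (- x) * (1 / (x + real k)) = poly r (real k)" for k
  proof -
    have "poly q (real k) = (x + real k) * poly r (real k) + poly q (- x)"
      by (subst q[symmetric]) (simp add: algebra_simps)
    then show ?thesis using assms by (simp add: divide_simps)
  qed
  have "alt_sum n (\<lambda>k. poly r (real k)) = 0"
  proof (cases n)
    case 0
    then have "r = 0" using assms by (simp add: r_def synthetic_div_eq_0_iff)
    then show ?thesis by (simp add: alt_sum_def)
  next
    case (Suc m)
    then show ?thesis using assms by (intro alt_sum_poly) (simp add: r_def degree_synthetic_div)
  qed
  then have "alt_sum n (\<lambda>k. poly q (real k) / (x + real k)) = poly q (- x) * alt_sum n (\<lambda>k. 1 / (x + real k))"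
    unfolding eq[symmetric] alt_sum_diff[symmetric] alt_sum_cmult by simp
  then show ?thesis using assms by (simp add: alt_sum_reciprocal)
qed

text \<open>
  A rising factorial of an affine function is a polynomial; this supplies the degree bounds for the
  finite differences.
\<close>

lemma pochhammer_polynomial:
  fixes p :: "real poly"
  assumes "degree p \<le> 1"
  shows "poly (pochhammer p k) x = pochhammer (poly p x) k \<and> degree (pochhammer p k) \<le> k"
proof (induction k)
  case 0
  then show ?case by simp
next
  case (Suc k)
  have "degree (p + of_nat k) \<le> 1" using assms by (intro degree_add_le) simp_all
  moreover have "degree (pochhammer p k * (p + of_nat k)) \<le> degree (pochhammer p k) + degree (p + of_nat k)"
    by (rule degree_mult_le)
  ultimately show ?case using Suc by (simp add: pochhammer_Suc)
qed

text \<open>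
  Multiplying the classical terminating \<open>\<^sub>3F\<^sub>2\<close> summation by its denominators turns it into an identity that holds
  without restrictions on \<open>a\<close>, \<open>b\<close>, \<open>c\<close>. Writing \<open>P n c\<close> for the sum, Pascal's rule gives \<open>P (n + 1) c\<close> in terms of
  \<open>P n c\<close> and \<open>P (n - 1) (c + 1)\<close>, hence the strong induction.
\<close>

theorem pfaff_saalschuetz:
  fixes a b c :: real
  shows "(\<Sum>k\<le>n. real (n choose k) * (pochhammer a k * pochhammer b k
            * pochhammer (c + real k) (n - k) * pochhammer (c - a - b) (n - k)))
       = pochhammer (c - a) n * pochhammer (c - b) n"
proof (induction n arbitrary: c rule: less_induct)
  case (less N)
  define P where "P = (\<lambda>n c. \<Sum>k\<le>n. real (n choose k) * (pochhammer a k * pochhammer b k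
            * pochhammer (c + real k) (n - k) * pochhammer (c - a - b) (n - k)))"
  have IH: "P n c = pochhammer (c - a) n * pochhammer (c - b) n" if "n < N" for n c
    using less.IH[OF that] by (simp add: P_def)
  show ?case
  proof (cases N)
    case 0
    then show ?thesis by simp
  next
    case (Suc n)
    define d where "d = c - a - b"
    define u where "u = (\<lambda>k. real (n choose k) * (pochhammer a k * pochhammer b k))"
    define w where "w = (\<lambda>k. pochhammer (c + 1 + real k) (n - k) * pochhammer d (n - k))"
    have "P (Suc n) c = (\<Sum>k\<le>n. u k * (pochhammer (c + real k) (Suc n - k) * pochhammer d (Suc n - k)))
       + (\<Sum>k\<le>n. u k * ((a + k) * (b + k) * w k))"
      unfolding P_def by (subst pascal_sum) (simp add: u_def w_def d_def pochhammer_Suc mult_ac add_ac)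
    also have "(\<Sum>k\<le>n. u k * (pochhammer (c + real k) (Suc n - k) * pochhammer d (Suc n - k)))
       = (\<Sum>k\<le>n. u k * ((c + k) * (d + real (n - k)) * w k))"
    proof (rule sum.cong[OF refl])
      fix k assume "k \<in> {..n}"
      then have "Suc n - k = Suc (n - k)" by simp
      then show "u k * (pochhammer (c + real k) (Suc n - k) * pochhammer d (Suc n - k))
          = u k * ((c + k) * (d + real (n - k)) * w k)"
        by (simp add: w_def pochhammer_rec[of "c + real k"] pochhammer_rec'[of d] mult_ac add_ac)
    qed
    also have "\<dots> + (\<Sum>k\<le>n. u k * ((a + k) * (b + k) * w k))
       = (\<Sum>k\<le>n. u k * (((c - a) * (c - b) + n * (c + k)) * w k))"
      unfolding sum.distrib[symmetric]
    proof (rule sum.cong[OF refl])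
      fix k assume "k \<in> {..n}"
      then have "real (n - k) = real n - real k" by (simp add: of_nat_diff)
      then have "(c + k) * (d + real (n - k)) + (a + k) * (b + k) = (c - a) * (c - b) + n * (c + k)"
        by (simp add: d_def algebra_simps)
      then show "u k * ((c + k) * (d + real (n - k)) * w k) + u k * ((a + k) * (b + k) * w k)
         = u k * (((c - a) * (c - b) + n * (c + k)) * w k)"
        by (metis distrib_left distrib_right)
    qed
    also have "\<dots> = (\<Sum>k\<le>n. u k * ((c - a) * (c - b) * (w k - pochhammer (c + real k) (n - k) * pochhammer d (n - k)))
        + u k * (((c - a) * (c - b) + n * (c + n)) * (pochhammer (c + real k) (n - k) * pochhammer d (n - k))))"
    proof (rule sum.cong[OF refl])
      fix k assume k: "k \<in> {..n}"
      have "(c + k) * pochhammer (c + 1 + real k) (n - k) = pochhammer (c + real k) (Suc (n - k))"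
        by (simp add: pochhammer_rec[of "c + real k"] add_ac)
      also have "\<dots> = (c + n) * pochhammer (c + real k) (n - k)"
        using k by (simp add: pochhammer_Suc of_nat_diff)
      finally have "(c + k) * w k = (c + n) * (pochhammer (c + real k) (n - k) * pochhammer d (n - k))"
        by (simp add: w_def)
      then show "u k * (((c - a) * (c - b) + n * (c + k)) * w k) =
          u k * ((c - a) * (c - b) * (w k - pochhammer (c + real k) (n - k) * pochhammer d (n - k)))
        + u k * (((c - a) * (c - b) + n * (c + n)) * (pochhammer (c + real k) (n - k) * pochhammer d (n - k)))"
        by algebra
    qed
    also have "\<dots> = (c - a) * (c - b) * (\<Sum>k\<le>n. u k * (w k - pochhammer (c + real k) (n - k) * pochhammer d (n - k)))
        + ((c - a) * (c - b) + n * (c + n)) * P n c"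
      unfolding P_def u_def d_def[symmetric] by (simp add: sum.distrib sum_distrib_left mult_ac)
    also have "(\<Sum>k\<le>n. u k * (w k - pochhammer (c + real k) (n - k) * pochhammer d (n - k)))
       = n * d * (if n = 0 then 1 else P (n - 1) (c + 1))"
    proof (cases n)
      case 0
      then show ?thesis by (simp add: w_def)
    next
      case (Suc m)
      have "u k * (w k - pochhammer (c + real k) (n - k) * pochhammer d (n - k))
         = n * d * (real (m choose k) * (pochhammer a k * pochhammer b k
            * pochhammer (c + 1 + real k) (m - k) * pochhammer (c + 1 - a - b) (m - k)))" if k: "k \<le> m" for k
      proof -
        have e: "n - k = Suc (m - k)" using Suc k by simp
        have "pochhammer (c + 1 + real k) (n - k) - pochhammer (c + real k) (n - k)
            = real (n - k) * pochhammer (c + 1 + real k) (m - k)"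
          unfolding e pochhammer_rec[of "c + real k"] pochhammer_Suc[of "c + 1 + real k"]
          using k by (simp add: add_ac of_nat_diff algebra_simps)
        moreover have "pochhammer d (n - k) = d * pochhammer (c + 1 - a - b) (m - k)"
          unfolding e pochhammer_rec[of d] by (simp add: d_def algebra_simps)
        moreover have "real (n choose k) * real (n - k) = n * real (m choose k)"
          unfolding of_nat_mult[symmetric]
          using binomial_absorb_comp[of n k] Suc by (simp add: mult_ac)
        ultimately show ?thesis
          by (simp add: w_def u_def left_diff_distrib[symmetric])
      qed
      then show ?thesis using Suc by (simp add: P_def sum_distrib_left w_def)
    qed
    also have "(c - a) * (c - b) * (n * d * (if n = 0 then 1 else P (n - 1) (c + 1))) = n * d * P n c"
    proof (cases n)
      case 0
      then show ?thesis by simp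
    next
      case (Suc m)
      then show ?thesis using \<open>N = Suc n\<close>
        by (simp add: IH pochhammer_rec[of "c - a"] pochhammer_rec[of "c - b"] algebra_simps)
    qed
    also have "n * d * P n c + ((c - a) * (c - b) + n * (c + n)) * P n c
       = (c - a + n) * (c - b + n) * P n c"
      by (simp add: d_def algebra_simps)
    also have "\<dots> = pochhammer (c - a) N * pochhammer (c - b) N"
      using Suc by (simp add: IH pochhammer_Suc)
    finally show ?thesis unfolding Suc P_def .
  qed
qed

section \<open>Moments of Hahn polynomials\<close>

lemma finite_idx: "finite (idx n)"
  by (rule finite_subset[of _ "{..n} \<times> {..n}"]) (auto simp: idx_def)

lemma idx_Sigma: "idx n = Sigma {..n} (\<lambda>k1. {..n - k1})"
  by (auto simp: idx_def)

lemma sum_idx: "(\<Sum>l\<in>idx n. f l) = (\<Sum>l1\<le>n. \<Sum>l2\<le>n - l1. f (l1, l2))"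
  by (simp add: idx_Sigma sum.Sigma)

lemma sum_idx_swap: "(\<Sum>l\<in>idx n. f l) = (\<Sum>l2\<le>n. \<Sum>l1\<le>n - l2. f (l1, l2))"
proof -
  have "(\<Sum>l\<in>idx n. f l) = (\<Sum>l\<in>idx n. f (prod.swap l))"
    by (rule sum.reindex_bij_witness[of _ prod.swap prod.swap]) (auto simp: idx_def)
  then show ?thesis by (simp add: sum_idx)
qed

lemma pochhammer_neg_ratio: "r \<le> M \<Longrightarrow> pochhammer (- real M) r = (- 1) ^ r * fact M / fact (M - r)"
proof (induction r)
  case 0
  then show ?case by simp
next
  case (Suc r)
  then have e: "M - r = Suc (M - Suc r)" by simp
  define d where "d = real (M - r)"
  have "- real M + real r = - d" using Suc by (simp add: d_def of_nat_diff)
  moreover have "fact (M - r) = d * fact (M - Suc r)" unfolding d_def e by simp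
  moreover have "d \<noteq> 0" using Suc by (simp add: d_def)
  ultimately show ?case using Suc by (simp add: pochhammer_Suc)
qed

text \<open>
  The upper limit \<open>N\<close> may exceed \<open>i\<close>, because the terms beyond \<open>i\<close> vanish; a common limit allows Hahn polynomials
  of different degrees to be compared term by term.
\<close>

lemma hahn_finite_sum:
  assumes "i \<le> N"
  shows "hahn i t a b M = pochhammer (a + 1) i * pochhammer (- M) i *
     (\<Sum>r\<le>N. pochhammer (- real i) r * pochhammer (real i + a + b + 1) r * pochhammer (- t) r
            / (pochhammer (a + 1) r * pochhammer (- M) r * fact r))"
proof -
  have "hypergeo_3F2 (- real i) (real i + a + b + 1) (- t) (a + 1) (- M) 1
      = (\<Sum>r\<le>N. pochhammer (- real i) r * pochhammer (real i + a + b + 1) r * pochhammer (- t) r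
            / (pochhammer (a + 1) r * pochhammer (- M) r) * 1 ^ r / fact r)"
    unfolding hypergeo_3F2_def using assms
    by (intro suminf_finite) (auto simp: pochhammer_of_nat_eq_0_lemma)
  then show ?thesis by (simp add: hahn_def)
qed

text \<open>
  The instance of the Pfaff--Saalschuetz summation that evaluates the moments of Hahn polynomials. The factor
  \<open>pochhammer (- real j) i\<close> on the right is the orthogonality relation: it vanishes for \<open>j < i\<close>.
\<close>

lemma saalschuetz_hahn:
  fixes a b :: real
  assumes "a > - 1" "b > - 1"
  shows "(\<Sum>r\<le>i. pochhammer (- real i) r * pochhammer (real i + a + b + 1) r * pochhammer (a + 1 + real j) r
            / (pochhammer (a + 1) r * fact r * pochhammer (a + b + 2 + real j) r))
       = pochhammer (b + 1) i * pochhammer (- real j) i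
            / (pochhammer (a + 1) i * pochhammer (a + b + 2 + real j) i)" (is "?S = _")
proof -
  define A where "A = real i + a + b + 1"
  define B where "B = a + 1 + real j"
  define e where "e = a + b + 2 + real j"
  have pa: "pochhammer (a + 1) r > 0" for r using assms by (intro pochhammer_pos) simp
  have pe: "pochhammer e r > 0" for r using assms by (intro pochhammer_pos) (simp add: e_def)
  have "real (i choose r) * (pochhammer A r * pochhammer B r
            * pochhammer (a + 1 + real r) (i - r) * pochhammer (a + 1 - A - B) (i - r))
     = (pochhammer (- real i) r * pochhammer A r * pochhammer B r
            / (pochhammer (a + 1) r * fact r * pochhammer e r)) * ((- 1) ^ i * pochhammer (a + 1) i * pochhammer e i)"
    if r: "r \<le> i" for r
  proof -
    have 1: "pochhammer (a + 1) i = pochhammer (a + 1) r * pochhammer (a + 1 + real r) (i - r)"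
      using r by (rule pochhammer_product)
    have 2: "pochhammer e i = pochhammer e r * pochhammer (e + real r) (i - r)"
      using r by (rule pochhammer_product)
    have arg: "a + 1 - A - B = - (e + real i - 1)" "e + real i - 1 - real (i - r) + 1 = e + real r"
      using r by (simp_all add: A_def B_def e_def of_nat_diff)
    have 3: "pochhammer (a + 1 - A - B) (i - r) = (- 1) ^ (i - r) * pochhammer (e + real r) (i - r)"
      unfolding arg(1) pochhammer_minus arg(2) ..
    have 4: "real (i choose r) = fact i / (fact r * fact (i - r))"
      using r by (rule binomial_fact)
    have 5: "(- 1 :: real) ^ i = (- 1) ^ r * (- 1) ^ (i - r)"
      using r by (simp add: power_add[symmetric])
    have 6: "(- 1 :: real) ^ r * (- 1) ^ r = 1" by (simp add: power_add[symmetric] flip: mult_2)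
    show ?thesis unfolding pochhammer_neg_ratio[OF r] 1 2 3 4 5
      using pa[of r] pe[of r] 6 by (simp add: field_simps)
  qed
  then have "?S * ((- 1) ^ i * pochhammer (a + 1) i * pochhammer e i)
      = (\<Sum>r\<le>i. real (i choose r) * (pochhammer A r * pochhammer B r
            * pochhammer (a + 1 + real r) (i - r) * pochhammer (a + 1 - A - B) (i - r)))"
    by (simp add: sum_distrib_right A_def[symmetric] B_def[symmetric] e_def[symmetric])
  also have "\<dots> = pochhammer (a + 1 - A) i * pochhammer (a + 1 - B) i"
    by (rule pfaff_saalschuetz)
  also have "a + 1 - A = - (b + real i)" by (simp add: A_def)
  also have "pochhammer (- (b + real i)) i = (- 1) ^ i * pochhammer (b + 1) i"
    unfolding pochhammer_minus by simp
  also have "a + 1 - B = - real j" by (simp add: B_def)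
  finally have "?S * (pochhammer (a + 1) i * pochhammer e i) = pochhammer (b + 1) i * pochhammer (- real j) i"
    by (simp add: mult_ac)
  then show ?thesis using pa[of i] pe[of i] unfolding e_def by (simp add: field_simps)
qed

lemma shifted_vandermonde:
  fixes x y :: real
  assumes "r \<le> M"
  shows "(\<Sum>l=r..M. pochhammer x l * pochhammer y (M - l) / (fact (l - r) * fact (M - l)))
     = pochhammer x r * pochhammer (x + real r + y) (M - r) / fact (M - r)"
proof -
  have "(\<Sum>l=r..M. pochhammer x l * pochhammer y (M - l) / (fact (l - r) * fact (M - l)))
     = (\<Sum>u\<le>M - r. pochhammer x (u + r) * pochhammer y (M - (u + r)) / (fact u * fact (M - (u + r))))"
    by (rule sum.reindex_bij_witness[of _ "\<lambda>u. u + r" "\<lambda>l. l - r"]) (use assms in auto)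
  also have "\<dots> = (\<Sum>u\<le>M - r. pochhammer x r / fact (M - r) *
       (real ((M - r) choose u) * pochhammer (x + real r) u * pochhammer y (M - r - u)))"
  proof (rule sum.cong[OF refl])
    fix u assume u: "u \<in> {..M - r}"
    then have c: "real ((M - r) choose u) = fact (M - r) / (fact u * fact (M - r - u))"
      by (simp add: binomial_fact)
    have e: "M - (u + r) = M - r - u" by simp
    have p: "pochhammer x (u + r) = pochhammer x r * pochhammer (x + real r) u"
      using pochhammer_product'[of x r u] by (simp add: add_ac)
    show "pochhammer x (u + r) * pochhammer y (M - (u + r)) / (fact u * fact (M - (u + r)))
       = pochhammer x r / fact (M - r) *
       (real ((M - r) choose u) * pochhammer (x + real r) u * pochhammer y (M - r - u))"
      unfolding c e p by simp
  qed
  also have "\<dots> = pochhammer x r * pochhammer (x + real r + y) (M - r) / fact (M - r)"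
    unfolding sum_distrib_left[symmetric] pochhammer_binomial_sum[symmetric] by simp
  finally show ?thesis .
qed

text \<open>
  Up to normalisation this is the integral of a Jacobi polynomial of degree \<open>i\<close>, raised to Bernstein degree \<open>M\<close>, against
  the \<open>j\<close>-th power of the variable. The Vandermonde summation disposes of \<open>l\<close>, after which the hypergeometric
  series has the Saalschuetz form.
\<close>

lemma hahn_moment:
  fixes a b :: real
  assumes ab: "a > - 1" "b > - 1" and iM: "i \<le> M"
  shows "(\<Sum>l\<le>M. hahn i (real l) a b (real M) * pochhammer (a + 1) (l + j) * pochhammer (b + 1) (M - l)
            / (fact l * fact (M - l)))
     = pochhammer (- real M) i / fact M * pochhammer (a + b + 2) (M + j)
        * pochhammer (a + 1) j * pochhammer (b + 1) i * pochhammer (- real j) i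
        / pochhammer (a + b + 2) (j + i)" (is "?S = _")
proof -
  have pa: "pochhammer (a + 1) r > 0" for r using ab by (intro pochhammer_pos) simp
  have ps: "pochhammer (a + b + 2) r > 0" for r using ab by (intro pochhammer_pos) simp
  have ps': "pochhammer (a + b + 2 + real j) r > 0" for r using ab by (intro pochhammer_pos) simp
  define c where "c = pochhammer (a + 1) i * pochhammer (- real M) i"
  define g where "g = (\<lambda>r. pochhammer (- real i) r * pochhammer (real i + a + b + 1) r
      / (pochhammer (a + 1) r * pochhammer (- real M) r * fact r))"
  have inner: "(\<Sum>l\<le>M. pochhammer (- real l) r * pochhammer (a + 1) (l + j) * pochhammer (b + 1) (M - l)
            / (fact l * fact (M - l)))
     = pochhammer (- real M) r / fact M * (pochhammer (a + 1) j * pochhammer (a + 1 + real j) r)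
        * (pochhammer (a + b + 2) (M + j) / (pochhammer (a + b + 2) j * pochhammer (a + b + 2 + real j) r))"
    (is "?T = _") if r: "r \<le> M" for r
  proof -
    have "?T = (\<Sum>l=r..M. pochhammer (- real l) r * pochhammer (a + 1) (l + j) * pochhammer (b + 1) (M - l)
            / (fact l * fact (M - l)))"
      by (rule sum.mono_neutral_right) (auto simp: pochhammer_of_nat_eq_0_lemma)
    also have "\<dots> = (\<Sum>l=r..M. (- 1) ^ r * pochhammer (a + 1) j *
         (pochhammer (a + 1 + real j) l * pochhammer (b + 1) (M - l) / (fact (l - r) * fact (M - l))))"
    proof (rule sum.cong[OF refl])
      fix l assume l: "l \<in> {r..M}"
      have p: "pochhammer (a + 1) (l + j) = pochhammer (a + 1) j * pochhammer (a + 1 + real j) l"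
        using pochhammer_product'[of "a + 1" j l] by (simp add: add_ac)
      have q: "pochhammer (- real l) r = (- 1) ^ r * fact l / fact (l - r)"
        using l by (intro pochhammer_neg_ratio) simp
      show "pochhammer (- real l) r * pochhammer (a + 1) (l + j) * pochhammer (b + 1) (M - l)
            / (fact l * fact (M - l)) = (- 1) ^ r * pochhammer (a + 1) j *
         (pochhammer (a + 1 + real j) l * pochhammer (b + 1) (M - l) / (fact (l - r) * fact (M - l)))"
        unfolding p q by simp
    qed
    also have "\<dots> = (- 1) ^ r * pochhammer (a + 1) j * (pochhammer (a + 1 + real j) r
         * pochhammer (a + 1 + real j + real r + (b + 1)) (M - r) / fact (M - r))"
      unfolding sum_distrib_left[symmetric] shifted_vandermonde[OF r] ..
    also have "pochhammer (a + 1 + real j + real r + (b + 1)) (M - r)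
       = pochhammer (a + b + 2) (M + j) / (pochhammer (a + b + 2) j * pochhammer (a + b + 2 + real j) r)"
    proof -
      have "M + j = j + (r + (M - r))" using r by simp
      then have "pochhammer (a + b + 2) (M + j) = pochhammer (a + b + 2) j
         * (pochhammer (a + b + 2 + real j) r * pochhammer (a + b + 2 + real j + real r) (M - r))"
        by (simp only: pochhammer_product')
      then show ?thesis using ps[of j] ps'[of r] by (simp add: field_simps add_ac)
    qed
    finally show ?thesis unfolding pochhammer_neg_ratio[OF r] by (simp add: mult_ac)
  qed
  have nz: "pochhammer (- real M) r \<noteq> 0" if "r \<le> i" for r
    using that iM by (simp add: pochhammer_of_nat_eq_0_iff)
  have "?S = (\<Sum>l\<le>M. \<Sum>r\<le>i. c * g r * (pochhammer (- real l) r * pochhammer (a + 1) (l + j)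
       * pochhammer (b + 1) (M - l) / (fact l * fact (M - l))))"
    unfolding hahn_finite_sum[OF order_refl] c_def[symmetric]
    by (simp add: g_def sum_distrib_left sum_distrib_right sum_divide_distrib mult_ac)
  also have "\<dots> = (\<Sum>r\<le>i. c * g r * (\<Sum>l\<le>M. pochhammer (- real l) r * pochhammer (a + 1) (l + j)
       * pochhammer (b + 1) (M - l) / (fact l * fact (M - l))))"
    by (subst sum.swap) (simp add: sum_distrib_left)
  also have "\<dots> = (\<Sum>r\<le>i. c * g r * (pochhammer (- real M) r / fact M * (pochhammer (a + 1) j * pochhammer (a + 1 + real j) r)
        * (pochhammer (a + b + 2) (M + j) / (pochhammer (a + b + 2) j * pochhammer (a + b + 2 + real j) r))))"
    using iM by (intro sum.cong refl) (simp add: inner)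
  also have "\<dots> = (\<Sum>r\<le>i. c / fact M * pochhammer (a + 1) j * pochhammer (a + b + 2) (M + j) / pochhammer (a + b + 2) j
       * (pochhammer (- real i) r * pochhammer (real i + a + b + 1) r * pochhammer (a + 1 + real j) r
            / (pochhammer (a + 1) r * fact r * pochhammer (a + b + 2 + real j) r)))"
    by (intro sum.cong refl) (use nz in \<open>simp add: g_def mult_ac\<close>)
  also have "\<dots> = c / fact M * pochhammer (a + 1) j * pochhammer (a + b + 2) (M + j) / pochhammer (a + b + 2) j
       * (pochhammer (b + 1) i * pochhammer (- real j) i
            / (pochhammer (a + 1) i * pochhammer (a + b + 2 + real j) i))"
    unfolding sum_distrib_left[symmetric] saalschuetz_hahn[OF ab] ..
  finally show ?thesis using pa[of i] by (simp add: c_def pochhammer_product')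
qed

section \<open>The reproducing kernel at a vertex\<close>

text \<open>
  The factor \<open>(2 i + s) (s)\<^sub>i / s\<close> that comes from the squared norms of Jacobi polynomials, with \<open>s\<close> cancelled so that
  \<open>s = 0\<close> is admissible.
\<close>

definition kernel_weight :: "real \<Rightarrow> nat \<Rightarrow> real" where
  "kernel_weight s i = (if i = 0 then 1 else (2 * real i + s) * pochhammer (s + 1) (i - 1))"

text \<open>
  A closed form for all partial sums, found by telescoping; the full sum \<open>N = j\<close> is the discrete orthogonality that
  makes the kernel reproduce at the vertex.
\<close>

lemma kernel_weight_sum:
  assumes "s > - 1"
  shows "(\<Sum>i\<le>N. kernel_weight s i * pochhammer (- real j) i / (fact i * pochhammer (s + 1) (j + i)))
       = pochhammer (s + 1) N * pochhammer (1 - real j) N / (fact N * pochhammer (s + 1) (j + N))"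
proof (induction N)
  case 0
  then show ?case by (simp add: kernel_weight_def)
next
  case (Suc N)
  define p where "p = pochhammer (s + 1) (j + N)"
  define q where "q = pochhammer (s + 1) N"
  define u where "u = pochhammer (1 - real j) N"
  have p: "p > 0" unfolding p_def using assms by (intro pochhammer_pos) simp
  have p': "pochhammer (s + 1) (j + Suc N) = p * (s + 1 + real j + real N)"
    by (simp add: p_def pochhammer_Suc add_ac)
  have z: "s + 1 + real j + real N > 0" using assms by linarith
  have u1: "pochhammer (- real j) (Suc N) = - real j * u" by (simp add: u_def pochhammer_rec add_ac)
  have u2: "pochhammer (1 - real j) (Suc N) = u * (1 - real j + real N)" by (simp add: u_def pochhammer_Suc)
  have q': "pochhammer (s + 1) (Suc N) = q * (s + 1 + real N)" by (simp add: q_def pochhammer_Suc)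
  have k: "kernel_weight s (Suc N) = (2 * real N + 2 + s) * q" by (simp add: kernel_weight_def q_def)
  have f: "(fact (Suc N) :: real) = (real N + 1) * fact N" by simp
  have "(\<Sum>i\<le>Suc N. kernel_weight s i * pochhammer (- real j) i / (fact i * pochhammer (s + 1) (j + i)))
     = q * u / (fact N * p)
       + (2 * real N + 2 + s) * q * (- real j * u) / ((real N + 1) * fact N * (p * (s + 1 + real j + real N)))"
    unfolding sum.atMost_Suc Suc.IH k f u1 p' q_def u_def p_def ..
  also have "\<dots> = q * u * ((real N + 1) * (s + 1 + real j + real N) - (2 * real N + 2 + s) * real j)
      / ((real N + 1) * fact N * (p * (s + 1 + real j + real N)))"
    using p z by (simp add: divide_simps) (simp add: algebra_simps)
  also have "(real N + 1) * (s + 1 + real j + real N) - (2 * real N + 2 + s) * real j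
      = (s + 1 + real N) * (1 - real j + real N)"
    by (simp add: algebra_simps)
  finally show ?case unfolding q' u2 f p' by (simp add: mult_ac)
qed

lemma kernel_weight_delta:
  assumes "s > - 1"
  shows "(\<Sum>i\<le>j. kernel_weight s i * pochhammer (- real j) i / (fact i * pochhammer (s + 1) (j + i)))
       = (if j = 0 then 1 else 0)"
proof -
  have "pochhammer (1 - real j) j = 0" if "j > 0"
    using that by (auto simp: pochhammer_eq_0_iff of_nat_diff intro!: exI[of _ "j - 1"])
  then show ?thesis unfolding kernel_weight_sum[OF assms] by auto
qed

text \<open>
  The coefficients of Step 1 in a form that is uniform in \<open>i\<close>, including \<open>i = 0\<close>.
\<close>

lemma c_star_eq:
  assumes a: "a2 > - 1" "a3 > - (1::real)" and l1: "l1 + i \<le> n"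
  shows "c_star n a1 a2 a3 l1 i =
     (- 1) ^ i * kernel_weight (a2 + a3 + 1) i * pochhammer (a1 + 2) (n - i)
        * pochhammer (a1 + a2 + a3 + real n + 3) i
        / (fact i * pochhammer (a3 + 1) i * pochhammer (a2 + a3 + 2) (n - l1 + i))"
proof (cases i)
  case 0
  then show ?thesis by (simp add: c_star_def kernel_weight_def)
next
  case (Suc h)
  define M where "M = n - l1"
  have pos: "pochhammer (a2 + a3 + 2) h > 0" using a by (intro pochhammer_pos) simp
  have "M + i = h + (M + 1)" using Suc by simp
  then have "pochhammer (a2 + a3 + 2) (M + i)
      = pochhammer (a2 + a3 + 2) h * pochhammer (a2 + a3 + real i + 1) (M + 1)"
    by (simp only: pochhammer_product') (simp add: Suc algebra_simps)
  then show ?thesis using pos unfolding c_star_def kernel_weight_def M_def[symmetric]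
    by (simp add: Suc add_ac)
qed

lemma ratio_polynomial:
  fixes a s :: real
  assumes "a > - 1"
  obtains q where "degree q < d + Suc h"
    "\<And>l. l \<le> n \<Longrightarrow> poly q (real l)
        = pochhammer (a + 1) (Suc h + l) / pochhammer (a + 2) l * pochhammer (s + real (n - l)) d"
proof
  let ?q = "[:a + 1:] * (pochhammer [:a + 2, 1:] h * pochhammer [:s + real n, - 1:] d)"
  have "degree (pochhammer [:a + 2, 1:] h) \<le> h" "degree (pochhammer [:s + real n, - 1:] d) \<le> d"
    using pochhammer_polynomial[of "[:a + 2, 1:]" h] pochhammer_polynomial[of "[:s + real n, - 1:]" d] by simp_all
  then have "degree (pochhammer [:a + 2, 1:] h * pochhammer [:s + real n, - 1:] d) \<le> h + d"
    by (meson degree_mult_le add_mono order_trans)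
  then have "degree ?q \<le> h + d"
    using degree_mult_le[of "[:a + 1:]" "pochhammer [:a + 2, 1:] h * pochhammer [:s + real n, - 1:] d"] by simp
  then show "degree ?q < d + Suc h" by simp
  fix l assume l: "l \<le> n"
  have pos: "pochhammer (a + 2) l > 0" using assms by (intro pochhammer_pos) simp
  have "pochhammer (a + 1) (Suc h + l) = (a + 1) * pochhammer (a + 2) (l + h)"
    by (simp add: pochhammer_rec add_ac)
  also have "pochhammer (a + 2) (l + h) = pochhammer (a + 2) l * pochhammer (a + 2 + real l) h"
    by (rule pochhammer_product')
  finally have "pochhammer (a + 1) (Suc h + l) / pochhammer (a + 2) l = (a + 1) * pochhammer (a + 2 + real l) h"
    using pos by simp
  then show "poly ?q (real l) = pochhammer (a + 1) (Suc h + l) / pochhammer (a + 2) l * pochhammer (s + real (n - l)) d"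
    using l pochhammer_polynomial[of "[:a + 2, 1:]" h "real l"] pochhammer_polynomial[of "[:s + real n, - 1:]" d "real l"]
    by (simp add: of_nat_diff algebra_simps)
qed

lemma alt_sum_cong: "(\<And>k. k \<le> n \<Longrightarrow> f k = g k) \<Longrightarrow> alt_sum n f = alt_sum n g"
  unfolding alt_sum_def by (intro sum.cong) auto

text \<open>
  The pairing of the Step 1 vector with \<open>x\<^sub>1\<^sup>k x\<^sub>2\<^sup>j (1 - x\<^sub>1)\<^bsup>n - k - j\<^esup>\<close> for \<open>k = k1\<close>, up to a constant. After the moment formula
  only \<open>i \<le> j\<close> survives, and the sum over \<open>l1\<close> becomes a finite difference of order \<open>n - i\<close>. For \<open>k1 > 0\<close> the
  summand is a polynomial of degree \<open>n - i - 1\<close>. For \<open>k1 = 0\<close> a denominator \<open>a1 + 1 + l1\<close> remains; the residue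
  depends on \<open>i\<close> only through the weights whose sum is \<open>kernel_weight_delta\<close>.
\<close>

lemma vertex_moment:
  fixes a1 a2 a3 :: real
  assumes a: "a1 > - 1" "a2 > - 1" "a3 > - 1" and kj: "k1 + j \<le> n"
  shows "(\<Sum>(l1, l2)\<in>idx n. step1_value n a1 a2 a3 (l1, l2) * pochhammer (a1 + 1) (k1 + l1)
       * pochhammer (a2 + 1) (l2 + j) * pochhammer (a3 + 1) (n - l1 - l2)
       * pochhammer (a2 + a3 + 2 + real (n - l1 + j)) (n - k1 - j)
       / (fact l1 * fact l2 * fact (n - l1 - l2)))
     = (if k1 = 0 \<and> j = 0 then pochhammer (a1 + a2 + a3 + 3) (2 * n) / fact n else 0)"
    (is "?S = _")
proof -
  define s where "s = a2 + a3 + 1"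
  define m where "m = n - k1"
  define z where "z = a1 + a2 + a3 + 3"
  have jm: "j \<le> m" using kj by (simp add: m_def)
  have s: "s > - 1" using a by (simp add: s_def)
  have s2: "a2 + a3 + 2 = s + 1" by (simp add: s_def)
  have ps: "pochhammer (s + 1) r > 0" for r using s by (intro pochhammer_pos) simp
  have p1: "pochhammer (a1 + 2) r > 0" for r using a by (intro pochhammer_pos) simp
  have p1': "pochhammer (a1 + 1) r > 0" for r using a by (intro pochhammer_pos) simp
  have p3: "pochhammer (a3 + 1) r > 0" for r using a by (intro pochhammer_pos) simp
  define pre where "pre = pochhammer z n / fact n"
  \<comment> \<open>for fixed \<open>i\<close> the factors that depend on \<open>l1\<close> go into \<open>Q\<close>, except for the binomial coefficient and the sign\<close>
  define K where "K = (\<lambda>i. kernel_weight s i * pochhammer (a1 + 2) (n - i) * pochhammer (z + real n) i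
        * pochhammer (a2 + 1) j * pochhammer (- real j) i
        / (fact i * pochhammer (s + 1) (j + i) * fact (n - i)))"
  define Q where "Q = (\<lambda>i l. pochhammer (a1 + 1) (k1 + l) / pochhammer (a1 + 2) l
        * (pochhammer (s + 1) (n - l + m) / pochhammer (s + 1) (n - l + i)))"
  define H where "H = (\<lambda>l1 i. \<Sum>l2\<le>n - l1. hahn i (real l2) a2 a3 (real (n - l1)) * pochhammer (a2 + 1) (l2 + j)
        * pochhammer (a3 + 1) (n - l1 - l2) / (fact l2 * fact (n - l1 - l2)))"
  define R where "R = (\<lambda>l1. pre * ((- 1) ^ l1 / pochhammer (a1 + 2) l1) * pochhammer (a1 + 1) (k1 + l1)
        * pochhammer (s + 1 + real (n - l1 + j)) (m - j) / fact l1)"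
  have "?S = (\<Sum>l1\<le>n. \<Sum>l2\<le>n - l1. \<Sum>i\<le>n - l1. R l1 * c_star n a1 a2 a3 l1 i
        * (hahn i (real l2) a2 a3 (real (n - l1)) * pochhammer (a2 + 1) (l2 + j)
        * pochhammer (a3 + 1) (n - l1 - l2) / (fact l2 * fact (n - l1 - l2))))"
    unfolding sum_idx step1_value_def R_def pre_def m_def z_def s2 atLeast0AtMost
    by (simp add: sum_distrib_left sum_distrib_right sum_divide_distrib mult_ac del: of_nat_diff of_nat_add)
  also have "\<dots> = (\<Sum>l1\<le>n. \<Sum>i\<le>n - l1. R l1 * c_star n a1 a2 a3 l1 i * H l1 i)"
    unfolding H_def sum_distrib_left by (rule sum.cong[OF refl]) (rule sum.swap)
  also have "\<dots> = (\<Sum>i\<le>n. \<Sum>l1\<le>n - i. R l1 * c_star n a1 a2 a3 l1 i * H l1 i)"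
    using sum_idx[of "\<lambda>(l1, i). R l1 * c_star n a1 a2 a3 l1 i * H l1 i" n]
      sum_idx_swap[of "\<lambda>(l1, i). R l1 * c_star n a1 a2 a3 l1 i * H l1 i" n] by simp
  also have "\<dots> = (\<Sum>i\<le>n. pre * K i * alt_sum (n - i) (Q i))"
  proof (rule sum.cong[OF refl])
    fix i assume "i \<in> {..n}"
    have "R l1 * c_star n a1 a2 a3 l1 i * H l1 i
        = pre * K i * (real (n - i choose l1) * ((- 1) ^ l1 * Q i l1))" if l1: "l1 \<le> n - i" for l1
    proof -
      have li: "l1 + i \<le> n" "i \<le> n - l1" using l1 \<open>i \<in> {..n}\<close> by auto
      have h: "H l1 i = pochhammer (- real (n - l1)) i / fact (n - l1) * pochhammer (s + 1) (n - l1 + j)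
        * pochhammer (a2 + 1) j * pochhammer (a3 + 1) i * pochhammer (- real j) i
        / pochhammer (s + 1) (j + i)"
        unfolding H_def s2[symmetric] using a li by (intro hahn_moment)
      have neg: "pochhammer (- real (n - l1)) i = (- 1) ^ i * fact (n - l1) / fact (n - i - l1)"
        using pochhammer_neg_ratio[OF li(2)] by (simp add: diff_commute add.commute)
      have bin: "real (n - i choose l1) = fact (n - i) / (fact l1 * fact (n - i - l1))"
        using l1 by (rule binomial_fact)
      have "n - l1 + m = (n - l1 + j) + (m - j)" using jm by simp
      then have sm: "pochhammer (s + 1) (n - l1 + m)
          = pochhammer (s + 1) (n - l1 + j) * pochhammer (s + 1 + real (n - l1 + j)) (m - j)"
        by (simp only: pochhammer_product')
      have sgn: "(- 1 :: real) ^ i * (- 1) ^ i = 1" by (simp flip: power_add mult_2)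
      have zz: "a1 + a2 + a3 + real n + 3 = z + real n" by (simp add: z_def)
      define e :: real where "e = (- 1) ^ i"
      have "R l1 * c_star n a1 a2 a3 l1 i * H l1 i
        = (e * e) * (pre * K i * (real (n - i choose l1) * ((- 1) ^ l1 * Q i l1)))"
        unfolding h neg bin Q_def sm R_def c_star_eq[OF a(2,3) li(1)] K_def s2 s_def[symmetric] zz e_def[symmetric]
        using p3[of i] by (simp add: mult_ac)
      then show ?thesis using sgn by (simp add: e_def)
    qed
    then show "(\<Sum>l1\<le>n - i. R l1 * c_star n a1 a2 a3 l1 i * H l1 i) = pre * K i * alt_sum (n - i) (Q i)"
      by (simp add: alt_sum_def sum_distrib_left)
  qed
  also have "\<dots> = (\<Sum>i\<le>j. pre * K i * alt_sum (n - i) (Q i))"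
    using kj by (intro sum.mono_neutral_right) (auto simp: K_def pochhammer_of_nat_eq_0_lemma)
  also have "\<dots> = (if k1 = 0 \<and> j = 0 then pochhammer z (2 * n) / fact n else 0)"
  proof -
    have Q: "Q i l = pochhammer (a1 + 1) (k1 + l) / pochhammer (a1 + 2) l
        * pochhammer (s + 1 + real i + real (n - l)) (m - i)" if "i \<le> j" for i l
    proof -
      have "n - l + m = (n - l + i) + (m - i)" using that jm by simp
      then have "pochhammer (s + 1) (n - l + m)
          = pochhammer (s + 1) (n - l + i) * pochhammer (s + 1 + real (n - l + i)) (m - i)"
        by (simp only: pochhammer_product')
      then show ?thesis using ps[of "n - l + i"] by (simp add: Q_def add_ac)
    qed
    show ?thesis
    proof (cases k1)
      case (Suc h)
      have "alt_sum (n - i) (Q i) = 0" if i: "i \<le> j" for i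
      proof -
        from a(1) obtain q where q: "degree q < m - i + Suc h"
          "\<And>l. l \<le> n \<Longrightarrow> poly q (real l)
              = pochhammer (a1 + 1) (Suc h + l) / pochhammer (a1 + 2) l
                * pochhammer (s + 1 + real i + real (n - l)) (m - i)"
          by (rule ratio_polynomial[where d = "m - i" and h = h and n = n and s = "s + 1 + real i"]) blast
        have "alt_sum (n - i) (Q i) = alt_sum (n - i) (\<lambda>l. poly q (real l))"
          unfolding Q[OF i] by (rule alt_sum_cong) (simp add: q(2) Suc)
        moreover have "m - i + Suc h = n - i" using kj i Suc by (simp add: m_def)
        ultimately show ?thesis using q(1) by (simp add: alt_sum_poly)
      qed
      then show ?thesis using Suc by simp
    next
      case 0
      have "pre * K i * alt_sum (n - i) (Q i) = pochhammer z (2 * n) / fact n * pochhammer (a2 + 1) j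
          * (kernel_weight s i * pochhammer (- real j) i / (fact i * pochhammer (s + 1) (j + i)))"
        if i: "i \<le> j" for i
      proof -
        have iN: "i \<le> n" using i kj by simp
        let ?q = "[:a1 + 1:] * pochhammer [:s + 1 + real i + real n, - 1:] (n - i)"
        have dq: "degree ?q \<le> n - i"
          using pochhammer_polynomial[of "[:s + 1 + real i + real n, - 1:]" "n - i"]
            degree_mult_le[of "[:a1 + 1:]" "pochhammer [:s + 1 + real i + real n, - 1:] (n - i)"] by simp
        have Q1: "Q i l = poly ?q (real l) / (a1 + 1 + real l)" if "l \<le> n - i" for l
        proof -
          have "(a1 + 1) * pochhammer (a1 + 2) l = pochhammer (a1 + 1) l * (a1 + 1 + real l)"
            using pochhammer_rec[of "a1 + 1" l] by (simp add: pochhammer_Suc add_ac)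
          then have "pochhammer (a1 + 1) l / pochhammer (a1 + 2) l = (a1 + 1) / (a1 + 1 + real l)"
            using p1[of l] a by (simp add: divide_simps)
          moreover have "poly (pochhammer [:s + 1 + real i + real n, - 1:] (n - i)) (real l)
              = pochhammer (s + 1 + real i + real (n - l)) (n - i)"
            using that pochhammer_polynomial[of "[:s + 1 + real i + real n, - 1:]" "n - i" "real l"]
            by (simp add: of_nat_diff add_ac diff_conv_add_uminus del: add_uminus_conv_diff)
          ultimately show ?thesis using 0 by (simp add: Q[OF i] m_def)
        qed
        have qm: "poly ?q (- (a1 + 1)) = (a1 + 1) * pochhammer (z + real n + real i) (n - i)"
          using pochhammer_polynomial[of "[:s + 1 + real i + real n, - 1:]" "n - i" "- (a1 + 1)"]
          by (simp add: s_def z_def algebra_simps)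
        have "alt_sum (n - i) (Q i) = alt_sum (n - i) (\<lambda>l. poly ?q (real l) / (a1 + 1 + real l))"
          by (rule alt_sum_cong) (rule Q1)
        also have "\<dots> = poly ?q (- (a1 + 1)) * fact (n - i) / pochhammer (a1 + 1) (Suc (n - i))"
          by (rule alt_sum_poly_over_linear[OF _ dq]) (use a in simp)
        also have "\<dots> = pochhammer (z + real n + real i) (n - i) * fact (n - i) / pochhammer (a1 + 2) (n - i)"
          unfolding qm pochhammer_rec[of "a1 + 1"] using a by (simp add: add_ac)
        finally have A: "alt_sum (n - i) (Q i)
            = pochhammer (z + real n + real i) (n - i) * fact (n - i) / pochhammer (a1 + 2) (n - i)" .
        have "2 * n = n + (i + (n - i))" using iN by simp
        then have zz: "pochhammer z (2 * n)
            = pochhammer z n * (pochhammer (z + real n) i * pochhammer (z + real n + real i) (n - i))"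
          by (simp only: pochhammer_product')
        show ?thesis unfolding A zz K_def pre_def using p1[of "n - i"] by simp
      qed
      then have "(\<Sum>i\<le>j. pre * K i * alt_sum (n - i) (Q i)) = pochhammer z (2 * n) / fact n * pochhammer (a2 + 1) j
          * (if j = 0 then 1 else 0)"
        unfolding kernel_weight_delta[OF s, symmetric] by (simp add: sum_distrib_left)
      then show ?thesis using 0 by simp
    qed
  qed
  finally show ?thesis by (simp add: z_def)
qed

section \<open>The Gram matrix and its inverse\<close>

text \<open>
  The third index \<open>n - k1 - k2\<close>, which makes formulas symmetric in the three barycentric coordinates.
\<close>

definition third :: "nat \<Rightarrow> nat \<times> nat \<Rightarrow> nat" where
  "third n k = n - (fst k + snd k)"

definition gram_factor :: "real \<Rightarrow> nat \<Rightarrow> nat \<Rightarrow> real" where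
  "gram_factor a i j = pochhammer (a + 1) (i + j) / (fact i * fact j)"

definition gram :: "nat \<Rightarrow> real \<Rightarrow> real \<Rightarrow> real \<Rightarrow> nat \<times> nat \<Rightarrow> nat \<times> nat \<Rightarrow> real" where
  "gram n a1 a2 a3 k l = (fact n)\<^sup>2 / pochhammer (a1 + a2 + a3 + 3) (2 * n)
     * gram_factor a1 (fst k) (fst l) * gram_factor a2 (snd k) (snd l) * gram_factor a3 (third n k) (third n l)"

lemma gram_factor_commute: "gram_factor a i j = gram_factor a j i"
  by (simp add: gram_factor_def add.commute mult.commute)

lemma gram_commute: "gram n a1 a2 a3 k l = gram n a1 a2 a3 l k"
  by (simp add: gram_def gram_factor_commute)

lemma gram_swap: "gram n a2 a1 a3 (prod.swap k) (prod.swap l) = gram n a1 a2 a3 k l"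
  by (simp add: gram_def third_def add_ac mult_ac)

text \<open>
  The vector \<open>c\<close> is row \<open>k\<close> of a left inverse of the Gram matrix.
\<close>

definition dual_row :: "nat \<Rightarrow> real \<Rightarrow> real \<Rightarrow> real \<Rightarrow> nat \<times> nat \<Rightarrow> (nat \<times> nat \<Rightarrow> real) \<Rightarrow> bool" where
  "dual_row n a1 a2 a3 k c \<longleftrightarrow>
     (\<forall>m\<in>idx n. (\<Sum>l\<in>idx n. c l * gram n a1 a2 a3 l m) = (if m = k then 1 else 0))"

text \<open>
  The algebraic form of expanding \<open>x\<^sub>3\<^sup>k = ((x\<^sub>2 + x\<^sub>3) - x\<^sub>2)\<^sup>k\<close> under the Dirichlet moment functional; it passes from the
  test functions of \<open>vertex_moment\<close> to Bernstein polynomials.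
\<close>

lemma pochhammer_split_alternating:
  fixes x y :: real
  shows "pochhammer y k = (\<Sum>r\<le>k. real (k choose r)
           * ((- 1) ^ r * pochhammer x r * pochhammer (x + y + real r) (k - r)))"
proof (induction k arbitrary: y)
  case 0
  then show ?case by simp
next
  case (Suc k)
  have "(\<Sum>r\<le>Suc k. real (Suc k choose r)
           * ((- 1) ^ r * pochhammer x r * pochhammer (x + y + real r) (Suc k - r)))
     = (\<Sum>r\<le>k. y * (real (k choose r)
           * ((- 1) ^ r * pochhammer x r * pochhammer (x + (y + 1) + real r) (k - r))))"
    unfolding pascal_sum sum.distrib[symmetric]
  proof (rule sum.cong[OF refl])
    fix r assume "r \<in> {..k}"
    then have e: "Suc k - r = Suc (k - r)" by simp
    show "real (k choose r) * ((- 1) ^ r * pochhammer x r * pochhammer (x + y + real r) (Suc k - r))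
        + real (k choose r) * ((- 1) ^ Suc r * pochhammer x (Suc r) * pochhammer (x + y + real (Suc r)) (Suc k - Suc r))
        = y * (real (k choose r) * ((- 1) ^ r * pochhammer x r * pochhammer (x + (y + 1) + real r) (k - r)))"
      unfolding e pochhammer_rec[of "x + y + real r"] pochhammer_Suc[of x]
      by (simp add: algebra_simps)
  qed
  then show ?case by (simp add: pochhammer_rec Suc.IH[of "y + 1"] sum_distrib_left)
qed

lemma dual_row_vertex:
  assumes a: "a1 > - 1" "a2 > - 1" "a3 > - 1"
  shows "dual_row n a1 a2 a3 (0, 0) (step1_value n a1 a2 a3)"
  unfolding dual_row_def
proof
  fix m assume m: "m \<in> idx n"
  obtain k1 k2 where mk: "m = (k1, k2)" by (cases m)
  define k3 where "k3 = n - k1 - k2"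
  have kn: "k1 + k2 \<le> n" using m by (simp add: mk idx_def)
  define z where "z = a1 + a2 + a3 + 3"
  have pz: "pochhammer z (2 * n) > 0" using a by (intro pochhammer_pos) (simp add: z_def)
  define pre where "pre = (fact n)\<^sup>2 / pochhammer z (2 * n) / (fact k1 * fact k2 * fact k3 :: real)"
  define V where "V = (\<lambda>j (l1, l2). step1_value n a1 a2 a3 (l1, l2) * pochhammer (a1 + 1) (k1 + l1)
       * pochhammer (a2 + 1) (l2 + j) * pochhammer (a3 + 1) (n - l1 - l2)
       * pochhammer (a2 + a3 + 2 + real (n - l1 + j)) (n - k1 - j)
       / (fact l1 * fact l2 * fact (n - l1 - l2)))"
  have "step1_value n a1 a2 a3 l * gram n a1 a2 a3 l m
      = (\<Sum>r\<le>k3. pre * (real (k3 choose r) * (- 1) ^ r) * V (k2 + r) l)" if l: "l \<in> idx n" for l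
  proof -
    obtain l1 l2 where ll: "l = (l1, l2)" by (cases l)
    define l3 where "l3 = n - l1 - l2"
    have ln: "l1 + l2 \<le> n" using l by (simp add: ll idx_def)
    have "pochhammer (a2 + 1) (l2 + k2) * pochhammer (a3 + 1) (l3 + k3)
        = (\<Sum>r\<le>k3. real (k3 choose r) * (- 1) ^ r * (pochhammer (a2 + 1) (l2 + (k2 + r))
            * pochhammer (a3 + 1) l3 * pochhammer (a2 + a3 + 2 + real (n - l1 + (k2 + r))) (n - k1 - (k2 + r))))"
    proof -
      define x where "x = a2 + 1 + real (l2 + k2)"
      define y where "y = a3 + 1 + real l3"
      have p3: "pochhammer (a3 + 1) (l3 + k3) = pochhammer (a3 + 1) l3 * pochhammer y k3"
        unfolding y_def by (rule pochhammer_product')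
      have p2: "pochhammer (a2 + 1) (l2 + k2) * pochhammer x r = pochhammer (a2 + 1) (l2 + (k2 + r))" for r
        unfolding x_def pochhammer_product'[symmetric] by (simp add: add_ac)
      have xy: "x + y + real r = a2 + a3 + 2 + real (n - l1 + (k2 + r))" for r
        using ln by (simp add: x_def y_def l3_def of_nat_diff)
      have d: "k3 - r = n - k1 - (k2 + r)" for r by (simp add: k3_def)
      show ?thesis unfolding p3 pochhammer_split_alternating[of y k3 x] p2[symmetric] xy d
        by (simp add: sum_distrib_left mult_ac)
    qed
    note A = this
    have "step1_value n a1 a2 a3 l * gram n a1 a2 a3 l m
      = pre * (step1_value n a1 a2 a3 (l1, l2) * pochhammer (a1 + 1) (k1 + l1) / (fact l1 * fact l2 * fact l3))
         * (pochhammer (a2 + 1) (l2 + k2) * pochhammer (a3 + 1) (l3 + k3))"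
      unfolding gram_def gram_factor_def third_def
      by (simp add: mk ll pre_def z_def l3_def k3_def add_ac mult_ac)
    also have "\<dots> = (\<Sum>r\<le>k3. pre * (real (k3 choose r) * (- 1) ^ r) * V (k2 + r) l)"
      unfolding A ll V_def by (simp add: sum_distrib_left l3_def mult_ac)
    finally show ?thesis .
  qed
  then have "(\<Sum>l\<in>idx n. step1_value n a1 a2 a3 l * gram n a1 a2 a3 l m)
      = (\<Sum>l\<in>idx n. \<Sum>r\<le>k3. pre * (real (k3 choose r) * (- 1) ^ r) * V (k2 + r) l)"
    by (rule sum.cong[OF refl])
  also have "\<dots> = (\<Sum>r\<le>k3. pre * (real (k3 choose r) * (- 1) ^ r) * (\<Sum>l\<in>idx n. V (k2 + r) l))"
    unfolding sum_distrib_left by (rule sum.swap)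
  also have "\<dots> = (\<Sum>r\<le>k3. pre * (real (k3 choose r) * (- 1) ^ r)
      * (if k1 = 0 \<and> k2 + r = 0 then pochhammer z (2 * n) / fact n else 0))"
    unfolding V_def z_def using kn by (intro sum.cong refl, subst vertex_moment[OF a]) (auto simp: k3_def)
  also have "\<dots> = (\<Sum>r\<le>k3. if r = 0 then
       (if m = (0, 0) then pre * pochhammer z (2 * n) / fact n else 0) else 0)"
    by (rule sum.cong) (auto simp: mk)
  also have "\<dots> = (if m = (0, 0) then 1 else 0)"
    using pz by (auto simp: mk pre_def k3_def power2_eq_square)
  finally show "(\<Sum>l\<in>idx n. step1_value n a1 a2 a3 l * gram n a1 a2 a3 l m) = (if m = (0, 0) then 1 else 0)" .
qed

definition sigma0_val :: "nat \<Rightarrow> real \<Rightarrow> nat \<times> nat \<Rightarrow> real" where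
  "sigma0_val n a2 t = (real (fst t) + real (snd t) - real n) * (real (snd t) + a2 + 1)"

definition sigma2_val :: "nat \<Rightarrow> real \<Rightarrow> nat \<times> nat \<Rightarrow> real" where
  "sigma2_val n a3 t = real (snd t) * (real (fst t) + real (snd t) - a3 - real n - 1)"

text \<open>
  The shift \<open>snd l - 1\<close> truncates at \<open>0\<close>, and \<open>snd l + 1\<close> may leave the index set; in both cases the coefficient in
  front is zero.
\<close>

definition tridiag :: "nat \<Rightarrow> real \<Rightarrow> real \<Rightarrow> (nat \<times> nat \<Rightarrow> real) \<Rightarrow> nat \<times> nat \<Rightarrow> real" where
  "tridiag n a2 a3 c l = sigma0_val n a2 l * c (fst l, snd l + 1) - (sigma0_val n a2 l + sigma2_val n a3 l) * c l
     + sigma2_val n a3 l * c (fst l, snd l - 1)"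

text \<open>
  Here the coefficients are taken at the shifted index, where they need not vanish, so the boundary has to be cut
  off by hand.
\<close>

definition tridiag_adj :: "nat \<Rightarrow> real \<Rightarrow> real \<Rightarrow> (nat \<times> nat \<Rightarrow> real) \<Rightarrow> nat \<times> nat \<Rightarrow> real" where
  "tridiag_adj n a2 a3 g l =
     (if snd l = 0 then 0 else sigma0_val n a2 (fst l, snd l - 1) * g (fst l, snd l - 1))
     - (sigma0_val n a2 l + sigma2_val n a3 l) * g l
     + (if third n l = 0 then 0 else sigma2_val n a3 (fst l, snd l + 1) * g (fst l, snd l + 1))"

lemma sum_by_parts_tridiagonal:
  fixes p q c g :: "nat \<Rightarrow> real"
  assumes "p N = 0" "q 0 = 0"
  shows "(\<Sum>x\<le>N. (p x * c (x + 1) + q x * c (x - 1)) * g x)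
       = (\<Sum>x\<le>N. c x * ((if x = 0 then 0 else p (x - 1) * g (x - 1))
              + (if x = N then 0 else q (x + 1) * g (x + 1))))"
proof -
  have 1: "(\<Sum>x\<le>N. p x * c (x + 1) * g x) = (\<Sum>x\<le>N. c x * (if x = 0 then 0 else p (x - 1) * g (x - 1)))"
  proof -
    have "(\<Sum>x\<le>N. p x * c (x + 1) * g x) = (\<Sum>x<N. p x * c (x + 1) * g x)"
      using assms by (simp add: lessThan_Suc_atMost[symmetric])
    also have "\<dots> = (\<Sum>x\<in>{1..N}. c x * (if x = 0 then 0 else p (x - 1) * g (x - 1)))"
      by (rule sum.reindex_bij_witness[of _ "\<lambda>x. x - 1" "\<lambda>x. x + 1"]) (auto simp: mult_ac)
    also have "\<dots> = (\<Sum>x\<le>N. c x * (if x = 0 then 0 else p (x - 1) * g (x - 1)))"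
      by (rule sum.mono_neutral_left) auto
    finally show ?thesis .
  qed
  have 2: "(\<Sum>x\<le>N. q x * c (x - 1) * g x) = (\<Sum>x\<le>N. c x * (if x = N then 0 else q (x + 1) * g (x + 1)))"
  proof -
    have "(\<Sum>x\<le>N. q x * c (x - 1) * g x) = (\<Sum>x\<in>{1..N}. q x * c (x - 1) * g x)"
      using assms by (intro sum.mono_neutral_right) (auto simp: not_less_eq_eq)
    also have "\<dots> = (\<Sum>x<N. c x * (if x = N then 0 else q (x + 1) * g (x + 1)))"
      by (rule sum.reindex_bij_witness[of _ "\<lambda>x. x + 1" "\<lambda>x. x - 1"]) (auto simp: mult_ac)
    also have "\<dots> = (\<Sum>x\<le>N. c x * (if x = N then 0 else q (x + 1) * g (x + 1)))"
      by (rule sum.mono_neutral_left) auto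
    finally show ?thesis .
  qed
  show ?thesis by (simp only: distrib_left distrib_right sum.distrib 1 2)
qed

lemma tridiag_adjoint:
  "(\<Sum>l\<in>idx n. tridiag n a2 a3 c l * g l) = (\<Sum>l\<in>idx n. c l * tridiag_adj n a2 a3 g l)"
  unfolding sum_idx
proof (rule sum.cong[OF refl])
  fix l1 assume "l1 \<in> {..n}"
  define p where "p = (\<lambda>x. sigma0_val n a2 (l1, x))"
  define q where "q = (\<lambda>x. sigma2_val n a3 (l1, x))"
  define N where "N = n - l1"
  have b: "p N = 0" "q 0 = 0"
    using \<open>l1 \<in> {..n}\<close> by (simp_all add: p_def q_def N_def sigma0_val_def sigma2_val_def of_nat_diff)
  have "(\<Sum>l2\<le>N. tridiag n a2 a3 c (l1, l2) * g (l1, l2))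
     = (\<Sum>x\<le>N. (p x * c (l1, x + 1) + q x * c (l1, x - 1)) * g (l1, x)) - (\<Sum>x\<le>N. (p x + q x) * c (l1, x) * g (l1, x))"
    unfolding sum_subtractf[symmetric] by (rule sum.cong) (simp_all add: tridiag_def p_def q_def algebra_simps)
  also have "\<dots> = (\<Sum>x\<le>N. c (l1, x) * ((if x = 0 then 0 else p (x - 1) * g (l1, x - 1))
              + (if x = N then 0 else q (x + 1) * g (l1, x + 1)))) - (\<Sum>x\<le>N. (p x + q x) * c (l1, x) * g (l1, x))"
    using sum_by_parts_tridiagonal[of p N q "\<lambda>x. c (l1, x)" "\<lambda>x. g (l1, x)", OF b] by simp
  also have "\<dots> = (\<Sum>x\<le>N. c (l1, x) * tridiag_adj n a2 a3 g (l1, x))"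
    unfolding sum_subtractf[symmetric]
  proof (rule sum.cong[OF refl])
    fix x assume x: "x \<in> {..N}"
    have "third n (l1, x) = 0 \<longleftrightarrow> x = N" using x \<open>l1 \<in> {..n}\<close> by (auto simp: third_def N_def)
    then show "c (l1, x) * ((if x = 0 then 0 else p (x - 1) * g (l1, x - 1))
              + (if x = N then 0 else q (x + 1) * g (l1, x + 1))) - (p x + q x) * c (l1, x) * g (l1, x)
       = c (l1, x) * tridiag_adj n a2 a3 g (l1, x)"
      by (simp add: tridiag_adj_def p_def q_def algebra_simps)
  qed
  finally show "(\<Sum>l2\<le>n - l1. tridiag n a2 a3 c (l1, l2) * g (l1, l2))
      = (\<Sum>l2\<le>n - l1. c (l1, l2) * tridiag_adj n a2 a3 g (l1, l2))" unfolding N_def .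
qed

lemma gram_factor_Suc: "gram_factor a (Suc i) j * (real i + 1) = gram_factor a i j * (a + 1 + real i + real j)"
  by (simp add: gram_factor_def pochhammer_Suc divide_simps) (simp add: algebra_simps)

text \<open>
  The right-hand side is symmetric in \<open>l\<close> and \<open>m\<close>, which is self-adjointness with respect to the Gram matrix. Where a denominator
  such as \<open>a2 + real (snd l) + real (snd m)\<close> is zero, both second components are zero and so is the numerator.
\<close>

lemma tridiag_adj_gram:
  assumes a: "a2 > - 1" "a3 > - 1" and l: "l \<in> idx n"
  shows "tridiag_adj n a2 a3 (\<lambda>x. gram n a1 a2 a3 x m) l =
    gram n a1 a2 a3 l m *
      (real (snd l) * real (snd m) * (a3 + real (third n l) + real (third n m) + 1) / (a2 + real (snd l) + real (snd m))
     + real (third n l) * real (third n m) * (a2 + real (snd l) + real (snd m) + 1) / (a3 + real (third n l) + real (third n m))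
     - real (snd l) * real (third n m) - real (third n l) * real (snd m))"
proof -
  obtain l1 l2 where ll: "l = (l1, l2)" by (cases l)
  define l3 where "l3 = third n l"
  define G where "G = gram n a1 a2 a3 l m"
  define p where "p = a2 + real l2 + real (snd m)"
  define q where "q = a3 + real l3 + real (third n m)"
  have ln: "l1 + l2 \<le> n" "l3 = n - (l1 + l2)" using l by (simp_all add: ll idx_def l3_def third_def)
  have r3: "real l3 = real n - real l1 - real l2" using ln by (simp add: of_nat_diff)
  define C where "C = (fact n)\<^sup>2 / pochhammer (a1 + a2 + a3 + 3) (2 * n) * gram_factor a1 l1 (fst m)"
  have G: "G = C * (gram_factor a2 l2 (snd m) * gram_factor a3 l3 (third n m))"
    by (simp add: G_def gram_def C_def ll l3_def)
  have 1: "(if l2 = 0 then 0 else sigma0_val n a2 (l1, l2 - 1) * gram n a1 a2 a3 (l1, l2 - 1) m)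
      = G * (real l2 * real (snd m) * (q + 1) / p - real l2 * (q + 1))"
  proof (cases l2)
    case (Suc h)
    have p: "p > 0" using a Suc by (simp add: p_def)
    have c: "third n (l1, h) = Suc l3" using ln Suc by (simp add: third_def)
    have g: "gram n a1 a2 a3 (l1, h) m = C * (gram_factor a2 h (snd m) * gram_factor a3 (Suc l3) (third n m))"
      by (simp add: gram_def C_def c)
    have f2: "gram_factor a2 l2 (snd m) * real l2 = gram_factor a2 h (snd m) * p"
      using gram_factor_Suc[of a2 h "snd m"] by (simp add: Suc p_def algebra_simps)
    have f3: "gram_factor a3 (Suc l3) (third n m) * (real l3 + 1) = gram_factor a3 l3 (third n m) * (q + 1)"
      using gram_factor_Suc[of a3 l3 "third n m"] by (simp add: q_def algebra_simps)
    have u: "sigma0_val n a2 (l1, h) = - ((real l3 + 1) * (real l2 + a2))"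
      by (simp add: sigma0_val_def r3 Suc algebra_simps)
    have "(sigma0_val n a2 (l1, h) * gram n a1 a2 a3 (l1, h) m) * p
        = - ((real l2 + a2) * C) * (gram_factor a2 h (snd m) * p) * (gram_factor a3 (Suc l3) (third n m) * (real l3 + 1))"
      unfolding u g by (simp add: mult_ac)
    also have "\<dots> = - (G * (real l2 + a2) * real l2 * (q + 1))"
      unfolding f2[symmetric] f3 G by (simp add: mult_ac)
    also have "\<dots> = G * (real l2 * real (snd m) * (q + 1) / p - real l2 * (q + 1)) * p"
      using p by (simp add: divide_simps) (simp add: p_def algebra_simps)
    finally show ?thesis using p Suc by simp
  qed simp
  have 2: "(if l3 = 0 then 0 else sigma2_val n a3 (l1, l2 + 1) * gram n a1 a2 a3 (l1, l2 + 1) m)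
      = G * (real l3 * real (third n m) * (p + 1) / q - real l3 * (p + 1))"
  proof (cases l3)
    case (Suc h)
    have q: "q > 0" using a Suc by (simp add: q_def)
    have c: "third n (l1, l2 + 1) = h" using ln Suc by (simp add: third_def)
    have g: "gram n a1 a2 a3 (l1, l2 + 1) m = C * (gram_factor a2 (Suc l2) (snd m) * gram_factor a3 h (third n m))"
      by (simp add: gram_def C_def c[simplified])
    have f2: "gram_factor a2 (Suc l2) (snd m) * (real l2 + 1) = gram_factor a2 l2 (snd m) * (p + 1)"
      using gram_factor_Suc[of a2 l2 "snd m"] by (simp add: p_def algebra_simps)
    have f3: "gram_factor a3 l3 (third n m) * real l3 = gram_factor a3 h (third n m) * q"
      using gram_factor_Suc[of a3 h "third n m"] by (simp add: Suc q_def algebra_simps)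
    have u: "sigma2_val n a3 (l1, l2 + 1) = - ((real l2 + 1) * (real l3 + a3))"
      by (simp add: sigma2_val_def r3 algebra_simps)
    have "(sigma2_val n a3 (l1, l2 + 1) * gram n a1 a2 a3 (l1, l2 + 1) m) * q
        = - ((real l3 + a3) * C) * (gram_factor a2 (Suc l2) (snd m) * (real l2 + 1)) * (gram_factor a3 h (third n m) * q)"
      unfolding u g by (simp add: mult_ac)
    also have "\<dots> = - (G * (real l3 + a3) * real l3 * (p + 1))"
      unfolding f2 f3[symmetric] G by (simp add: mult_ac)
    also have "\<dots> = G * (real l3 * real (third n m) * (p + 1) / q - real l3 * (p + 1)) * q"
      using q by (simp add: divide_simps) (simp add: q_def algebra_simps)
    finally show ?thesis using q Suc by simp
  qed simp
  have 3: "sigma0_val n a2 l + sigma2_val n a3 l = - (real l3 * (real l2 + a2 + 1) + real l2 * (real l3 + a3 + 1))"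
    by (simp add: sigma0_val_def sigma2_val_def ll r3 algebra_simps)
  have "tridiag_adj n a2 a3 (\<lambda>x. gram n a1 a2 a3 x m) l
     = (if l2 = 0 then 0 else sigma0_val n a2 (l1, l2 - 1) * gram n a1 a2 a3 (l1, l2 - 1) m)
       - (sigma0_val n a2 l + sigma2_val n a3 l) * G
       + (if l3 = 0 then 0 else sigma2_val n a3 (l1, l2 + 1) * gram n a1 a2 a3 (l1, l2 + 1) m)"
    by (simp add: tridiag_adj_def ll l3_def G_def)
  also have "\<dots> = G * (real l2 * real (snd m) * (q + 1) / p - real l2 * (q + 1))
       + (real l3 * (real l2 + a2 + 1) + real l2 * (real l3 + a3 + 1)) * G
       + G * (real l3 * real (third n m) * (p + 1) / q - real l3 * (p + 1))"
    unfolding 1 2 3 minus_mult_left[symmetric] diff_minus_eq_add ..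
  also have "\<dots> = G * (real l2 * real (snd m) * (q + 1) / p + real l3 * real (third n m) * (p + 1) / q
      - (real l2 * (q + 1) + real l3 * (p + 1) - real l3 * (real l2 + a2 + 1) - real l2 * (real l3 + a3 + 1)))"
    by (simp add: algebra_simps)
  also have "real l2 * (q + 1) + real l3 * (p + 1) - real l3 * (real l2 + a2 + 1) - real l2 * (real l3 + a3 + 1)
      = real l2 * real (third n m) + real l3 * real (snd m)"
    by (simp add: p_def q_def algebra_simps)
  finally show ?thesis by (simp add: p_def q_def G_def ll l3_def algebra_simps)
qed

lemma tridiag_adj_gram_commute:
  assumes "a2 > - 1" "a3 > - 1" "l \<in> idx n" "m \<in> idx n"
  shows "tridiag_adj n a2 a3 (\<lambda>x. gram n a1 a2 a3 x m) l = tridiag_adj n a2 a3 (\<lambda>x. gram n a1 a2 a3 x l) m"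
  using assms by (simp add: tridiag_adj_gram gram_commute[of n a1 a2 a3 l m] add_ac mult_ac)

lemma tridiag_adj_sum:
  "tridiag_adj n a2 a3 (\<lambda>x. \<Sum>l\<in>A. c l * g l x) m = (\<Sum>l\<in>A. c l * tridiag_adj n a2 a3 (g l) m)"
  unfolding tridiag_adj_def
  by (cases "snd m = 0"; cases "third n m = 0")
    (simp_all add: sum_distrib_left sum.distrib sum_subtractf sum_negf algebra_simps)

text \<open>
  Summation by parts moves the operator onto the Gram matrix, and self-adjointness moves it on to the index \<open>m\<close>,
  where the row has become a Kronecker delta.
\<close>

lemma dual_row_tridiag:
  assumes a: "a2 > - 1" "a3 > - 1" and c: "dual_row n a1 a2 a3 k c" and m: "m \<in> idx n"
  shows "(\<Sum>l\<in>idx n. tridiag n a2 a3 c l * gram n a1 a2 a3 l m)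
     = tridiag_adj n a2 a3 (\<lambda>x. if x = k then 1 else 0) m"
proof -
  define D where "D = (\<lambda>x. \<Sum>l\<in>idx n. c l * gram n a1 a2 a3 l x)"
  have D: "D x = (if x = k then 1 else 0)" if "x \<in> idx n" for x
    using c that by (simp add: dual_row_def D_def)
  have "(\<Sum>l\<in>idx n. tridiag n a2 a3 c l * gram n a1 a2 a3 l m)
      = (\<Sum>l\<in>idx n. c l * tridiag_adj n a2 a3 (\<lambda>x. gram n a1 a2 a3 x l) m)"
    unfolding tridiag_adjoint using a m
    by (intro sum.cong refl arg_cong2[of _ _ _ _ "(*)"] tridiag_adj_gram_commute)
  also have "\<dots> = tridiag_adj n a2 a3 D m"
    unfolding D_def tridiag_adj_sum
    by (intro sum.cong refl arg_cong2[of _ _ _ _ "(*)"] arg_cong[of _ _ "\<lambda>g. tridiag_adj n a2 a3 g m"] ext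
        gram_commute)
  also have "\<dots> = tridiag_adj n a2 a3 (\<lambda>x. if x = k then 1 else 0) m"
    using m by (auto simp: tridiag_adj_def D idx_def third_def)
  finally show ?thesis .
qed

text \<open>
  Applying the operator to a row gives a combination of the Kronecker deltas at \<open>k\<close> and its two neighbours, which can
  be solved for the upper one.
\<close>

lemma dual_row_step:
  assumes a: "a2 > - 1" "a3 > - 1" and k: "k1 + k2 < n"
    and c: "dual_row n a1 a2 a3 (k1, k2) c"
    and c': "k2 > 0 \<Longrightarrow> dual_row n a1 a2 a3 (k1, k2 - 1) c'"
  shows "dual_row n a1 a2 a3 (k1, k2 + 1) (\<lambda>l.
     ((sigma0_val n a2 (k1, k2) + sigma2_val n a3 (k1, k2)) * c l - sigma2_val n a3 (k1, k2) * c' l + tridiag n a2 a3 c l)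
       / sigma0_val n a2 (k1, k2))"
  unfolding dual_row_def
proof
  fix m assume m: "m \<in> idx n"
  define u where "u = sigma0_val n a2 (k1, k2)"
  define d where "d = sigma2_val n a3 (k1, k2)"
  have "real k1 + real k2 - real n < 0" "real k2 + a2 + 1 > 0" using k a by linarith+
  then have u: "u \<noteq> 0" by (simp add: u_def sigma0_val_def)
  have C: "(\<Sum>l\<in>idx n. c l * gram n a1 a2 a3 l m) = (if m = (k1, k2) then 1 else 0)"
    using c m by (simp add: dual_row_def)
  have C': "d * (\<Sum>l\<in>idx n. c' l * gram n a1 a2 a3 l m) = d * (if k2 > 0 \<and> m = (k1, k2 - 1) then 1 else 0)"
    using c' m by (cases "k2 = 0") (simp_all add: dual_row_def d_def sigma2_val_def)
  have "(\<Sum>l\<in>idx n. ((u + d) * c l - d * c' l + tridiag n a2 a3 c l) / u * gram n a1 a2 a3 l m)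
     = ((u + d) * (\<Sum>l\<in>idx n. c l * gram n a1 a2 a3 l m) - d * (\<Sum>l\<in>idx n. c' l * gram n a1 a2 a3 l m)
        + (\<Sum>l\<in>idx n. tridiag n a2 a3 c l * gram n a1 a2 a3 l m)) / u"
    unfolding sum_distrib_left sum.distrib[symmetric] sum_subtractf[symmetric] sum_divide_distrib
    by (rule sum.cong[OF refl]) (simp only: times_divide_eq_left ring_distribs mult.assoc)
  also have "\<dots> = (if m = (k1, k2 + 1) then 1 else 0)"
  proof -
    obtain x y where xy: "m = (x, y)" by (cases m)
    have "((u + d) * (if m = (k1, k2) then 1 else 0) - d * (if k2 > 0 \<and> m = (k1, k2 - 1) then 1 else 0)
        + tridiag_adj n a2 a3 (\<lambda>x. if x = (k1, k2) then 1 else 0) m)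
      = (if m = (k1, k2 + 1) then u else 0)"
    proof (cases "x = k1")
      case False
      then show ?thesis by (simp add: xy tridiag_adj_def)
    next
      case True
      consider "y = k2 + 1" | "y = k2" | "k2 = Suc y" | "y \<noteq> k2 + 1" "y \<noteq> k2" "k2 \<noteq> Suc y" by blast
      then show ?thesis
      proof cases
        case 1
        then show ?thesis using True by (cases k2) (auto simp: xy tridiag_adj_def u_def)
      next
        case 2
        then show ?thesis using True by (cases k2) (simp_all add: xy tridiag_adj_def u_def d_def)
      next
        case 3
        then show ?thesis using True k by (simp add: xy tridiag_adj_def u_def d_def third_def)
      next
        case 4
        then show ?thesis using True by (auto simp: xy tridiag_adj_def)
      qed
    qed
    then show ?thesis unfolding C C' dual_row_tridiag[OF a c m] using u by simp
  qed
  finally show "(\<Sum>l\<in>idx n. ((sigma0_val n a2 (k1, k2) + sigma2_val n a3 (k1, k2)) * c l - sigma2_val n a3 (k1, k2) * c' l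
       + tridiag n a2 a3 c l) / sigma0_val n a2 (k1, k2) * gram n a1 a2 a3 l m) = (if m = (k1, k2 + 1) then 1 else 0)"
    unfolding u_def d_def .
qed

lemma dual_row_swap:
  "dual_row n a2 a1 a3 (prod.swap k) (\<lambda>l. c (prod.swap l)) \<longleftrightarrow> dual_row n a1 a2 a3 k c"
proof -
  have gs: "gram n a1 a2 a3 (y, x) m = gram n a2 a1 a3 (x, y) (prod.swap m)" for x y m
    using gram_swap[of n a2 a1 a3 "(y, x)" m] by simp
  have gs2: "(\<Sum>l\<in>idx n. c (prod.swap l) * gram n a2 a1 a3 l (prod.swap m)) = (\<Sum>l\<in>idx n. c l * gram n a1 a2 a3 l m)" for m
    by (rule sum.reindex_bij_witness[of _ prod.swap prod.swap])
      (auto simp: idx_def gs)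
  have eq: "(\<Sum>l\<in>idx n. c (prod.swap l) * gram n a2 a1 a3 l m)
      = (\<Sum>l\<in>idx n. c l * gram n a1 a2 a3 l (prod.swap m))" for m
    using gs2[of "prod.swap m"] by simp
  have img: "prod.swap ` idx n = idx n"
    by (force simp: idx_def image_iff)
  have "m = prod.swap k \<longleftrightarrow> prod.swap m = k" for m by (metis swap_swap)
  then have "dual_row n a2 a1 a3 (prod.swap k) (\<lambda>l. c (prod.swap l)) \<longleftrightarrow>
      (\<forall>m\<in>prod.swap ` idx n. (\<Sum>l\<in>idx n. c l * gram n a1 a2 a3 l m) = (if m = k then 1 else 0))"
    unfolding dual_row_def eq by simp
  then show ?thesis unfolding img dual_row_def .
qed

lemma dual_row_exists:
  assumes a: "a1 > - 1" "a2 > - 1" "a3 > - 1"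
  shows "k1 + k2 \<le> n \<Longrightarrow> \<exists>c. dual_row n a1 a2 a3 (k1, k2) c"
proof -
  have col: "k1 + k2 \<le> n \<Longrightarrow> \<exists>c. dual_row n a1 a2 a3 (k1, k2) c"
    if "\<exists>c. dual_row n a1 a2 a3 (k1, 0) c" "a2 > - 1" for k1 k2 a1 a2
  proof (induction k2 rule: less_induct)
    case (less k2)
    show ?case
    proof (cases k2)
      case 0
      then show ?thesis using that(1) by simp
    next
      case (Suc h)
      obtain c where c: "dual_row n a1 a2 a3 (k1, h) c" using less Suc by force
      have "\<exists>c'. h > 0 \<longrightarrow> dual_row n a1 a2 a3 (k1, h - 1) c'"
      proof (cases "h > 0")
        case True
        then have "\<exists>c'. dual_row n a1 a2 a3 (k1, h - 1) c'" using less Suc by (intro less.IH) auto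
        then show ?thesis by blast
      qed simp
      then obtain c' where "h > 0 \<Longrightarrow> dual_row n a1 a2 a3 (k1, h - 1) c'" by blast
      then show ?thesis using dual_row_step[OF that(2) a(3) _ c, of c'] less.prems Suc by auto
    qed
  qed
  assume k: "k1 + k2 \<le> n"
  have "dual_row n a2 a1 a3 (0, 0) (\<lambda>l. step1_value n a1 a2 a3 (prod.swap l))"
    using dual_row_vertex[OF a] dual_row_swap[of n a2 a1 a3 "(0, 0)"] by simp
  then have "\<exists>c. dual_row n a2 a1 a3 (0, k1) c" using col[of a2 a1 0 k1] a k by auto
  then obtain c where "dual_row n a2 a1 a3 (0, k1) c" ..
  then have "dual_row n a1 a2 a3 (k1, 0) (\<lambda>l. c (prod.swap l))"
    using dual_row_swap[of n a1 a2 a3 "(0, k1)" c] by simp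
  then show ?thesis using col[of a1 a2 k1 k2] a k by blast
qed

text \<open>
  The inverse of the Gram matrix, extended by zero in the lower index.
\<close>

definition dual_coeff :: "nat \<Rightarrow> real \<Rightarrow> real \<Rightarrow> real \<Rightarrow> nat \<times> nat \<Rightarrow> nat \<times> nat \<Rightarrow> real" where
  "dual_coeff n a1 a2 a3 k l =
     (if l \<in> idx n then (SOME c. dual_row n a1 a2 a3 k c) l else 0)"

lemma dual_row_dual_coeff:
  assumes a: "a1 > - 1" "a2 > - 1" "a3 > - 1" and k: "k \<in> idx n"
  shows "dual_row n a1 a2 a3 k (dual_coeff n a1 a2 a3 k)"
proof -
  have "\<exists>c. dual_row n a1 a2 a3 k c"
    using dual_row_exists[OF a, of "fst k" "snd k" n] k by (auto simp: idx_def)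
  then have "dual_row n a1 a2 a3 k (SOME c. dual_row n a1 a2 a3 k c)" by (rule someI_ex)
  moreover have "dual_row n a1 a2 a3 k (dual_coeff n a1 a2 a3 k) \<longleftrightarrow> dual_row n a1 a2 a3 k (SOME c. dual_row n a1 a2 a3 k c)"
    unfolding dual_row_def[of n a1 a2 a3 k "dual_coeff n a1 a2 a3 k"]
      dual_row_def[of n a1 a2 a3 k "SOME c. dual_row n a1 a2 a3 k c"]
    by (simp add: dual_coeff_def)
  ultimately show ?thesis by simp
qed

text \<open>
  Both sides equal the sandwich \<open>c G e\<close>. Taking \<open>c\<close> and \<open>e\<close> from one family of rows gives symmetry, and varying
  \<open>c\<close> alone gives uniqueness.
\<close>

lemma dual_row_transpose:
  assumes c: "dual_row n a1 a2 a3 k c" and e: "dual_row n a1 a2 a3 l e" and k: "k \<in> idx n" and l: "l \<in> idx n"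
  shows "c l = e k"
proof -
  have "c l = (\<Sum>j\<in>idx n. if j = l then c j else 0)"
    using l by (simp add: finite_idx)
  also have "\<dots> = (\<Sum>j\<in>idx n. c j * (if j = l then 1 else 0))"
    by (rule sum.cong) simp_all
  also have "\<dots> = (\<Sum>j\<in>idx n. c j * (\<Sum>m\<in>idx n. e m * gram n a1 a2 a3 m j))"
    using e by (intro sum.cong) (simp_all add: dual_row_def)
  also have "\<dots> = (\<Sum>m\<in>idx n. (\<Sum>j\<in>idx n. c j * gram n a1 a2 a3 j m) * e m)"
    unfolding sum_distrib_left sum_distrib_right
    by (subst sum.swap) (simp add: gram_commute[of n a1 a2 a3] mult_ac)
  also have "\<dots> = (\<Sum>m\<in>idx n. (if m = k then 1 else 0) * e m)"
    using c by (intro sum.cong) (simp_all add: dual_row_def)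
  also have "\<dots> = (\<Sum>m\<in>idx n. if m = k then e m else 0)"
    by (rule sum.cong) simp_all
  also have "\<dots> = e k" using k by (simp add: finite_idx)
  finally show ?thesis .
qed

lemma dual_coeff_commute:
  assumes a: "a1 > - 1" "a2 > - 1" "a3 > - 1" and k: "k \<in> idx n" and l: "l \<in> idx n"
  shows "dual_coeff n a1 a2 a3 k l = dual_coeff n a1 a2 a3 l k"
  by (rule dual_row_transpose[OF dual_row_dual_coeff[OF a k] dual_row_dual_coeff[OF a l] k l])

lemma dual_row_unique:
  assumes a: "a1 > - 1" "a2 > - 1" "a3 > - 1"
    and c: "dual_row n a1 a2 a3 k c" and k: "k \<in> idx n" and l: "l \<in> idx n"
  shows "c l = dual_coeff n a1 a2 a3 k l"
  unfolding dual_coeff_commute[OF a k l] by (rule dual_row_transpose[OF c dual_row_dual_coeff[OF a l] k l])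

section \<open>Dirichlet integrals and the dual basis\<close>

lemma beta_nn_integral:
  fixes a b :: real
  assumes "a > 0" "b > 0"
  shows "(\<integral>\<^sup>+t. ennreal (t powr (a - 1) * (1 - t) powr (b - 1)) * indicator {0..1} t \<partial>lborel) = ennreal (Beta a b)"
  by (rule nn_integral_has_integral_lebesgue'[OF _ has_integral_Beta_real[OF assms]]) simp

lemma beta_nn_integral_scaled:
  fixes a b r :: real
  assumes ab: "a > 0" "b > 0" and r: "r > 0"
  shows "(\<integral>\<^sup>+y. ennreal (y powr (a - 1) * (r - y) powr (b - 1)) * indicator {0..r} y \<partial>lborel)
     = ennreal (r powr (a + b - 1) * Beta a b)"
proof -
  have "(\<integral>\<^sup>+y. ennreal (y powr (a - 1) * (r - y) powr (b - 1)) * indicator {0..r} y \<partial>lborel)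
     = ennreal \<bar>r\<bar> * (\<integral>\<^sup>+t. ennreal ((0 + r * t) powr (a - 1) * (r - (0 + r * t)) powr (b - 1))
           * indicator {0..r} (0 + r * t) \<partial>lborel)"
    using r by (intro nn_integral_real_affine) auto
  also have "(\<integral>\<^sup>+t. ennreal ((0 + r * t) powr (a - 1) * (r - (0 + r * t)) powr (b - 1))
           * indicator {0..r} (0 + r * t) \<partial>lborel)
     = (\<integral>\<^sup>+t. ennreal (r powr (a + b - 2)) * (ennreal (t powr (a - 1) * (1 - t) powr (b - 1))
           * indicator {0..1} t) \<partial>lborel)"
  proof (rule nn_integral_cong)
    fix t :: real
    show "ennreal ((0 + r * t) powr (a - 1) * (r - (0 + r * t)) powr (b - 1)) * indicator {0..r} (0 + r * t)
       = ennreal (r powr (a + b - 2)) * (ennreal (t powr (a - 1) * (1 - t) powr (b - 1)) * indicator {0..1} t)"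
    proof (cases "t \<in> {0..1}")
      case True
      have "r - r * t = r * (1 - t)" by (simp add: algebra_simps)
      then have "(r * t) powr (a - 1) * (r - r * t) powr (b - 1)
          = (r powr (a - 1) * r powr (b - 1)) * (t powr (a - 1) * (1 - t) powr (b - 1))"
        using True r by (simp add: powr_mult mult_ac)
      also have "r powr (a - 1) * r powr (b - 1) = r powr (a + b - 2)"
        unfolding powr_add[symmetric] by (simp add: algebra_simps)
      finally show ?thesis using True r
        by (simp add: indicator_def mult_le_cancel_left1 ennreal_mult'[symmetric])
    next
      case False
      then have "r * t \<notin> {0..r}" using r by (auto simp: zero_le_mult_iff mult_le_cancel_left2)
      then show ?thesis using False by simp
    qed
  qed
  also have "\<dots> = ennreal (r powr (a + b - 2)) * ennreal (Beta a b)"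
    using ab by (subst nn_integral_cmult) (simp_all add: beta_nn_integral)
  also have "ennreal \<bar>r\<bar> * \<dots> = ennreal (r powr (a + b - 1) * Beta a b)"
  proof -
    have "r powr (a + b - 1) = r powr 1 * r powr (a + b - 2)"
      unfolding powr_add[symmetric] by simp
    then show ?thesis using r ab by (simp add: ennreal_mult'[symmetric] ennreal_mult''[symmetric] mult_ac)
  qed
  finally show ?thesis .
qed

lemma triangle_borel [measurable]: "triangle \<in> sets borel"
proof -
  have "triangle = {x. 0 \<le> fst x} \<inter> {x. 0 \<le> snd x} \<inter> {x. fst x + snd x \<le> 1}"
    by (auto simp: triangle_def)
  moreover have "closed ({x :: real \<times> real. 0 \<le> fst x} \<inter> {x. 0 \<le> snd x} \<inter> {x. fst x + snd x \<le> 1})"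
    by (intro closed_Int closed_Collect_le continuous_intros)
  ultimately show ?thesis by (simp add: borel_closed)
qed

lemma dirichlet_density_measurable:
  "(\<lambda>x. indicator triangle x * (fst x powr a * snd x powr b * (1 - (fst x + snd x)) powr c)) \<in> borel_measurable borel"
proof -
  have [measurable]: "fst \<in> borel_measurable (borel :: (real \<times> real) measure)"
      "snd \<in> borel_measurable (borel :: (real \<times> real) measure)"
    by (intro borel_measurable_continuous_onI continuous_intros)+
  show ?thesis by measurable
qed

text \<open>
  Integrating over \<open>x\<^sub>2\<close> first, a scaled Beta integral, leaves another Beta integral in \<open>x\<^sub>1\<close>.
\<close>

lemma dirichlet_nn_integral:
  fixes a b c :: real
  assumes abc: "a > 0" "b > 0" "c > 0"
  shows "(\<integral>\<^sup>+x. ennreal (indicator triangle x * (fst x powr (a - 1) * snd x powr (b - 1)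
            * (1 - (fst x + snd x)) powr (c - 1))) \<partial>lborel)
     = ennreal (Gamma a * Gamma b * Gamma c / Gamma (a + b + c))"
proof -
  define f :: "real \<times> real \<Rightarrow> ennreal" where
    "f = (\<lambda>x. ennreal (indicator triangle x * (fst x powr (a - 1) * snd x powr (b - 1)
            * (1 - (fst x + snd x)) powr (c - 1))))"
  have meas: "f \<in> borel_measurable (lborel \<Otimes>\<^sub>M lborel)"
  proof -
    have "f \<in> borel_measurable borel" unfolding f_def
      by (intro measurable_compose[OF _ measurable_ennreal] dirichlet_density_measurable)
    then show ?thesis by (simp add: lborel_prod)
  qed
  have Bpos: "Beta b c \<ge> 0" using abc by (simp add: Beta_def)
  have inner: "(\<integral>\<^sup>+y. f (x, y) \<partial>lborel)
      = ennreal (Beta b c) * (ennreal (x powr (a - 1) * (1 - x) powr (b + c - 1)) * indicator {0..1} x)" for x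
  proof (cases "0 \<le> x \<and> x < 1")
    case True
    have "f (x, y) = ennreal (x powr (a - 1)) * (ennreal (y powr (b - 1) * ((1 - x) - y) powr (c - 1))
        * indicator {0..1 - x} y)" for y
      using True by (auto simp: f_def triangle_def indicator_def ennreal_mult'[symmetric] algebra_simps)
    then have "(\<integral>\<^sup>+y. f (x, y) \<partial>lborel) = ennreal (x powr (a - 1))
        * (\<integral>\<^sup>+y. ennreal (y powr (b - 1) * ((1 - x) - y) powr (c - 1)) * indicator {0..1 - x} y \<partial>lborel)"
      by (simp add: nn_integral_cmult)
    also have "\<dots> = ennreal (x powr (a - 1)) * ennreal ((1 - x) powr (b + c - 1) * Beta b c)"
      using True abc by (subst beta_nn_integral_scaled) auto
    finally show ?thesis using True Bpos
      by (simp add: ennreal_mult'[symmetric] ennreal_mult''[symmetric] mult_ac)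
  next
    case False
    then have "f (x, y) = 0" for y
      by (auto simp: f_def triangle_def indicator_def)
    moreover have "(1 - x) powr (b + c - 1) = 0 \<or> indicator {0..1} x = (0 :: ennreal)"
      using False by (auto simp: indicator_def)
    ultimately show ?thesis by auto
  qed
  have "(\<integral>\<^sup>+x. f x \<partial>lborel) = (\<integral>\<^sup>+x. \<integral>\<^sup>+y. f (x, y) \<partial>lborel \<partial>lborel)"
    using lborel.nn_integral_fst[OF meas] by (simp add: lborel_prod)
  also have "\<dots> = ennreal (Beta b c) * ennreal (Beta a (b + c))"
    unfolding inner using abc beta_nn_integral[of a "b + c"] by (simp add: nn_integral_cmult)
  also have "\<dots> = ennreal (Gamma a * Gamma b * Gamma c / Gamma (a + b + c))"
  proof -
    have "Gamma (b + c) \<noteq> 0" using abc by (intro less_imp_neq[symmetric] Gamma_real_pos) simp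
    then show ?thesis using Bpos
      by (simp add: ennreal_mult'[symmetric] Beta_def add_ac mult_ac)
  qed
  finally show ?thesis unfolding f_def .
qed

lemma Gamma_shift: "(x :: real) > 0 \<Longrightarrow> Gamma (x + real n) = Gamma x * pochhammer x n"
proof -
  assume x: "x > 0"
  then have "Gamma x > 0" by (rule Gamma_real_pos)
  moreover have "x \<notin> \<int>\<^sub>\<le>\<^sub>0" using x by (auto elim!: nonpos_Ints_cases)
  ultimately show ?thesis by (simp add: pochhammer_Gamma)
qed

lemma weight_moment:
  fixes a1 a2 a3 :: real
  assumes a: "a1 > - 1" "a2 > - 1" "a3 > - 1"
  shows "has_bochner_integral lborel (\<lambda>x. indicator triangle x *
       (weight a1 a2 a3 x * (fst x ^ i * snd x ^ j * (1 - (fst x + snd x)) ^ r)))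
     (pochhammer (a1 + 1) i * pochhammer (a2 + 1) j * pochhammer (a3 + 1) r
        / pochhammer (a1 + a2 + a3 + 3) (i + j + r))"
proof -
  define A where "A = Gamma (a1 + a2 + a3 + 3) / (Gamma (a1 + 1) * Gamma (a2 + 1) * Gamma (a3 + 1))"
  define g :: "real \<times> real \<Rightarrow> real" where "g = (\<lambda>x. indicator triangle x * (fst x powr (a1 + 1 + real i - 1)
      * snd x powr (a2 + 1 + real j - 1) * (1 - (fst x + snd x)) powr (a3 + 1 + real r - 1)))"
  have pw: "x powr a * x ^ m = x powr (a + 1 + real m - 1)" if "x \<ge> 0" for x a :: real and m
    using that by (cases "x = 0") (simp_all add: powr_add powr_realpow)
  have eq: "indicator triangle x * (weight a1 a2 a3 x * (fst x ^ i * snd x ^ j * (1 - (fst x + snd x)) ^ r))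
      = A * g x" for x
  proof (cases "x \<in> triangle")
    case True
    then have "fst x \<ge> 0" "snd x \<ge> 0" "1 - (fst x + snd x) \<ge> 0" by (auto simp: triangle_def)
    from this[THEN pw, symmetric] show ?thesis using True
      by (simp only: g_def weight_def case_prod_beta A_def mult_ac)
  qed (simp add: g_def)
  have pos: "a1 + 1 + real i > 0" "a2 + 1 + real j > 0" "a3 + 1 + real r > 0" using a by linarith+
  have G: "Gamma (a1 + 1) > 0" "Gamma (a2 + 1) > 0" "Gamma (a3 + 1) > 0" "Gamma (a1 + a2 + a3 + 3) > 0"
    using a by (auto intro!: Gamma_real_pos)
  define I where "I = Gamma (a1 + 1 + real i) * Gamma (a2 + 1 + real j) * Gamma (a3 + 1 + real r)
      / Gamma (a1 + 1 + real i + (a2 + 1 + real j) + (a3 + 1 + real r))"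
  have nn: "(\<integral>\<^sup>+x. ennreal (g x) \<partial>lborel) = ennreal I"
    unfolding g_def I_def by (rule dirichlet_nn_integral[OF pos])
  have "I \<ge> 0" unfolding I_def using pos by (intro divide_nonneg_nonneg mult_nonneg_nonneg less_imp_le Gamma_real_pos) auto
  moreover have "g \<in> borel_measurable lborel"
    unfolding g_def measurable_lborel2 by (rule dirichlet_density_measurable)
  moreover have "g x \<ge> 0" for x by (simp add: g_def)
  ultimately have "has_bochner_integral lborel g I"
    using nn by (intro has_bochner_integral_nn_integral) auto
  then have "has_bochner_integral lborel (\<lambda>x. A * g x) (A * I)"
    by (rule has_bochner_integral_mult_right)
  moreover have "A * I = pochhammer (a1 + 1) i * pochhammer (a2 + 1) j * pochhammer (a3 + 1) r
        / pochhammer (a1 + a2 + a3 + 3) (i + j + r)"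
  proof -
    have e: "a1 + 1 + real i + (a2 + 1 + real j) + (a3 + 1 + real r) = a1 + a2 + a3 + 3 + real (i + j + r)" by simp
    show ?thesis unfolding I_def A_def e
      using a Gamma_shift[of "a1 + a2 + a3 + 3" "i + j + r"]
      by (simp add: Gamma_shift G[THEN less_imp_neq, symmetric])
  qed
  ultimately show ?thesis unfolding eq by simp
qed

lemma bernstein_eq:
  "bernstein n k x = fact n / (fact (fst k) * fact (snd k) * fact (third n k))
     * (fst x ^ fst k * snd x ^ snd k * (1 - (fst x + snd x)) ^ third n k)"
  by (cases k; cases x) (simp add: third_def)

lemma bernstein_product_integral:
  assumes a: "a1 > - 1" "a2 > - 1" "a3 > - 1" and k: "k \<in> idx n" and l: "l \<in> idx n"
  shows "has_bochner_integral lborel (\<lambda>x. indicator triangle x *\<^sub>R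
       (weight a1 a2 a3 x * bernstein n k x * bernstein n l x)) (gram n a1 a2 a3 k l)"
proof -
  define C :: real where "C = fact n / (fact (fst k) * fact (snd k) * fact (third n k))
      * (fact n / (fact (fst l) * fact (snd l) * fact (third n l)))"
  let ?h = "\<lambda>x. indicator triangle x * (weight a1 a2 a3 x * (fst x ^ (fst k + fst l)
      * snd x ^ (snd k + snd l) * (1 - (fst x + snd x)) ^ (third n k + third n l)))"
  have deg: "fst k + fst l + (snd k + snd l) + (third n k + third n l) = 2 * n"
    using k l by (auto simp: idx_def third_def)
  have "has_bochner_integral lborel (\<lambda>x. C * ?h x) (C * (pochhammer (a1 + 1) (fst k + fst l)
      * pochhammer (a2 + 1) (snd k + snd l) * pochhammer (a3 + 1) (third n k + third n l)
        / pochhammer (a1 + a2 + a3 + 3) (2 * n)))"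
    using weight_moment[OF a, of "fst k + fst l" "snd k + snd l" "third n k + third n l"]
    unfolding deg by (rule has_bochner_integral_mult_right)
  moreover have "C * ?h x = indicator triangle x *\<^sub>R (weight a1 a2 a3 x * bernstein n k x * bernstein n l x)" for x
    by (simp add: bernstein_eq C_def power_add mult_ac)
  moreover have "C * (pochhammer (a1 + 1) (fst k + fst l)
      * pochhammer (a2 + 1) (snd k + snd l) * pochhammer (a3 + 1) (third n k + third n l)
        / pochhammer (a1 + a2 + a3 + 3) (2 * n)) = gram n a1 a2 a3 k l"
    by (simp add: C_def gram_def gram_factor_def power2_eq_square mult_ac)
  ultimately show ?thesis by simp
qed

lemma jacobi_inner_combination:
  assumes a: "a1 > - 1" "a2 > - 1" "a3 > - 1" and l: "l \<in> idx n"
    and f: "\<And>x. f x = (\<Sum>k\<in>idx n. c k * bernstein n k x)"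
  shows "jacobi_inner a1 a2 a3 f (bernstein n l) = (\<Sum>k\<in>idx n. c k * gram n a1 a2 a3 k l)"
proof -
  have "has_bochner_integral lborel (\<lambda>x. \<Sum>k\<in>idx n. c k * (indicator triangle x *\<^sub>R
       (weight a1 a2 a3 x * bernstein n k x * bernstein n l x))) (\<Sum>k\<in>idx n. c k * gram n a1 a2 a3 k l)"
    using a l by (intro has_bochner_integral_sum has_bochner_integral_mult_right bernstein_product_integral)
  moreover have "(\<Sum>k\<in>idx n. c k * (indicator triangle x *\<^sub>R (weight a1 a2 a3 x * bernstein n k x * bernstein n l x)))
     = indicator triangle x *\<^sub>R (weight a1 a2 a3 x * f x * bernstein n l x)" for x
    by (simp add: f sum_distrib_left sum_distrib_right mult_ac)
  ultimately show ?thesis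
    by (simp add: jacobi_inner_def set_lebesgue_integral_def has_bochner_integral_integral_eq)
qed

definition bernstein_span :: "nat \<Rightarrow> (real \<times> real \<Rightarrow> real) set" where
  "bernstein_span n = {f. \<exists>c. \<forall>x. f x = (\<Sum>k\<in>idx n. c k * bernstein n k x)}"

lemma bernstein_span_add:
  assumes "f \<in> bernstein_span n" "g \<in> bernstein_span n"
  shows "(\<lambda>x. f x + g x) \<in> bernstein_span n"
proof -
  obtain c d where "\<And>x. f x = (\<Sum>k\<in>idx n. c k * bernstein n k x)" "\<And>x. g x = (\<Sum>k\<in>idx n. d k * bernstein n k x)"
    using assms by (auto simp: bernstein_span_def)
  then show ?thesis unfolding bernstein_span_def
    by (auto intro!: exI[of _ "\<lambda>k. c k + d k"] simp: sum.distrib distrib_right)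
qed

lemma bernstein_span_cmult:
  assumes "f \<in> bernstein_span n"
  shows "(\<lambda>x. r * f x) \<in> bernstein_span n"
proof -
  obtain c where "\<And>x. f x = (\<Sum>k\<in>idx n. c k * bernstein n k x)"
    using assms by (auto simp: bernstein_span_def)
  then show ?thesis unfolding bernstein_span_def
    by (auto intro!: exI[of _ "\<lambda>k. r * c k"] simp: sum_distrib_left mult_ac)
qed

lemma bernstein_span_sum:
  "finite A \<Longrightarrow> (\<And>i. i \<in> A \<Longrightarrow> f i \<in> bernstein_span n) \<Longrightarrow> (\<lambda>x. \<Sum>i\<in>A. f i x) \<in> bernstein_span n"
proof (induction A rule: finite_induct)
  case empty
  then show ?case by (auto simp: bernstein_span_def intro!: exI[of _ "\<lambda>_. 0"])
qed (simp add: bernstein_span_add)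

text \<open>
  Degree elevation: multiply by \<open>1 = x\<^sub>1 + x\<^sub>2 + x\<^sub>3\<close> until the degree is \<open>n\<close>.
\<close>

lemma barycentric_monomial_in_span:
  "i + j + r \<le> n \<Longrightarrow> (\<lambda>x. fst x ^ i * snd x ^ j * (1 - (fst x + snd x)) ^ r) \<in> bernstein_span n"
proof (induction "n - (i + j + r)" arbitrary: i j r)
  case 0
  then have n: "n = i + j + r" by simp
  let ?C = "fact n / (fact i * fact j * fact r) :: real"
  have eq: "fst x ^ i * snd x ^ j * (1 - (fst x + snd x)) ^ r
      = (\<Sum>k\<in>idx n. (if k = (i, j) then 1 / ?C else 0) * bernstein n k x)" for x :: "real \<times> real"
  proof -
    have "(\<Sum>k\<in>idx n. (if k = (i, j) then 1 / ?C else 0) * bernstein n k x)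
       = (\<Sum>k\<in>idx n. if k = (i, j) then 1 / ?C * bernstein n k x else 0)"
      by (rule sum.cong) simp_all
    also have "\<dots> = 1 / ?C * bernstein n (i, j) x"
      by (subst sum.delta) (simp_all add: finite_idx, simp add: idx_def n)
    also have "\<dots> = fst x ^ i * snd x ^ j * (1 - (fst x + snd x)) ^ r"
      by (simp add: bernstein_eq third_def n)
    finally show ?thesis ..
  qed
  show ?case unfolding bernstein_span_def by (intro CollectI exI allI) (rule eq)
next
  case (Suc d)
  let ?m = "\<lambda>i j r (x :: real \<times> real). fst x ^ i * snd x ^ j * (1 - (fst x + snd x)) ^ r"
  have "?m (Suc i) j r \<in> bernstein_span n" "?m i (Suc j) r \<in> bernstein_span n" "?m i j (Suc r) \<in> bernstein_span n"
    by (rule Suc.hyps(1); use Suc.hyps(2) in simp)+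
  then have "(\<lambda>x. ?m (Suc i) j r x + ?m i (Suc j) r x + ?m i j (Suc r) x) \<in> bernstein_span n"
    by (intro bernstein_span_add)
  moreover have "?m (Suc i) j r x + ?m i (Suc j) r x + ?m i j (Suc r) x = ?m i j r x" for x
  proof -
    have "?m (Suc i) j r x + ?m i (Suc j) r x + ?m i j (Suc r) x
        = ?m i j r x * (fst x + snd x + (1 - (fst x + snd x)))"
      unfolding power_Suc by (simp only: algebra_simps)
    then show ?thesis by simp
  qed
  ultimately show ?case by simp
qed

lemma poly_spaceI: "(\<And>x1 x2. f (x1, x2) = (\<Sum>(i, j)\<in>idx n. c (i, j) * x1 ^ i * x2 ^ j)) \<Longrightarrow> f \<in> poly_space n"
  unfolding poly_space_def by blast

lemma poly_space_lincomb:
  assumes "f \<in> poly_space n" "g \<in> poly_space n"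
  shows "(\<lambda>x. r * f x + s * g x) \<in> poly_space n"
proof -
  obtain c d where c: "\<And>x1 x2. f (x1, x2) = (\<Sum>(i, j)\<in>idx n. c (i, j) * x1 ^ i * x2 ^ j)"
    and d: "\<And>x1 x2. g (x1, x2) = (\<Sum>(i, j)\<in>idx n. d (i, j) * x1 ^ i * x2 ^ j)"
    using assms unfolding poly_space_def by blast
  show ?thesis
    by (rule poly_spaceI[where c = "\<lambda>p. r * c p + s * d p"])
      (simp add: c d sum_distrib_left sum.distrib case_prod_beta algebra_simps)
qed

text \<open>
  The last factor is expanded one power at a time.
\<close>

lemma barycentric_monomial_in_poly_space:
  "i + j + r \<le> n \<Longrightarrow> (\<lambda>x. fst x ^ i * snd x ^ j * (1 - (fst x + snd x)) ^ r) \<in> poly_space n"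
proof (induction r arbitrary: i j)
  case 0
  show ?case
  proof (rule poly_spaceI[where c = "\<lambda>p. if p = (i, j) then 1 else 0"])
    fix x1 x2 :: real
    have "(\<Sum>(i', j')\<in>idx n. (if (i', j') = (i, j) then 1 else 0) * x1 ^ i' * x2 ^ j')
        = (\<Sum>p\<in>idx n. if p = (i, j) then x1 ^ i * x2 ^ j else 0)"
      by (rule sum.cong) (auto split: if_splits)
    also have "\<dots> = x1 ^ i * x2 ^ j" using 0 by (subst sum.delta) (simp_all add: finite_idx, simp add: idx_def)
    finally show "fst (x1, x2) ^ i * snd (x1, x2) ^ j * (1 - (fst (x1, x2) + snd (x1, x2))) ^ 0
        = (\<Sum>(i', j')\<in>idx n. (if (i', j') = (i, j) then 1 else 0) * x1 ^ i' * x2 ^ j')" by simp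
  qed
next
  case (Suc r)
  let ?m = "\<lambda>i j (x :: real \<times> real). fst x ^ i * snd x ^ j * (1 - (fst x + snd x)) ^ r"
  have m: "?m i j \<in> poly_space n" "?m (Suc i) j \<in> poly_space n" "?m i (Suc j) \<in> poly_space n"
    by (rule Suc.IH; use Suc.prems in simp)+
  have "(\<lambda>x. 1 * (1 * ?m i j x + (- 1) * ?m (Suc i) j x) + (- 1) * ?m i (Suc j) x) \<in> poly_space n"
    by (intro poly_space_lincomb m)
  then show ?case by (simp add: algebra_simps)
qed

lemma poly_space_eq_bernstein_span: "poly_space n = bernstein_span n"
proof (intro equalityI subsetI)
  fix f assume "f \<in> poly_space n"
  then obtain c where c: "\<And>x1 x2. f (x1, x2) = (\<Sum>(i, j)\<in>idx n. c (i, j) * x1 ^ i * x2 ^ j)"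
    unfolding poly_space_def by blast
  have "(\<lambda>x. \<Sum>p\<in>idx n. c p * (fst x ^ fst p * snd x ^ snd p * (1 - (fst x + snd x)) ^ 0)) \<in> bernstein_span n"
    by (intro bernstein_span_sum bernstein_span_cmult finite_idx barycentric_monomial_in_span) (auto simp: idx_def)
  moreover have "f = (\<lambda>x. \<Sum>p\<in>idx n. c p * (fst x ^ fst p * snd x ^ snd p * (1 - (fst x + snd x)) ^ 0))"
    by (auto simp: fun_eq_iff c case_prod_beta mult_ac)
  ultimately show "f \<in> bernstein_span n" by simp
next
  fix f assume "f \<in> bernstein_span n"
  then obtain c where c: "f = (\<lambda>x. \<Sum>k\<in>idx n. c k * bernstein n k x)"
    unfolding bernstein_span_def by blast
  have B: "(\<lambda>x. c k * bernstein n k x) \<in> poly_space n" if "k \<in> idx n" for k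
  proof -
    have "fst k + snd k + third n k \<le> n" using that by (auto simp: idx_def third_def)
    note barycentric_monomial_in_poly_space[OF this]
    from poly_space_lincomb[OF this this, of "c k * (fact n / (fact (fst k) * fact (snd k) * fact (third n k)))" 0]
    show ?thesis by (simp add: bernstein_eq mult_ac)
  qed
  have "(\<lambda>x. \<Sum>k\<in>A. c k * bernstein n k x) \<in> poly_space n" if "finite A" "A \<subseteq> idx n" for A
    using that
  proof (induction A rule: finite_induct)
    case empty
    then show ?case by (auto intro: poly_spaceI[where c = "\<lambda>_. 0"])
  next
    case (insert k A)
    then show ?case using poly_space_lincomb[OF B[of k], of "\<lambda>x. \<Sum>k\<in>A. c k * bernstein n k x" 1 1] by simp
  qed
  then show "f \<in> poly_space n" unfolding c using finite_idx by blast
qed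

text \<open>
  Integration against the Bernstein basis turns the defining conditions of a dual polynomial into those of a row of the
  inverse Gram matrix.
\<close>

lemma dual_bernstein_iff:
  assumes a: "a1 > - 1" "a2 > - 1" "a3 > - 1" and k: "k \<in> idx n"
  shows "is_dual_bernstein n a1 a2 a3 k D \<longleftrightarrow> D = (\<lambda>x. \<Sum>l\<in>idx n. dual_coeff n a1 a2 a3 k l * bernstein n l x)"
proof
  assume "is_dual_bernstein n a1 a2 a3 k D"
  then have D: "D \<in> poly_space n"
    "\<And>l. l \<in> idx n \<Longrightarrow> jacobi_inner a1 a2 a3 D (bernstein n l) = (if k = l then 1 else 0)"
    by (simp_all add: is_dual_bernstein_def)
  obtain c where c: "\<And>x. D x = (\<Sum>l\<in>idx n. c l * bernstein n l x)"
    using D(1) unfolding poly_space_eq_bernstein_span bernstein_span_def by blast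
  have "dual_row n a1 a2 a3 k c"
    unfolding dual_row_def
  proof
    fix m assume m: "m \<in> idx n"
    show "(\<Sum>l\<in>idx n. c l * gram n a1 a2 a3 l m) = (if m = k then 1 else 0)"
      using D(2)[OF m] jacobi_inner_combination[OF a m c] by auto
  qed
  then have "c l = dual_coeff n a1 a2 a3 k l" if "l \<in> idx n" for l
    using dual_row_unique[OF a _ k that] by blast
  then show "D = (\<lambda>x. \<Sum>l\<in>idx n. dual_coeff n a1 a2 a3 k l * bernstein n l x)"
    by (simp add: fun_eq_iff c)
next
  assume D: "D = (\<lambda>x. \<Sum>l\<in>idx n. dual_coeff n a1 a2 a3 k l * bernstein n l x)"
  then have "D \<in> poly_space n"
    unfolding poly_space_eq_bernstein_span bernstein_span_def by blast
  moreover have "jacobi_inner a1 a2 a3 D (bernstein n l) = (if k = l then 1 else 0)" if "l \<in> idx n" for l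
  proof -
    have "jacobi_inner a1 a2 a3 D (bernstein n l) = (\<Sum>j\<in>idx n. dual_coeff n a1 a2 a3 k j * gram n a1 a2 a3 j l)"
      by (rule jacobi_inner_combination[OF a that]) (simp add: D)
    also have "\<dots> = (if l = k then 1 else 0)"
      using dual_row_dual_coeff[OF a k] that unfolding dual_row_def by blast
    finally show ?thesis by auto
  qed
  ultimately show "is_dual_bernstein n a1 a2 a3 k D" by (simp add: is_dual_bernstein_def)
qed

lemma dual_bernstein_eq:
  assumes "a1 > - 1" "a2 > - 1" "a3 > - 1" "k \<in> idx n"
  shows "dual_bernstein n a1 a2 a3 k = (\<lambda>x. \<Sum>l\<in>idx n. dual_coeff n a1 a2 a3 k l * bernstein n l x)"
  unfolding dual_bernstein_def dual_bernstein_iff[OF assms] by simp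

text \<open>
  Integrating a Bezier form of the dual polynomial against the basis exhibits it as a row of the inverse, and rows of the
  inverse are unique.
\<close>

lemma bezier_form_iff:
  assumes a: "a1 > - 1" "a2 > - 1" "a3 > - 1" and k: "k \<in> idx n"
  shows "is_bezier_form n (dual_bernstein n a1 a2 a3 k) c \<longleftrightarrow> c = dual_coeff n a1 a2 a3 k"
proof
  assume c: "is_bezier_form n (dual_bernstein n a1 a2 a3 k) c"
  have "is_dual_bernstein n a1 a2 a3 k (dual_bernstein n a1 a2 a3 k)"
    using dual_bernstein_iff[OF assms] dual_bernstein_eq[OF assms] by simp
  then have "dual_row n a1 a2 a3 k c"
    unfolding dual_row_def is_dual_bernstein_def
  proof (intro ballI)
    fix m assume m: "m \<in> idx n"
    assume D: "dual_bernstein n a1 a2 a3 k \<in> poly_space n \<and> (\<forall>l\<in>idx n.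
      jacobi_inner a1 a2 a3 (dual_bernstein n a1 a2 a3 k) (bernstein n l) = (if k = l then 1 else 0))"
    have "jacobi_inner a1 a2 a3 (dual_bernstein n a1 a2 a3 k) (bernstein n m)
        = (\<Sum>l\<in>idx n. c l * gram n a1 a2 a3 l m)"
      using c unfolding is_bezier_form_def by (intro jacobi_inner_combination[OF a m]) blast
    then show "(\<Sum>l\<in>idx n. c l * gram n a1 a2 a3 l m) = (if m = k then 1 else 0)"
      using D m by auto
  qed
  then have "c l = dual_coeff n a1 a2 a3 k l" if "l \<in> idx n" for l
    using dual_row_unique[OF a _ k that] by blast
  moreover have "c l = dual_coeff n a1 a2 a3 k l" if "l \<notin> idx n" for l
  proof -
    have "c l = 0" using that c unfolding is_bezier_form_def by blast
    then show ?thesis using that by (simp add: dual_coeff_def)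
  qed
  ultimately show "c = dual_coeff n a1 a2 a3 k" by blast
next
  assume "c = dual_coeff n a1 a2 a3 k"
  then show "is_bezier_form n (dual_bernstein n a1 a2 a3 k) c"
    by (simp add: is_bezier_form_def dual_bernstein_eq[OF assms] dual_coeff_def)
qed

lemma bezier_coeff_eq:
  assumes "a1 > - 1" "a2 > - 1" "a3 > - 1" "k \<in> idx n"
  shows "bezier_coeff n a1 a2 a3 k = dual_coeff n a1 a2 a3 k"
  unfolding bezier_coeff_def bezier_form_iff[OF assms] by simp

section \<open>The three-term recurrence of Hahn polynomials\<close>

text \<open>
  The real values of the coefficient expressions in Clenshaw's algorithm.
\<close>

definition hahn_c :: "real \<Rightarrow> real \<Rightarrow> nat \<Rightarrow> real" where
  "hahn_c a b l = (2 * real l + (a + b + 1) + 1) / ((real l + (a + b + 1)) * (2 * real l + (a + b + 1) - 1))"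

definition hahn_d :: "real \<Rightarrow> real \<Rightarrow> real \<Rightarrow> nat \<Rightarrow> real" where
  "hahn_d a b M l = (if l = 0 then 0 else hahn_c a b l * real l * (real l + M + (a + b + 1)) * (real l + b))"

definition hahn_e :: "real \<Rightarrow> real \<Rightarrow> nat \<Rightarrow> real" where
  "hahn_e a M l = (real l + a + 1) * (M - real l)"

definition hahn_a :: "real \<Rightarrow> real \<Rightarrow> real \<Rightarrow> real \<Rightarrow> nat \<Rightarrow> real" where
  "hahn_a t a b M l =
     (if l = 0 then (a + b + 2) * t - (a + 1) * M
      else hahn_c a b l * pochhammer (2 * real l + (a + b + 1) - 1) 2 * t - hahn_d a b M l - hahn_e a M l)"

definition hahn_b :: "real \<Rightarrow> real \<Rightarrow> real \<Rightarrow> nat \<Rightarrow> real" where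
  "hahn_b a b M l = 0 - hahn_d a b M l * hahn_e a M (l - 1)"

lemma hahn_zero: "hahn 0 t a b M = 1"
  by (simp add: hahn_finite_sum[OF order_refl])

lemma hahn_one:
  assumes "a > - 1" "N \<ge> 1"
  shows "hahn 1 t a b (real N) = hahn_a t a b (real N) 0"
  using assms by (simp add: hahn_finite_sum[OF order_refl] hahn_a_def divide_simps) (simp add: algebra_simps)

text \<open>
  The coefficient of \<open>pochhammer (- t) r\<close> in the Hahn polynomial of degree \<open>l\<close>, without its denominator, which does
  not depend on \<open>l\<close>.
\<close>

definition hahn_num :: "real \<Rightarrow> real \<Rightarrow> real \<Rightarrow> nat \<Rightarrow> nat \<Rightarrow> real" where
  "hahn_num a s M l r = pochhammer (a + 1) l * pochhammer (- M) l
     * (pochhammer (- real l) r * pochhammer (real l + s) r)"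

text \<open>
  What remains of the recurrence after the common Pochhammer factors are removed; \<open>p\<close> stands for \<open>L + a + b + 1\<close>.
  The two fractions over \<open>L + p - 1\<close> combine to one in which that factor cancels.
\<close>

lemma hahn_recurrence_identity:
  fixes L p b a M R :: real
  assumes L: "L > 0" and p: "p > 0" "L + p - 1 > 0" and b: "b = p - L - a - 1"
  shows "((a + L + 1) * (L - M)) * (- (L + 1) * (p + R) * (p + R + 1) / p)
     = (L + p) * (L + p + 1) / p * ((R + 1) * ((R - L) * (p + R)) - (a + 1 + R) * (R - M) * (R + 1))
       - ((L + p + 1) * L * (p + M) * (L + b) / (p * (L + p - 1)) + (L + a + 1) * (M - L)) * ((R - L) * (p + R))
       + (L + p + 1) * L * (p + M) * (L + b) / (p * (L + p - 1)) * ((p - 1) * (R - L) * (R - L + 1) / (- L))" (is "?l = ?r")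
proof -
  define X where "X = (p + M) * (p - a - 1)"
  have pa: "L + b = p - a - 1" by (simp add: b)
  define i where "i = inverse p"
  define j where "j = inverse (L + p - 1)"
  have i: "p * i = 1" using p by (simp add: i_def)
  have j: "(L + p - 1) * j = 1" using p by (simp add: j_def)
  have d1: "x / p = x * i" for x by (simp add: i_def divide_inverse)
  have d2: "x / (p * (L + p - 1)) = x * i * j" for x by (simp add: i_def j_def divide_inverse)
  have t: "(L + p + 1) * X * i * j * L * ((p - 1) * (R - L) * (R - L + 1) / (- L))
     = - ((L + p + 1) * X * i * j * ((p - 1) * (R - L) * (R - L + 1)))"
    using L by simp
  have s: "(R - L) * ((p - 1) * (R - L + 1) + L * (p + R)) = (R - L) * ((L + p - 1) * (R + 1))"
    by (simp add: algebra_simps)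
  have tt: "(L + p + 1) * X * i * j * L * ((R - L) * (p + R)) + (L + p + 1) * X * i * j * ((p - 1) * (R - L) * (R - L + 1))
     = (L + p + 1) * X * i * (((L + p - 1) * j) * ((R - L) * (R + 1)))" 
  proof -
    have "(L + p + 1) * X * i * j * L * ((R - L) * (p + R)) + (L + p + 1) * X * i * j * ((p - 1) * (R - L) * (R - L + 1))
      = (L + p + 1) * X * i * j * ((R - L) * ((p - 1) * (R - L + 1) + L * (p + R)))" by (simp add: distrib_left mult_ac)
    then show ?thesis unfolding s by (simp add: mult_ac)
  qed
  have fin: "((a + L + 1) * (L - M)) * (- (L + 1) * (p + R) * (p + R + 1))
     = (L + p) * (L + p + 1) * ((R + 1) * ((R - L) * (p + R)) - (a + 1 + R) * (R - M) * (R + 1))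
       - (L + p + 1) * ((p + M) * (p - a - 1)) * ((R - L) * (R + 1))
       - p * ((L + a + 1) * (M - L)) * ((R - L) * (p + R))"
    by algebra
  have q1: "(L + p + 1) * L * (p + M) * (L + b) / (p * (L + p - 1)) = (L + p + 1) * X * i * j * L"
    unfolding d2 pa X_def by simp
  have alg: "B * i * Y - (c + e) * w + - T = i * (B * Y) - (c * w + T) - 1 * e * w" for B Y c e w T :: real
    by (simp add: algebra_simps)
  have "?r = i * ((L + p) * (L + p + 1) * ((R + 1) * ((R - L) * (p + R)) - (a + 1 + R) * (R - M) * (R + 1)))
      - ((L + p + 1) * X * i * j * L * ((R - L) * (p + R)) + (L + p + 1) * X * i * j * ((p - 1) * (R - L) * (R - L + 1)))
      - (p * i) * ((L + a + 1) * (M - L)) * ((R - L) * (p + R))"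
    unfolding q1 t d1 i by (rule alg)
  also have "\<dots> = i * (((a + L + 1) * (L - M)) * (- (L + 1) * (p + R) * (p + R + 1)))"
  proof -
    have alg: "i * Y - F * x * i * (1 * z) - 1 * e * w = i * (Y - F * x * z - p * e * w)" for Y F x z e w
    proof -
      have "i * (Y - F * x * z - p * e * w) = i * Y - F * x * i * z - (p * i) * e * w"
        by (simp add: algebra_simps)
      then show ?thesis by (simp add: i)
    qed
    show ?thesis unfolding tt j i fin X_def[symmetric] by (rule alg)
  qed
  also have "\<dots> = ?l" unfolding d1 by (simp add: mult_ac)
  finally show ?thesis ..
qed

text \<open>
  Comparison of coefficients in the basis \<open>pochhammer (- t) r\<close>, in which multiplication by \<open>t\<close> is two-term.
\<close>

lemma hahn_num_recurrence:
  fixes a b s M :: real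
  assumes s: "s = a + b + 1" "s > - 1" and l: "l \<ge> 1"
  defines "K \<equiv> hahn_c a b l * pochhammer (2 * real l + s - 1) 2"
  shows "hahn_num a s M (Suc l) (Suc r) =
       K * (real (Suc r) * hahn_num a s M l (Suc r) - (a + 1 + real r) * (real r - M) * real (Suc r) * hahn_num a s M l r)
       - (hahn_d a b M l + hahn_e a M l) * hahn_num a s M l (Suc r)
       + hahn_b a b M l * hahn_num a s M (l - 1) (Suc r)"
    and "hahn_num a s M (Suc l) 0 = - (hahn_d a b M l + hahn_e a M l) * hahn_num a s M l 0
       + hahn_b a b M l * hahn_num a s M (l - 1) 0"
proof -
  obtain h where h: "l = Suc h" using l by (cases l) auto
  define L where "L = real l"
  define p where "p = L + s"
  \<comment> \<open>the Pochhammer factors common to all terms: \<open>Z\<close> collects those of length \<open>r\<close>, \<open>W\<close> those of length \<open>h = l - 1\<close>\<close>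
  define Z where "Z = pochhammer (- L) r * pochhammer p r"
  define W where "W = pochhammer (a + 1) h * pochhammer (- M) h"
  define f where "f = (a + L) * (L - 1 - M)"
  have L: "L > 0" "real h = L - 1" using l by (simp_all add: L_def h)
  have p: "p > 0" "L + p - 1 > 0" using s(2) l h by (simp_all add: p_def L_def)
  have b: "b = p - L - a - 1" using s(1) by (simp add: p_def)
  have W1: "pochhammer (a + 1) l * pochhammer (- M) l = W * f"
    using L by (simp add: h pochhammer_Suc W_def f_def)
  have W2: "pochhammer (a + 1) (Suc l) * pochhammer (- M) (Suc l) = W * f * ((a + L + 1) * (L - M))"
    unfolding pochhammer_Suc[of _ l] using W1 by (simp add: L_def algebra_simps)
  have Z1: "pochhammer (- L) (Suc r) * pochhammer p (Suc r) = Z * ((real r - L) * (p + real r))"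
    by (simp add: pochhammer_Suc Z_def)
  have Z2: "pochhammer (- (L + 1)) (Suc r) * pochhammer (p + 1) (Suc r)
      = - (L + 1) * Z * (p + real r) * (p + real r + 1) / p"
  proof -
    have "p * pochhammer (p + 1) (Suc r) = pochhammer p r * (p + real r) * (p + real r + 1)"
      unfolding pochhammer_rec[symmetric] by (simp add: pochhammer_Suc)
    then have "pochhammer (p + 1) (Suc r) = pochhammer p r * (p + real r) * (p + real r + 1) / p"
      using p by (simp add: field_simps)
    then show ?thesis unfolding pochhammer_rec[of "- (L + 1)"] by (simp add: Z_def)
  qed
  have Z3: "pochhammer (- real h) (Suc r) * pochhammer (p - 1) (Suc r)
      = (p - 1) * Z * (real r - L) * (real r - L + 1) / (- L)"
  proof -
    have "(- L) * pochhammer (- L + 1) (Suc r) = pochhammer (- L) r * (real r - L) * (real r - L + 1)"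
      unfolding pochhammer_rec[symmetric] by (simp add: pochhammer_Suc algebra_simps)
    then have "pochhammer (- L + 1) (Suc r) = pochhammer (- L) r * (real r - L) * (real r - L + 1) / (- L)"
      using L by (simp add: field_simps)
    moreover have "- real h = - L + 1" using L by simp
    ultimately show ?thesis unfolding pochhammer_rec[of "p - 1"] by (simp add: Z_def)
  qed
  have K: "K = (L + p) * (L + p + 1) / p"
    using p by (simp add: K_def hahn_c_def s(1)[symmetric] p_def L_def numeral_2_eq_2 pochhammer_Suc)
  have D: "hahn_d a b M l = (L + p + 1) * L * (p + M) * (L + b) / (p * (L + p - 1))"
  proof -
    have e: "real l = L" "2 * L + (a + b + 1) + 1 = L + p + 1" "2 * L + (a + b + 1) - 1 = L + p - 1"
      "L + (a + b + 1) = p" "L + M + (a + b + 1) = p + M"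
      by (simp_all add: p_def L_def s(1))
    show ?thesis using l unfolding hahn_d_def hahn_c_def e by simp
  qed
  have E: "hahn_e a M l = (L + a + 1) * (M - L)"
    by (simp add: hahn_e_def L_def)
  have B: "hahn_b a b M l = hahn_d a b M l * f"
    using L by (simp add: hahn_b_def hahn_e_def h f_def) (simp add: algebra_simps)
  have n0: "hahn_num a s M l r = W * f * Z"
    unfolding hahn_num_def W1 L_def[symmetric] p_def[symmetric] Z_def ..
  have n1: "hahn_num a s M l (Suc r) = W * f * (Z * ((real r - L) * (p + real r)))"
    unfolding hahn_num_def W1 L_def[symmetric] p_def[symmetric] Z1 ..
  have n2: "hahn_num a s M (Suc l) (Suc r) = W * f * ((a + L + 1) * (L - M))
      * (- (L + 1) * Z * (p + real r) * (p + real r + 1) / p)"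
    unfolding hahn_num_def W2 Z2[symmetric] by (simp add: L_def p_def add_ac)
  have n3: "hahn_num a s M (l - 1) (Suc r) = W * ((p - 1) * Z * (real r - L) * (real r - L + 1) / (- L))"
  proof -
    have e: "l - 1 = h" "real h + s = p - 1" using L(2) by (simp_all add: h p_def)
    show ?thesis unfolding hahn_num_def e Z3 W_def ..
  qed
  have key: "((a + L + 1) * (L - M)) * (- (L + 1) * (p + R) * (p + R + 1) / p)
     = (L + p) * (L + p + 1) / p * ((R + 1) * ((R - L) * (p + R)) - (a + 1 + R) * (R - M) * (R + 1))
       - ((L + p + 1) * L * (p + M) * (L + b) / (p * (L + p - 1)) + (L + a + 1) * (M - L)) * ((R - L) * (p + R))
       + (L + p + 1) * L * (p + M) * (L + b) / (p * (L + p - 1)) * ((p - 1) * (R - L) * (R - L + 1) / (- L))" for R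
    by (rule hahn_recurrence_identity[OF L(1) p b])
  have "W * f * ((a + L + 1) * (L - M)) * (- (L + 1) * Z * (p + real r) * (p + real r + 1) / p)
      = W * f * Z * (((a + L + 1) * (L - M)) * (- (L + 1) * (p + real r) * (p + real r + 1) / p))"
    by simp
  also have "\<dots> = (L + p) * (L + p + 1) / p * (real (Suc r) * (W * f * (Z * ((real r - L) * (p + real r))))
         - (a + 1 + real r) * (real r - M) * real (Suc r) * (W * f * Z))
       - ((L + p + 1) * L * (p + M) * (L + b) / (p * (L + p - 1)) + (L + a + 1) * (M - L))
          * (W * f * (Z * ((real r - L) * (p + real r))))
       + ((L + p + 1) * L * (p + M) * (L + b) / (p * (L + p - 1))) * f
          * (W * ((p - 1) * Z * (real r - L) * (real r - L + 1) / (- L)))"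
  proof -
    have alg: "W * f * Z * (k * (S * A - c * d * S) - e * A + D * (q * x * y / m))
        = k * (S * (W * f * (Z * A)) - c * d * S * (W * f * Z)) - e * (W * f * (Z * A))
          + D * f * (W * (q * Z * x * y / m))" for k S A c d e D q x y m :: real
      by (simp add: algebra_simps)
    have S: "real (Suc r) = real r + 1" by simp
    show ?thesis unfolding key S by (rule alg)
  qed
  finally show "hahn_num a s M (Suc l) (Suc r) =
       K * (real (Suc r) * hahn_num a s M l (Suc r) - (a + 1 + real r) * (real r - M) * real (Suc r) * hahn_num a s M l r)
       - (hahn_d a b M l + hahn_e a M l) * hahn_num a s M l (Suc r)
       + hahn_b a b M l * hahn_num a s M (l - 1) (Suc r)"
    unfolding B n0 n1 n2 n3 K D E .
  have m0: "hahn_num a s M (Suc l) 0 = W * f * ((a + L + 1) * (L - M))"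
    "hahn_num a s M l 0 = W * f" "hahn_num a s M (l - 1) 0 = W"
    unfolding hahn_num_def W1 W2 by (simp_all add: h W_def)
  show "hahn_num a s M (Suc l) 0 = - (hahn_d a b M l + hahn_e a M l) * hahn_num a s M l 0
       + hahn_b a b M l * hahn_num a s M (l - 1) 0"
    unfolding m0 B E by (simp add: algebra_simps)
qed

lemma hahn_recurrence:
  fixes a b t :: real
  assumes ab: "a > - 1" "b > - 1" and l: "l \<ge> 1" "Suc l \<le> N"
  shows "hahn (Suc l) t a b (real N)
     = hahn_a t a b (real N) l * hahn l t a b (real N) + hahn_b a b (real N) l * hahn (l - 1) t a b (real N)"
proof -
  define M where "M = real N"
  define s where "s = a + b + 1"
  have s: "s > - 1" using ab by (simp add: s_def)
  define q where "q = (\<lambda>r. pochhammer (a + 1) r * pochhammer (- M) r * fact r)"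
  define u where "u = (\<lambda>m r. hahn_num a s M m r / q r)"
  define T where "T = (\<lambda>r. pochhammer (- t) r)"
  define K where "K = hahn_c a b l * pochhammer (2 * real l + s - 1) 2"
  have pa: "pochhammer (a + 1) r \<noteq> 0" for r using ab pochhammer_pos[of "a + 1" r] by simp
  have qS: "q (Suc r) = q r * ((a + 1 + real r) * (real r - M) * real (Suc r))" for r
    by (simp add: q_def pochhammer_Suc algebra_simps)
  have q: "q r \<noteq> 0" if "r \<le> N" for r
    using that pa by (simp add: q_def M_def pochhammer_of_nat_eq_0_iff)
  have H: "hahn m t a b M = (\<Sum>r\<le>Suc l. u m r * T r)" if "m \<le> Suc l" for m
    unfolding hahn_finite_sum[OF that] sum_distrib_left
    by (rule sum.cong[OF refl]) (simp add: u_def q_def T_def hahn_num_def s_def add_ac mult_ac)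
  have tT: "t * T r = real r * T r - T (Suc r)" for r
    by (simp add: T_def pochhammer_Suc algebra_simps)
  have top: "u l (Suc l) = 0" by (simp add: u_def hahn_num_def pochhammer_of_nat_eq_0_lemma)
  have "t * hahn l t a b M = (\<Sum>r\<le>Suc l. u l r * (real r * T r)) - (\<Sum>r\<le>Suc l. u l r * T (Suc r))"
    unfolding H[of l, OF le_SucI[OF order_refl]] sum_distrib_left sum_subtractf[symmetric]
    by (rule sum.cong[OF refl]) (metis tT mult.left_commute right_diff_distrib)
  also have "(\<Sum>r\<le>Suc l. u l r * T (Suc r)) = (\<Sum>r\<le>l. u l r * T (Suc r))"
    by (simp add: top)
  also have "\<dots> = (\<Sum>r\<le>Suc l. (if r = 0 then 0 else u l (r - 1)) * T r)"
    by (simp add: sum.atMost_Suc_shift del: sum.atMost_Suc)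
  also have "(\<Sum>r\<le>Suc l. u l r * (real r * T r)) - (\<Sum>r\<le>Suc l. (if r = 0 then 0 else u l (r - 1)) * T r)
      = (\<Sum>r\<le>Suc l. (real r * u l r - (if r = 0 then 0 else u l (r - 1))) * T r)"
    unfolding sum_subtractf[symmetric] by (rule sum.cong[OF refl]) (simp only: left_diff_distrib right_diff_distrib mult_ac)
  finally have tH: "t * hahn l t a b M = (\<Sum>r\<le>Suc l. (real r * u l r - (if r = 0 then 0 else u l (r - 1))) * T r)" .
  have coeff: "u (Suc l) r = K * (real r * u l r - (if r = 0 then 0 else u l (r - 1)))
      - (hahn_d a b M l + hahn_e a M l) * u l r + hahn_b a b M l * u (l - 1) r" if r: "r \<le> Suc l" for r
  proof (cases r)
    case 0
    then show ?thesis
      using hahn_num_recurrence(2)[OF s_def s l(1), of M] by (simp add: u_def q_def algebra_simps)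
  next
    case (Suc r')
    have qq: "q (Suc r') \<noteq> 0" using q[of r] r l Suc by simp
    have z: "u l r' = (a + 1 + real r') * (real r' - M) * real (Suc r') * hahn_num a s M l r' / q (Suc r')"
      using qq unfolding u_def qS by (simp add: divide_simps)
    show ?thesis unfolding Suc using z hahn_num_recurrence(1)[OF s_def s l(1), of M r', folded K_def]
      by (simp add: u_def diff_divide_distrib add_divide_distrib right_diff_distrib)
  qed
  have "hahn (Suc l) t a b M = (\<Sum>r\<le>Suc l. u (Suc l) r * T r)" by (rule H) simp
  also have "\<dots> = (\<Sum>r\<le>Suc l. K * ((real r * u l r - (if r = 0 then 0 else u l (r - 1))) * T r)
      - (hahn_d a b M l + hahn_e a M l) * (u l r * T r) + hahn_b a b M l * (u (l - 1) r * T r))"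
  proof (rule sum.cong[OF refl])
    fix r assume "r \<in> {..Suc l}"
    then have r: "r \<le> Suc l" by simp
    show "u (Suc l) r * T r = K * ((real r * u l r - (if r = 0 then 0 else u l (r - 1))) * T r)
      - (hahn_d a b M l + hahn_e a M l) * (u l r * T r) + hahn_b a b M l * (u (l - 1) r * T r)"
      unfolding coeff[OF r] by (simp only: distrib_right left_diff_distrib mult.assoc)
  qed
  also have "\<dots> = K * (t * hahn l t a b M) - (hahn_d a b M l + hahn_e a M l) * hahn l t a b M
      + hahn_b a b M l * hahn (l - 1) t a b M"
    unfolding tH unfolding H[of l, OF le_SucI[OF order_refl]] H[of "l - 1", OF le_SucI[OF diff_le_self]]
    by (simp only: sum.distrib sum_subtractf sum_distrib_left)
  also have "\<dots> = hahn_a t a b M l * hahn l t a b M + hahn_b a b M l * hahn (l - 1) t a b M"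
    using l(1) by (simp add: hahn_a_def K_def s_def algebra_simps)
  finally show ?thesis unfolding M_def .
qed

section \<open>Correctness of the procedure\<close>

lemma dual_coeff_swap:
  assumes a: "a1 > - 1" "a2 > - 1" "a3 > - 1" and k: "k \<in> idx n" and l: "l \<in> idx n"
  shows "dual_coeff n a2 a1 a3 (prod.swap k) (prod.swap l) = dual_coeff n a1 a2 a3 k l"
proof -
  have "prod.swap k \<in> idx n" using k by (auto simp: idx_def)
  then have "dual_row n a2 a1 a3 (prod.swap k) (dual_coeff n a2 a1 a3 (prod.swap k))"
    using a by (intro dual_row_dual_coeff)
  then have "dual_row n a1 a2 a3 k (\<lambda>l. dual_coeff n a2 a1 a3 (prod.swap k) (prod.swap l))"
    using dual_row_swap[of n a1 a2 a3 "prod.swap k"] by simp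
  from dual_row_unique[OF a this k l] show ?thesis .
qed

lemma dual_coeff_recurrence:
  assumes a: "a1 > - 1" "a2 > - 1" "a3 > - 1" and k: "k1 + k2 < n" and l: "l \<in> idx n"
  shows "dual_coeff n a1 a2 a3 (k1, k2 + 1) l =
     ((sigma0_val n a2 (k1, k2) + sigma2_val n a3 (k1, k2) - (sigma0_val n a2 l + sigma2_val n a3 l)) * dual_coeff n a1 a2 a3 (k1, k2) l
       - sigma2_val n a3 (k1, k2) * dual_coeff n a1 a2 a3 (k1, k2 - 1) l
       + sigma0_val n a2 l * dual_coeff n a1 a2 a3 (k1, k2) (fst l, snd l + 1)
       + sigma2_val n a3 l * dual_coeff n a1 a2 a3 (k1, k2) (fst l, snd l - 1)) / sigma0_val n a2 (k1, k2)"
proof -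
  have "dual_row n a1 a2 a3 (k1, k2) (dual_coeff n a1 a2 a3 (k1, k2))"
    "dual_row n a1 a2 a3 (k1, k2 - 1) (dual_coeff n a1 a2 a3 (k1, k2 - 1))"
    using a k by (auto intro!: dual_row_dual_coeff simp: idx_def)
  from dual_row_step[OF a(2,3) k this] have "dual_row n a1 a2 a3 (k1, k2 + 1) (\<lambda>l.
     ((sigma0_val n a2 (k1, k2) + sigma2_val n a3 (k1, k2)) * dual_coeff n a1 a2 a3 (k1, k2) l
       - sigma2_val n a3 (k1, k2) * dual_coeff n a1 a2 a3 (k1, k2 - 1) l
       + tridiag n a2 a3 (dual_coeff n a1 a2 a3 (k1, k2)) l) / sigma0_val n a2 (k1, k2))" .
  from dual_row_unique[OF a this _ l] k show ?thesis
    by (simp add: idx_def tridiag_def algebra_simps)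
qed

text \<open>
  Exchanging the two coordinates exchanges the first two parameters and turns the one recurrence into the other.
\<close>

lemma dual_coeff_recurrence_swap:
  assumes a: "a1 > - 1" "a2 > - 1" "a3 > - 1" and k: "k1 + k2 < n" and l: "(l1, l2) \<in> idx n"
  shows "dual_coeff n a1 a2 a3 (k1 + 1, k2) (l1, l2) =
     ((sigma0_val n a1 (k2, k1) + sigma2_val n a3 (k2, k1) - (sigma0_val n a1 (l2, l1) + sigma2_val n a3 (l2, l1))) * dual_coeff n a1 a2 a3 (k1, k2) (l1, l2)
       - sigma2_val n a3 (k2, k1) * dual_coeff n a1 a2 a3 (k1 - 1, k2) (l1, l2)
       + sigma0_val n a1 (l2, l1) * dual_coeff n a1 a2 a3 (k1, k2) (l1 + 1, l2)
       + sigma2_val n a3 (l2, l1) * dual_coeff n a1 a2 a3 (k1, k2) (l1 - 1, l2)) / sigma0_val n a1 (k2, k1)"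
proof -
  let ?E = "dual_coeff n a1 a2 a3" and ?F = "dual_coeff n a2 a1 a3"
  have sw: "?F (y, x) (v, u) = ?E (x, y) (u, v)" if "x + y \<le> n" for x y u v
  proof (cases "u + v \<le> n")
    case True
    then show ?thesis using dual_coeff_swap[OF a, of "(x, y)" n "(u, v)"] that by (simp add: idx_def)
  next
    case False
    then show ?thesis by (simp add: dual_coeff_def idx_def)
  qed
  have "?F (k2, k1 + 1) (l2, l1) =
     ((sigma0_val n a1 (k2, k1) + sigma2_val n a3 (k2, k1) - (sigma0_val n a1 (l2, l1) + sigma2_val n a3 (l2, l1))) * ?F (k2, k1) (l2, l1)
       - sigma2_val n a3 (k2, k1) * ?F (k2, k1 - 1) (l2, l1)
       + sigma0_val n a1 (l2, l1) * ?F (k2, k1) (l2, l1 + 1)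
       + sigma2_val n a3 (l2, l1) * ?F (k2, k1) (l2, l1 - 1)) / sigma0_val n a1 (k2, k1)"
    using dual_coeff_recurrence[OF a(2,1,3), of k2 k1 n "(l2, l1)"] k l by (simp add: idx_def add_ac)
  then show ?thesis using k by (simp add: sw)
qed

definition hoare :: "(state \<Rightarrow> bool) \<Rightarrow> stmt list \<Rightarrow> (state \<Rightarrow> bool) \<Rightarrow> bool" where
  "hoare P p Q \<longleftrightarrow> (\<forall>s. P s \<longrightarrow> (\<exists>s'. exec p s = Some s' \<and> Q s'))"

lemma exec_append: "exec (p @ q) s = Option.bind (exec p s) (exec q)"
proof (induction p arbitrary: s)
  case (Cons st p)
  then show ?case by (cases st) (simp add: Option.bind_assoc fun_upd_def)
qed simp

lemma hoare_append: "hoare P p Q \<Longrightarrow> hoare Q q R \<Longrightarrow> hoare P (p @ q) R"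
  unfolding hoare_def exec_append by fastforce

lemma hoare_Nil: "(\<And>s. P s \<Longrightarrow> Q s) \<Longrightarrow> hoare P [] Q"
  by (simp add: hoare_def)

lemma hoare_assign:
  "(\<And>s. P s \<Longrightarrow> \<exists>x. eval_aexp s e = Some x \<and> Q (s(v \<mapsto> x))) \<Longrightarrow> hoare P [v \<leftarrow> e] Q"
  by (fastforce simp: hoare_def)

lemma hoare_loop_down:
  "(\<And>i. i < m \<Longrightarrow> hoare (I (Suc i)) (body i) (I i)) \<Longrightarrow> hoare (I m) (loop (rev [0..<m]) body) (I 0)"
proof (induction m)
  case 0
  show ?case by (simp add: hoare_Nil)
next
  case (Suc m)
  have "hoare (I (Suc m)) (body m @ loop (rev [0..<m]) body) (I 0)"
    using Suc by (intro hoare_append) auto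
  then show ?case by simp
qed

locale dual_procedure =
  fixes n :: nat and \<alpha>1 \<alpha>2 \<alpha>3 :: real
  assumes gt: "\<alpha>1 > - 1" "\<alpha>2 > - 1" "\<alpha>3 > - 1"
begin

abbreviation E :: "nat \<times> nat \<Rightarrow> nat \<times> nat \<Rightarrow> real" where
  "E \<equiv> dual_coeff n \<alpha>1 \<alpha>2 \<alpha>3"

definition stored :: "((nat \<times> nat) \<times> (nat \<times> nat)) set \<Rightarrow> state \<Rightarrow> bool" where
  "stored S s \<longleftrightarrow> s Alpha1 = Some \<alpha>1 \<and> s Alpha2 = Some \<alpha>2 \<and> s Alpha3 = Some \<alpha>3 \<and>
     (\<forall>(k, l)\<in>S. s (Coef k l) = Some (E k l))"

text \<open>
  Assignments never spoil an entry, since an overwritten entry receives the same true value. A program is therefore described by the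
  entries \<open>R\<close> that it reads and the entries \<open>W\<close> that it adds, in any state that stores a superset of \<open>R\<close>.
\<close>

definition computes :: "((nat \<times> nat) \<times> (nat \<times> nat)) set \<Rightarrow> stmt list
    \<Rightarrow> ((nat \<times> nat) \<times> (nat \<times> nat)) set \<Rightarrow> bool" where
  "computes R p W \<longleftrightarrow> (\<forall>S. R \<subseteq> S \<longrightarrow> hoare (stored S) p (stored (S \<union> W)))"

lemma computes_append:
  assumes p: "computes R p W" and q: "computes R' q W'" and R: "R' \<subseteq> R \<union> W"
  shows "computes R (p @ q) (W \<union> W')"
  unfolding computes_def
proof (intro allI impI)
  fix S assume S: "R \<subseteq> S"
  have "hoare (stored S) p (stored (S \<union> W))" using p S by (auto simp: computes_def)
  moreover have "hoare (stored (S \<union> W)) q (stored (S \<union> W \<union> W'))"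
  proof -
    have "R' \<subseteq> S \<union> W" using S R by blast
    then show ?thesis using q unfolding computes_def by blast
  qed
  ultimately show "hoare (stored S) (p @ q) (stored (S \<union> (W \<union> W')))"
    unfolding Un_assoc by (rule hoare_append)
qed

lemma computes_weaken: "computes R p W \<Longrightarrow> R \<subseteq> R' \<Longrightarrow> W = W' \<Longrightarrow> computes R' p W'"
  by (auto simp: computes_def)

lemma computes_loop:
  assumes "\<And>i. a \<le> i \<Longrightarrow> i < b \<Longrightarrow> computes (R \<union> (\<Union>j\<in>{a..<i}. W j)) (body i) (W i)"
  shows "computes R (loop [a..<b] body) (\<Union>j\<in>{a..<b}. W j)"
  using assms
proof (induction b)
  case 0
  show ?case by (simp add: computes_def hoare_Nil)
next
  case (Suc b)
  show ?case
  proof (cases "a \<le> b")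
    case True
    have "computes R (loop [a..<b] body @ body b) ((\<Union>j\<in>{a..<b}. W j) \<union> W b)"
      using Suc True by (intro computes_append[where R' = "R \<union> (\<Union>j\<in>{a..<b}. W j)"]) auto
    then show ?thesis using True by (simp add: atLeastLessThanSuc Un_commute)
  next
    case False
    then show ?thesis by (simp add: computes_def hoare_Nil)
  qed
qed

lemma computes_loop_independent:
  assumes "\<And>i. a \<le> i \<Longrightarrow> i < b \<Longrightarrow> computes R (body i) (W i)"
  shows "computes R (loop [a..<b] body) (\<Union>j\<in>{a..<b}. W j)"
  by (rule computes_loop) (rule computes_weaken[OF assms], auto)

lemma stored_store: "stored S s \<Longrightarrow> stored (insert (k, l) S) (s(Coef k l \<mapsto> E k l))"
  by (auto simp: stored_def)

lemma hoare_store: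
  assumes "k \<in> idx n" "l \<in> idx n" and P: "\<And>s. P s \<Longrightarrow> stored S s \<and> eval_aexp s e = Some (E k l)"
  shows "hoare P [Coef k l \<leftarrow> e, Coef l k \<leftarrow> Var (Coef k l)] (stored (S \<union> {(k, l), (l, k)}))"
  unfolding hoare_def
proof (intro allI impI)
  fix s assume "P s"
  then have s: "stored S s" and ev: "eval_aexp s e = Some (E k l)" using P by blast+
  have sym: "E k l = E l k" by (rule dual_coeff_commute[OF gt assms(1,2)])
  have "exec [Coef k l \<leftarrow> e, Coef l k \<leftarrow> Var (Coef k l)] s = Some (s(Coef k l \<mapsto> E k l, Coef l k \<mapsto> E k l))"
    using ev by simp
  moreover have "stored (insert (l, k) (insert (k, l) S)) (s(Coef k l \<mapsto> E k l, Coef l k \<mapsto> E l k))"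
    by (intro stored_store s)
  moreover have "S \<union> {(k, l), (l, k)} = insert (l, k) (insert (k, l) S)" by blast
  ultimately show "\<exists>s'. exec [Coef k l \<leftarrow> e, Coef l k \<leftarrow> Var (Coef k l)] s = Some s'
      \<and> stored (S \<union> {(k, l), (l, k)}) s'"
    using sym by simp
qed

lemma stored_mono: "stored S s \<Longrightarrow> R \<subseteq> S \<Longrightarrow> stored R s"
  by (auto simp: stored_def)

lemma computes_store:
  assumes "k \<in> idx n" "l \<in> idx n"
    and ev: "\<And>s. stored R s \<Longrightarrow> eval_aexp s e = Some (E k l)"
  shows "computes R [Coef k l \<leftarrow> e, Coef l k \<leftarrow> Var (Coef k l)] {(k, l), (l, k)}"
  unfolding computes_def by (intro allI impI hoare_store assms(1,2) conjI) (auto intro: ev stored_mono)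

lemma eval_poch_exp: "eval_aexp s e = Some x \<Longrightarrow> eval_aexp s (poch_exp e k) = Some (pochhammer x k)"
  by (induction k) (simp_all add: lift_op_def pochhammer_Suc)

lemma eval_power_exp: "eval_aexp s e = Some x \<Longrightarrow> eval_aexp s (power_exp e k) = Some (x ^ k)"
  by (induction k) (simp_all add: lift_op_def mult.commute)

lemma eval_fact_exp: "eval_aexp s (fact_exp k) = Some (fact k)"
  using eval_poch_exp[of s "Const 1" 1 k] by (simp add: pochhammer_fact)

lemma eval_div: "eval_aexp s e = Some x \<Longrightarrow> eval_aexp s f = Some y \<Longrightarrow> y \<noteq> 0
    \<Longrightarrow> eval_aexp s (e \<oslash> f) = Some (x / y)"
  by (simp add: lift_op_def)

lemma eval_arith:
  "eval_aexp s e = Some x \<Longrightarrow> eval_aexp s f = Some y \<Longrightarrow> eval_aexp s (e \<oplus> f) = Some (x + y)"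
  "eval_aexp s e = Some x \<Longrightarrow> eval_aexp s f = Some y \<Longrightarrow> eval_aexp s (e \<ominus> f) = Some (x - y)"
  "eval_aexp s e = Some x \<Longrightarrow> eval_aexp s f = Some y \<Longrightarrow> eval_aexp s (e \<otimes> f) = Some (x * y)"
  by (simp_all add: lift_op_def)

lemma eval_alpha:
  assumes "stored S s"
  shows "eval_aexp s (Var Alpha1) = Some \<alpha>1" "eval_aexp s (Var Alpha2) = Some \<alpha>2" "eval_aexp s (Var Alpha3) = Some \<alpha>3"
  using assms by (simp_all add: stored_def)

lemma eval_const: "eval_aexp s (Const c) = Some (of_int c)"
  by simp

lemmas eval_rules = eval_div eval_arith eval_alpha eval_const eval_poch_exp eval_power_exp eval_fact_exp

lemma eval_c_star:
  assumes s: "stored S s"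
  shows "eval_aexp s (c_star_exp n l1 i) = Some (c_star n \<alpha>1 \<alpha>2 \<alpha>3 l1 i)"
proof (cases "i = 0")
  case True
  have "pochhammer (\<alpha>2 + \<alpha>3 + of_int 2) (n - l1) > 0" using gt by (intro pochhammer_pos) simp
  then have nz: "pochhammer (\<alpha>2 + \<alpha>3 + of_int 2) (n - l1) \<noteq> 0" by simp
  have "eval_aexp s (c_star_exp n l1 i)
      = Some (pochhammer (\<alpha>1 + of_int 2) n / pochhammer (\<alpha>2 + \<alpha>3 + of_int 2) (n - l1))"
    unfolding c_star_exp_def if_P[OF True] 
    by (rule eval_div[OF _ _ nz]) (intro eval_rules(2,3,4,8-) eval_alpha[OF s])+
  then show ?thesis using True by (simp add: c_star_def)
next
  case False
  have "pochhammer (\<alpha>3 + of_int 1) i > 0" using gt by (intro pochhammer_pos) simp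
  moreover have "pochhammer (\<alpha>2 + \<alpha>3 + of_int (int i) + of_int 1) (n - l1 + 1) > 0"
    using gt False by (intro pochhammer_pos) simp
  ultimately have nz: "fact i * pochhammer (\<alpha>3 + of_int 1) i
      * pochhammer (\<alpha>2 + \<alpha>3 + of_int (int i) + of_int 1) (n - l1 + 1) \<noteq> 0" by simp
  have "eval_aexp s (c_star_exp n l1 i) = Some (of_int (- 1) ^ i
          * ((of_int 2 * of_int (int i) + \<alpha>2 + \<alpha>3 + of_int 1)
               * pochhammer (\<alpha>1 + of_int 2) (n - i)
               * pochhammer (\<alpha>1 + \<alpha>2 + \<alpha>3 + of_int (int n) + of_int 3) i)
          / (fact i * pochhammer (\<alpha>3 + of_int 1) i
               * pochhammer (\<alpha>2 + \<alpha>3 + of_int (int i) + of_int 1) (n - l1 + 1)))"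
    unfolding c_star_exp_def if_not_P[OF False]
    by (rule eval_div[OF _ _ nz]) (intro eval_rules(2,3,4,8-) eval_alpha[OF s])+
  then show ?thesis using False by (simp add: c_star_def)
qed

lemma eval_hahn_exps:
  assumes s: "stored S s"
  shows "l \<ge> 1 \<Longrightarrow> eval_aexp s (hahn_C (Var Alpha2) (Var Alpha3) l) = Some (hahn_c \<alpha>2 \<alpha>3 l)"
    and "eval_aexp s (hahn_D (Var Alpha2) (Var Alpha3) (nat_const M) l) = Some (hahn_d \<alpha>2 \<alpha>3 (real M) l)"
    and "eval_aexp s (hahn_E (Var Alpha2) (nat_const M) l) = Some (hahn_e \<alpha>2 (real M) l)"
    and "eval_aexp s (hahn_A (nat_const t) (Var Alpha2) (Var Alpha3) (nat_const M) l)
          = Some (hahn_a (real t) \<alpha>2 \<alpha>3 (real M) l)"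
    and "eval_aexp s (hahn_B (Var Alpha2) (Var Alpha3) (nat_const M) l) = Some (hahn_b \<alpha>2 \<alpha>3 (real M) l)"
proof -
  have A: "s Alpha2 = Some \<alpha>2" "s Alpha3 = Some \<alpha>3" using s by (simp_all add: stored_def)
  show C: "eval_aexp s (hahn_C (Var Alpha2) (Var Alpha3) l) = Some (hahn_c \<alpha>2 \<alpha>3 l)" if "l \<ge> 1" for l
  proof -
    have "real l + (\<alpha>2 + \<alpha>3 + 1) > 0" "2 * real l + (\<alpha>2 + \<alpha>3 + 1) - 1 > 0" using that gt by linarith+
    then show ?thesis by (simp add: hahn_C_def hahn_s_def hahn_c_def lift_op_def A)
  qed
  show D: "eval_aexp s (hahn_D (Var Alpha2) (Var Alpha3) (nat_const M) l) = Some (hahn_d \<alpha>2 \<alpha>3 (real M) l)" for l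
    using C[of l] by (simp add: hahn_D_def hahn_s_def hahn_d_def lift_op_def A)
  show F: "eval_aexp s (hahn_E (Var Alpha2) (nat_const M) l) = Some (hahn_e \<alpha>2 (real M) l)" for l
    by (simp add: hahn_E_def hahn_e_def lift_op_def A)
  have P: "eval_aexp s (poch_exp (Const 2 \<otimes> nat_const l \<oplus> hahn_s (Var Alpha2) (Var Alpha3) \<ominus> Const 1) 2)
      = Some (pochhammer (2 * real l + (\<alpha>2 + \<alpha>3 + 1) - 1) 2)"
    by (rule eval_poch_exp) (simp add: hahn_s_def lift_op_def A)
  show "eval_aexp s (hahn_A (nat_const t) (Var Alpha2) (Var Alpha3) (nat_const M) l)
          = Some (hahn_a (real t) \<alpha>2 \<alpha>3 (real M) l)"
    using C[of l] D[of l] F[of l] P by (simp add: hahn_A_def hahn_a_def lift_op_def A del: poch_exp.simps)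
  show "eval_aexp s (hahn_B (Var Alpha2) (Var Alpha3) (nat_const M) l) = Some (hahn_b \<alpha>2 \<alpha>3 (real M) l)"
    using D[of l] F[of "l - 1"] by (simp add: hahn_B_def hahn_b_def lift_op_def)
qed

lemma stored_Acc: "stored S s \<Longrightarrow> stored S (s(Acc i \<mapsto> x))"
  by (auto simp: stored_def)

text \<open>
  The invariant of the downward loop, before the accumulator \<open>i - 1\<close> is computed, is
  \<open>(\<Sum>j\<le>N. g j * h j) = (\<Sum>j<i. g j * h j) + V i * h i + B i * V (i + 1) * h (i - 1)\<close>. The three-term recurrence is
  available for \<open>h (i + 1)\<close> with \<open>i < N\<close> only; for \<open>i = N\<close> it is multiplied by the initial accumulator, which is zero.
\<close>

lemma clenshaw_correct:
  fixes \<gamma> :: "nat \<Rightarrow> aexp" and g :: "nat \<Rightarrow> real"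
  assumes \<gamma>: "\<And>s i. stored S s \<Longrightarrow> eval_aexp s (\<gamma> i) = Some (g i)"
  shows "hoare (stored S) (clenshaw_hahn N \<gamma> (nat_const t) (Var Alpha2) (Var Alpha3) (nat_const N))
     (\<lambda>s. stored S s \<and> s (Acc 0) = Some (\<Sum>i\<le>N. g i * hahn i (real t) \<alpha>2 \<alpha>3 (real N)))"
proof -
  define h where "h = (\<lambda>i. hahn i (real t) \<alpha>2 \<alpha>3 (real N))"
  define A where "A = (\<lambda>i. hahn_a (real t) \<alpha>2 \<alpha>3 (real N) i)"
  define B where "B = (\<lambda>i. hahn_b \<alpha>2 \<alpha>3 (real N) i)"
  define I where "I = (\<lambda>i s. stored S s \<and> (\<exists>v0 v1. s (Acc i) = Some v0 \<and> s (Acc (i + 1)) = Some v1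
      \<and> (i = Suc N \<longrightarrow> v0 = 0)
      \<and> (\<Sum>j\<le>N. g j * h j) = (\<Sum>j<i. g j * h j) + v0 * h i + (if i = 0 then 0 else B i * v1 * h (i - 1))))"
  have rec: "h (Suc i) = A i * h i + (if i = 0 then 0 else B i * h (i - 1))" if "i < N" for i
  proof (cases i)
    case 0
    then show ?thesis using that gt hahn_one[of \<alpha>2 N "real t" \<alpha>3] by (simp add: h_def A_def hahn_zero)
  next
    case (Suc j)
    then show ?thesis using that gt hahn_recurrence[of \<alpha>2 \<alpha>3 i N "real t"] by (simp add: h_def A_def B_def)
  qed
  have init: "hoare (stored S) [Acc (N + 1) \<leftarrow> Const 0, Acc (N + 2) \<leftarrow> Const 0] (I (Suc N))"
    unfolding hoare_def by (auto simp: I_def stored_Acc lessThan_Suc_atMost)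
  have step: "hoare (I (Suc i)) [Acc i \<leftarrow> \<gamma> i \<oplus> hahn_A (nat_const t) (Var Alpha2) (Var Alpha3) (nat_const N) i \<otimes> Var (Acc (i + 1))
                  \<oplus> hahn_B (Var Alpha2) (Var Alpha3) (nat_const N) (i + 1) \<otimes> Var (Acc (i + 2))] (I i)"
    if i: "i < Suc N" for i
  proof (rule hoare_assign)
    fix s assume "I (Suc i) s"
    then obtain v0 v1 where st: "stored S s" and v: "s (Acc (Suc i)) = Some v0" "s (Acc (Suc (Suc i))) = Some v1"
      and v0: "Suc i = Suc N \<longrightarrow> v0 = 0"
      and sum: "(\<Sum>j\<le>N. g j * h j) = (\<Sum>j<Suc i. g j * h j) + v0 * h (Suc i) + B (Suc i) * v1 * h i"
      by (auto simp: I_def)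
    let ?v = "g i + A i * v0 + B (Suc i) * v1"
    have ev: "eval_aexp s (\<gamma> i \<oplus> hahn_A (nat_const t) (Var Alpha2) (Var Alpha3) (nat_const N) i \<otimes> Var (Acc (i + 1))
                  \<oplus> hahn_B (Var Alpha2) (Var Alpha3) (nat_const N) (i + 1) \<otimes> Var (Acc (i + 2))) = Some ?v"
      unfolding A_def B_def using v
      using eval_hahn_exps(5)[OF st, where M = N and l = "Suc i"]
      by (intro eval_arith \<gamma>[OF st] eval_hahn_exps(4)[OF st]) simp_all
    have "v0 * h (Suc i) = v0 * (A i * h i + (if i = 0 then 0 else B i * h (i - 1)))"
      using rec[of i] v0 i by (cases "i = N") auto
    then have "(\<Sum>j\<le>N. g j * h j) = (\<Sum>j<i. g j * h j) + ?v * h i + (if i = 0 then 0 else B i * v0 * h (i - 1))"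
      unfolding sum by (simp add: algebra_simps)
    then have "I i (s(Acc i \<mapsto> ?v))"
      using st v i by (simp add: I_def stored_Acc)
    then show "\<exists>x. eval_aexp s (\<gamma> i \<oplus> hahn_A (nat_const t) (Var Alpha2) (Var Alpha3) (nat_const N) i \<otimes> Var (Acc (i + 1))
                  \<oplus> hahn_B (Var Alpha2) (Var Alpha3) (nat_const N) (i + 1) \<otimes> Var (Acc (i + 2))) = Some x \<and> I i (s(Acc i \<mapsto> x))"
      using ev by blast
  qed
  have "hoare (I (N + 1)) (loop (rev [0..<N + 1]) (\<lambda>i.
       [Acc i \<leftarrow> \<gamma> i \<oplus> hahn_A (nat_const t) (Var Alpha2) (Var Alpha3) (nat_const N) i \<otimes> Var (Acc (i + 1))
                  \<oplus> hahn_B (Var Alpha2) (Var Alpha3) (nat_const N) (i + 1) \<otimes> Var (Acc (i + 2))])) (I 0)"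
    by (rule hoare_loop_down) (use step in simp)
  with init have "hoare (stored S) (clenshaw_hahn N \<gamma> (nat_const t) (Var Alpha2) (Var Alpha3) (nat_const N)) (I 0)"
    unfolding clenshaw_hahn_def by (intro hoare_append) simp_all
  then show ?thesis unfolding hoare_def I_def h_def by (fastforce simp: hahn_zero)
qed

lemma step1_value_eq: "l \<in> idx n \<Longrightarrow> E (0, 0) l = step1_value n \<alpha>1 \<alpha>2 \<alpha>3 l"
  using dual_row_unique[OF gt dual_row_vertex[OF gt], where l = l] by (simp add: idx_def)

lemma computes_step1: "computes {} (step1 n) (\<Union>l1\<in>{0..<n + 1}. \<Union>l2\<in>{0..<n - l1 + 1}. {((0, 0), (l1, l2)), ((l1, l2), (0, 0))})"
  unfolding step1_def
proof (intro computes_loop_independent)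
  fix l1 l2 assume l1: "l1 < n + 1" and l2: "l2 < n - l1 + 1"
  then have l: "(l1, l2) \<in> idx n" "(0, 0) \<in> idx n" by (auto simp: idx_def)
  let ?e = "power_exp (Const (- 1)) l1 \<otimes> poch_exp (abs_alpha \<oplus> Const 3) n
            \<oslash> (fact_exp n \<otimes> poch_exp (Var Alpha1 \<oplus> Const 2) l1) \<otimes> Var (Acc 0)"
  let ?p = "clenshaw_hahn (n - l1) (c_star_exp n l1)
         (nat_const l2) (Var Alpha2) (Var Alpha3) (nat_const (n - l1))"
  let ?sum = "\<Sum>i\<le>n - l1. c_star n \<alpha>1 \<alpha>2 \<alpha>3 l1 i * hahn i (real l2) \<alpha>2 \<alpha>3 (real (n - l1))"
  let ?Q = "\<lambda>S s. stored S s \<and> s (Acc 0) = Some ?sum"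
  show "computes {} (?p @ [Coef (0, 0) (l1, l2) \<leftarrow> ?e, Coef (l1, l2) (0, 0) \<leftarrow> Var (Coef (0, 0) (l1, l2))])
     {((0, 0), (l1, l2)), ((l1, l2), (0, 0))}"
    unfolding computes_def
  proof (intro allI impI)
    fix S :: "((nat \<times> nat) \<times> (nat \<times> nat)) set"
    have 1: "hoare (stored S) ?p (?Q S)"
      by (rule clenshaw_correct) (rule eval_c_star)
    have 2: "hoare (?Q S) [Coef (0, 0) (l1, l2) \<leftarrow> ?e, Coef (l1, l2) (0, 0) \<leftarrow> Var (Coef (0, 0) (l1, l2))]
        (stored (S \<union> {((0, 0), (l1, l2)), ((l1, l2), (0, 0))}))"
    proof (rule hoare_store[OF l(2,1)])
      fix s assume s: "?Q S s"
      then have st: "stored S s" by simp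
      have "pochhammer (\<alpha>1 + of_int 2) l1 > 0" using gt by (intro pochhammer_pos) simp
      then have nz: "fact n * pochhammer (\<alpha>1 + of_int 2) l1 \<noteq> 0" by simp
      have "eval_aexp s ?e = Some (of_int (- 1) ^ l1 * pochhammer (\<alpha>1 + \<alpha>2 + \<alpha>3 + of_int 3) n
          / (fact n * pochhammer (\<alpha>1 + of_int 2) l1) * ?sum)"
      proof (rule eval_arith(3))
        show "eval_aexp s (Var (Acc 0)) = Some ?sum" using s by simp
        show "eval_aexp s (power_exp (Const (- 1)) l1 \<otimes> poch_exp (abs_alpha \<oplus> Const 3) n
            \<oslash> (fact_exp n \<otimes> poch_exp (Var Alpha1 \<oplus> Const 2) l1))
          = Some (of_int (- 1) ^ l1 * pochhammer (\<alpha>1 + \<alpha>2 + \<alpha>3 + of_int 3) n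
            / (fact n * pochhammer (\<alpha>1 + of_int 2) l1))"
          by (rule eval_div[OF _ _ nz]) (intro eval_rules(2,3,4,8-) eval_alpha[OF st])+
      qed
      also have "of_int (- 1) ^ l1 * pochhammer (\<alpha>1 + \<alpha>2 + \<alpha>3 + of_int 3) n
          / (fact n * pochhammer (\<alpha>1 + of_int 2) l1) * ?sum = E (0, 0) (l1, l2)"
        using step1_value_eq[OF l(1)] by (simp add: step1_value_def atLeast0AtMost)
      finally have ev: "eval_aexp s ?e = Some (E (0, 0) (l1, l2))" .
      with st show "stored S s \<and> eval_aexp s ?e = Some (E (0, 0) (l1, l2))" by blast
    qed
    from 1 2 show "hoare (stored S) (?p @ [Coef (0, 0) (l1, l2) \<leftarrow> ?e, Coef (l1, l2) (0, 0) \<leftarrow> Var (Coef (0, 0) (l1, l2))])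
        (stored (S \<union> {((0, 0), (l1, l2)), ((l1, l2), (0, 0))}))"
      by (rule hoare_append)
  qed
qed

text \<open>
  Row \<open>k\<close> at the lower indices with first component at least \<open>c\<close>, together with its mirror image.
\<close>

definition cross :: "nat \<times> nat \<Rightarrow> nat \<Rightarrow> ((nat \<times> nat) \<times> (nat \<times> nat)) set" where
  "cross k c = (\<Union>l1\<in>{c..<n + 1}. \<Union>l2\<in>{0..<n - l1 + 1}. {(k, (l1, l2)), ((l1, l2), k)})"

lemma
  assumes "l \<in> idx n" "c \<le> fst l"
  shows cross_mem: "(k, l) \<in> cross k c" and cross_mem': "(l, k) \<in> cross k c"
proof -
  obtain a b where l: "l = (a, b)" by (cases l)
  have "a \<in> {c..<n + 1}" "b \<in> {0..<n - a + 1}" using assms by (auto simp: l idx_def)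
  then show "(k, l) \<in> cross k c" "(l, k) \<in> cross k c" unfolding cross_def l by blast+
qed

lemma eval_recurrence:
  assumes c: "\<And>t. eval_aexp s (c0 t) = Some (x0 t)" "\<And>t. eval_aexp s (c1 t) = Some (x1 t)"
      "\<And>t. eval_aexp s (c2 t) = Some (x2 t)" and nz: "x0 k \<noteq> 0"
    and e: "eval_aexp s (entry n k l) = Some e0" "eval_aexp s (entry n (k - v) l) = Some e1"
      "eval_aexp s (entry n k (l + v)) = Some e2" "eval_aexp s (entry n k (l - v)) = Some e3"
  shows "eval_aexp s (recurrence n c0 c1 c2 v k l)
    = Some (((x1 k - x1 l) * e0 - x2 k * e1 + x0 l * e2 + x2 l * e3) / x0 k)"
  unfolding recurrence_def by (rule eval_div[OF _ _ nz]) (intro eval_arith c e)+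

lemma eval_sigma_tau:
  assumes s: "stored S s"
  shows "eval_aexp s (sigma0 n t) = Some ((of_int (fst t) + of_int (snd t) - real n) * (of_int (snd t) + \<alpha>2 + 1))"
    "eval_aexp s (sigma2 n t) = Some (of_int (snd t) * (of_int (fst t) + of_int (snd t) - \<alpha>3 - real n - 1))"
    "eval_aexp s (sigma1 n t) = Some ((of_int (fst t) + of_int (snd t) - real n) * (of_int (snd t) + \<alpha>2 + 1)
       + of_int (snd t) * (of_int (fst t) + of_int (snd t) - \<alpha>3 - real n - 1))"
    "eval_aexp s (tau0 n t) = Some ((of_int (fst t) + of_int (snd t) - real n) * (of_int (fst t) + \<alpha>1 + 1))"
    "eval_aexp s (tau2 n t) = Some (of_int (fst t) * (of_int (fst t) + of_int (snd t) - \<alpha>3 - real n - 1))"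
    "eval_aexp s (tau1 n t) = Some ((of_int (fst t) + of_int (snd t) - real n) * (of_int (fst t) + \<alpha>1 + 1)
       + of_int (fst t) * (of_int (fst t) + of_int (snd t) - \<alpha>3 - real n - 1))"
  using eval_alpha[OF s]
  by (simp_all add: sigma0_def sigma1_def sigma2_def tau0_def tau1_def tau2_def lift_op_def)

lemma E_outside: "l \<notin> idx n \<Longrightarrow> E k l = 0"
  by (simp add: dual_coeff_def)

lemma computes_sigma_step:
  assumes k: "k1 + k2 < n" and R: "cross (k1, k2) k1 \<subseteq> R" "k2 > 0 \<Longrightarrow> cross (k1, k2 - 1) k1 \<subseteq> R"
    and l: "(l1, l2) \<in> idx n" "k1 \<le> l1"
  shows "computes R
     [Coef (k1, k2 + 1) (l1, l2) \<leftarrow> recurrence n (sigma0 n) (sigma1 n) (sigma2 n) (0, 1) (int k1, int k2) (int l1, int l2),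
      Coef (l1, l2) (k1, k2 + 1) \<leftarrow> Var (Coef (k1, k2 + 1) (l1, l2))]
     {((k1, k2 + 1), (l1, l2)), ((l1, l2), (k1, k2 + 1))}"
proof (rule computes_store[OF _ l(1)])
  show "(k1, k2 + 1) \<in> idx n" using k by (simp add: idx_def)
  fix s assume s: "stored R s"
  have R0: "s (Coef (k1, k2) l) = Some (E (k1, k2) l)" if "l \<in> idx n" "k1 \<le> fst l" for l
    using s R(1) cross_mem[OF that, of "(k1, k2)"] by (auto simp: stored_def)
  have R1: "s (Coef (k1, k2 - 1) l) = Some (E (k1, k2 - 1) l)" if "l \<in> idx n" "k1 \<le> fst l" "k2 > 0" for l
    using s R(2)[OF that(3)] cross_mem[OF that(1,2), of "(k1, k2 - 1)"] by (auto simp: stored_def)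
  let ?k = "(int k1, int k2)" and ?l = "(int l1, int l2)"
  have e0: "eval_aexp s (entry n ?k ?l) = Some (E (k1, k2) (l1, l2))"
    using R0[of "(l1, l2)"] k l by (simp add: entry_def in_idx_def nat_pair_def idx_def)
  have e1: "eval_aexp s (entry n (?k - (0, 1)) ?l) = Some (if k2 = 0 then 0 else E (k1, k2 - 1) (l1, l2))"
    using R1[of "(l1, l2)"] k l by (cases k2) (simp_all add: entry_def in_idx_def nat_pair_def idx_def)
  have e2: "eval_aexp s (entry n ?k (?l + (0, 1))) = Some (E (k1, k2) (l1, l2 + 1))"
    using R0[of "(l1, l2 + 1)"] E_outside[of "(l1, l2 + 1)" "(k1, k2)"] k l
    by (auto simp: entry_def in_idx_def nat_pair_def idx_def nat_add_distrib)
  have e3: "eval_aexp s (entry n ?k (?l - (0, 1))) = Some (if l2 = 0 then 0 else E (k1, k2) (l1, l2 - 1))"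
    using R0[of "(l1, l2 - 1)"] k l by (cases l2) (simp_all add: entry_def in_idx_def nat_pair_def idx_def)
  have nz: "(of_int (fst ?k) + of_int (snd ?k) - real n) * (of_int (snd ?k) + \<alpha>2 + 1) \<noteq> 0"
  proof -
    have "real k1 + real k2 - real n < 0" "real k2 + \<alpha>2 + 1 > 0" using k gt by linarith+
    then show ?thesis by simp
  qed
  show "eval_aexp s (recurrence n (sigma0 n) (sigma1 n) (sigma2 n) (0, 1) ?k ?l) = Some (E (k1, k2 + 1) (l1, l2))"
    unfolding eval_recurrence[of s "sigma0 n" _ "sigma1 n" _ "sigma2 n", OF eval_sigma_tau(1)[OF s] eval_sigma_tau(3)[OF s]
        eval_sigma_tau(2)[OF s] nz e0 e1 e2 e3] dual_coeff_recurrence[OF gt k l(1)]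
    by (simp add: sigma0_val_def sigma2_val_def)
qed

lemma computes_tau_step:
  assumes k: "k1 < n" and R: "cross (k1, 0) k1 \<subseteq> R" "k1 > 0 \<Longrightarrow> cross (k1 - 1, 0) (k1 - 1) \<subseteq> R"
    and l: "(l1, l2) \<in> idx n" "k1 + 1 \<le> l1"
  shows "computes R
     [Coef (k1 + 1, 0) (l1, l2) \<leftarrow> recurrence n (tau0 n) (tau1 n) (tau2 n) (1, 0) (int k1, 0) (int l1, int l2),
      Coef (l1, l2) (k1 + 1, 0) \<leftarrow> Var (Coef (k1 + 1, 0) (l1, l2))]
     {((k1 + 1, 0), (l1, l2)), ((l1, l2), (k1 + 1, 0))}"
proof (rule computes_store[OF _ l(1)])
  show "(k1 + 1, 0) \<in> idx n" using k by (simp add: idx_def)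
  fix s assume s: "stored R s"
  have R0: "s (Coef (k1, 0) l) = Some (E (k1, 0) l)" if "l \<in> idx n" "k1 \<le> fst l" for l
    using s R(1) cross_mem[OF that, of "(k1, 0)"] by (auto simp: stored_def)
  have R1: "s (Coef (k1 - 1, 0) l) = Some (E (k1 - 1, 0) l)" if "l \<in> idx n" "k1 - 1 \<le> fst l" "k1 > 0" for l
    using s R(2)[OF that(3)] cross_mem[OF that(1,2), of "(k1 - 1, 0)"] by (auto simp: stored_def)
  let ?k = "(int k1, 0 :: int)" and ?l = "(int l1, int l2)"
  have e0: "eval_aexp s (entry n ?k ?l) = Some (E (k1, 0) (l1, l2))"
    using R0[of "(l1, l2)"] k l by (simp add: entry_def in_idx_def nat_pair_def idx_def)
  have e1: "eval_aexp s (entry n (?k - (1, 0)) ?l) = Some (if k1 = 0 then 0 else E (k1 - 1, 0) (l1, l2))"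
    using R1[of "(l1, l2)"] k l by (cases k1) (simp_all add: entry_def in_idx_def nat_pair_def idx_def)
  have e2: "eval_aexp s (entry n ?k (?l + (1, 0))) = Some (E (k1, 0) (l1 + 1, l2))"
    using R0[of "(l1 + 1, l2)"] E_outside[of "(l1 + 1, l2)" "(k1, 0)"] k l
    by (auto simp: entry_def in_idx_def nat_pair_def idx_def nat_add_distrib)
  have e3: "eval_aexp s (entry n ?k (?l - (1, 0))) = Some (E (k1, 0) (l1 - 1, l2))"
    using R0[of "(l1 - 1, l2)"] k l by (cases l1) (simp_all add: entry_def in_idx_def nat_pair_def idx_def)
  have nz: "(of_int (fst ?k) + of_int (snd ?k) - real n) * (of_int (fst ?k) + \<alpha>1 + 1) \<noteq> 0"
  proof -
    have "real k1 - real n < 0" "real k1 + \<alpha>1 + 1 > 0" using k gt by linarith+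
    then show ?thesis by simp
  qed
  have k': "k1 + 0 < n" using k by simp
  show "eval_aexp s (recurrence n (tau0 n) (tau1 n) (tau2 n) (1, 0) ?k ?l) = Some (E (k1 + 1, 0) (l1, l2))"
    unfolding eval_recurrence[of s "tau0 n" _ "tau1 n" _ "tau2 n", OF eval_sigma_tau(4)[OF s] eval_sigma_tau(6)[OF s]
        eval_sigma_tau(5)[OF s] nz e0 e1 e2 e3] dual_coeff_recurrence_swap[OF gt k' l(1)]
    by (simp add: sigma0_val_def sigma2_val_def add_ac)
qed

text \<open>
  The entries added by the pass of Step 2 for \<open>k1\<close>.
\<close>

definition sweep :: "nat \<Rightarrow> ((nat \<times> nat) \<times> (nat \<times> nat)) set" where
  "sweep k1 = (\<Union>k2\<in>{0..<n - k1}. cross (k1, k2 + 1) k1) \<union> cross (k1 + 1, 0) (k1 + 1)"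

lemma computes_step2: "computes (cross (0, 0) 0) (step2 n) (\<Union>k1\<in>{0..<n}. sweep k1)"
  unfolding step2_def
proof (rule computes_loop)
  fix k1 assume k1: "k1 < n"
  let ?R = "cross (0, 0) 0 \<union> (\<Union>j\<in>{0..<k1}. sweep j)"
  have row: "cross (j, 0) j \<subseteq> ?R" if "j \<le> k1" for j
  proof (cases j)
    case (Suc i)
    then have "cross (j, 0) j \<subseteq> sweep i" by (auto simp: sweep_def)
    then show ?thesis using Suc that by fastforce
  qed auto
  have A: "computes ?R (loop [0..<n - k1] (\<lambda>k2. loop [k1..<n + 1] (\<lambda>l1. loop [0..<n - l1 + 1] (\<lambda>l2.
         [Coef (k1, k2 + 1) (l1, l2) \<leftarrow>
            recurrence n (sigma0 n) (sigma1 n) (sigma2 n) (0, 1)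
              (int k1, int k2) (int l1, int l2),
          Coef (l1, l2) (k1, k2 + 1) \<leftarrow> Var (Coef (k1, k2 + 1) (l1, l2))]))))
      (\<Union>k2\<in>{0..<n - k1}. cross (k1, k2 + 1) k1)"
  proof (rule computes_loop)
    fix k2 assume k2: "k2 < n - k1"
    let ?S = "?R \<union> (\<Union>j\<in>{0..<k2}. cross (k1, j + 1) k1)"
    have col: "cross (k1, j) k1 \<subseteq> ?S" if "j \<le> k2" for j
    proof (cases j)
      case 0
      then show ?thesis using row[of k1] by auto
    next
      case (Suc i)
      then have "i \<in> {0..<k2}" using that by simp
      then have "cross (k1, i + 1) k1 \<subseteq> (\<Union>j\<in>{0..<k2}. cross (k1, j + 1) k1)" by blast
      then show ?thesis using Suc by auto
    qed
    show "computes ?S (loop [k1..<n + 1] (\<lambda>l1. loop [0..<n - l1 + 1] (\<lambda>l2.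
         [Coef (k1, k2 + 1) (l1, l2) \<leftarrow>
            recurrence n (sigma0 n) (sigma1 n) (sigma2 n) (0, 1)
              (int k1, int k2) (int l1, int l2),
          Coef (l1, l2) (k1, k2 + 1) \<leftarrow> Var (Coef (k1, k2 + 1) (l1, l2))]))) (cross (k1, k2 + 1) k1)"
      unfolding cross_def[of "(k1, k2 + 1)"]
      by (intro computes_loop_independent computes_sigma_step col) (use k1 k2 in \<open>auto simp: idx_def\<close>)
  qed
  have B: "computes ?R (loop [k1 + 1..<n + 1] (\<lambda>l1. loop [0..<n - l1 + 1] (\<lambda>l2.
         [Coef (k1 + 1, 0) (l1, l2) \<leftarrow>
            recurrence n (tau0 n) (tau1 n) (tau2 n) (1, 0)
              (int k1, 0) (int l1, int l2),
          Coef (l1, l2) (k1 + 1, 0) \<leftarrow> Var (Coef (k1 + 1, 0) (l1, l2))])))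
      (cross (k1 + 1, 0) (k1 + 1))"
    unfolding cross_def[of "(k1 + 1, 0)"]
    by (intro computes_loop_independent computes_tau_step row) (use k1 in \<open>auto simp: idx_def\<close>)
  show "computes ?R (loop [0..<n - k1] (\<lambda>k2. loop [k1..<n + 1] (\<lambda>l1. loop [0..<n - l1 + 1] (\<lambda>l2.
         [Coef (k1, k2 + 1) (l1, l2) \<leftarrow>
            recurrence n (sigma0 n) (sigma1 n) (sigma2 n) (0, 1)
              (int k1, int k2) (int l1, int l2),
          Coef (l1, l2) (k1, k2 + 1) \<leftarrow> Var (Coef (k1, k2 + 1) (l1, l2))]))) @
       loop [k1 + 1..<n + 1] (\<lambda>l1. loop [0..<n - l1 + 1] (\<lambda>l2.
         [Coef (k1 + 1, 0) (l1, l2) \<leftarrow>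
            recurrence n (tau0 n) (tau1 n) (tau2 n) (1, 0)
              (int k1, 0) (int l1, int l2),
          Coef (l1, l2) (k1 + 1, 0) \<leftarrow> Var (Coef (k1 + 1, 0) (l1, l2))]))) (sweep k1)"
    unfolding sweep_def[of k1] by (rule computes_append[OF A B]) blast
qed

text \<open>
  By symmetry it may be assumed that the first component of the upper index is the smaller one.
\<close>

lemma sweeps_cover:
  assumes "k \<in> idx n" "l \<in> idx n"
  shows "(k, l) \<in> cross (0, 0) 0 \<union> (\<Union>k1\<in>{0..<n}. sweep k1)"
proof -
  have *: "cross k (fst k) \<subseteq> cross (0, 0) 0 \<union> (\<Union>k1\<in>{0..<n}. sweep k1)" if "k \<in> idx n" for k
  proof -
    obtain k1 k2 where k: "k = (k1, k2)" by (cases k)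
    have kn: "k1 + k2 \<le> n" using that by (simp add: k idx_def)
    show ?thesis
    proof (cases k2)
      case (Suc j)
      then have "j \<in> {0..<n - k1}" "k1 < n" using kn by auto
      then have "cross (k1, j + 1) k1 \<subseteq> sweep k1" "k1 < n" unfolding sweep_def by blast+
      then have "cross (k1, k2) k1 \<subseteq> sweep k1" "k1 < n" using Suc by simp_all
      then show ?thesis by (auto simp: k)
    next
      case 0
      show ?thesis
      proof (cases k1)
        case (Suc i)
        then have "cross (k1, 0) k1 \<subseteq> sweep i" "i < n" using kn by (auto simp: sweep_def)
        then show ?thesis using 0 by (auto simp: k)
      qed (simp add: k 0)
    qed
  qed
  show ?thesis
  proof (cases "fst k \<le> fst l")
    case True
    then show ?thesis using *[OF assms(1)] cross_mem[OF assms(2)] by blast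
  next
    case False
    then show ?thesis using *[OF assms(2)] cross_mem'[OF assms(1), of "fst l" l] by auto
  qed
qed

lemma computes_run: "computes R p W \<Longrightarrow> stored R s \<Longrightarrow> \<exists>s'. exec p s = Some s' \<and> stored (R \<union> W) s'"
  unfolding computes_def hoare_def by blast

theorem procedure_correct:
  "\<exists>s1 s. exec (step1 n) (init_state \<alpha>1 \<alpha>2 \<alpha>3) = Some s1 \<and>
     (\<forall>l\<in>idx n. s1 (Coef (0, 0) l) = Some (step1_value n \<alpha>1 \<alpha>2 \<alpha>3 l)) \<and>
     exec (step2 n) s1 = Some s \<and>
     exec (procedure n) (init_state \<alpha>1 \<alpha>2 \<alpha>3) = Some s \<and>
     (\<forall>k\<in>idx n. \<forall>l\<in>idx n. s (Coef k l) = Some (bezier_coeff n \<alpha>1 \<alpha>2 \<alpha>3 k l))"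
proof -
  have "stored {} (init_state \<alpha>1 \<alpha>2 \<alpha>3)" by (simp add: stored_def init_state_def)
  then obtain s1 where s1: "exec (step1 n) (init_state \<alpha>1 \<alpha>2 \<alpha>3) = Some s1" "stored (cross (0, 0) 0) s1"
    using computes_run[OF computes_step1] by (auto simp: cross_def)
  obtain s where s: "exec (step2 n) s1 = Some s" "stored (cross (0, 0) 0 \<union> (\<Union>k1\<in>{0..<n}. sweep k1)) s"
    using computes_run[OF computes_step2 s1(2)] by blast
  have "s1 (Coef (0, 0) l) = Some (step1_value n \<alpha>1 \<alpha>2 \<alpha>3 l)" if "l \<in> idx n" for l
  proof -
    have "((0, 0), l) \<in> cross (0, 0) 0" using that by (intro cross_mem) simp_all
    then have "s1 (Coef (0, 0) l) = Some (E (0, 0) l)" using s1(2) by (auto simp: stored_def)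
    then show ?thesis by (simp add: step1_value_eq[OF that])
  qed
  moreover have "s (Coef k l) = Some (bezier_coeff n \<alpha>1 \<alpha>2 \<alpha>3 k l)" if "k \<in> idx n" "l \<in> idx n" for k l
    using s(2) sweeps_cover[OF that] unfolding stored_def bezier_coeff_eq[OF gt that(1)] by blast
  moreover have "exec (procedure n) (init_state \<alpha>1 \<alpha>2 \<alpha>3) = Some s"
    by (simp add: procedure_def exec_append s1 s)
  ultimately show ?thesis using s1(1) s(1) by blast
qed

end

section \<open>The number of arithmetic operations\<close>

lemma ops_Nil: "ops [] = 0" by (simp add: ops_def)
lemma ops_Cons: "ops (st # p) = ops_stmt st + ops p" by (simp add: ops_def)
lemma ops_append: "ops (p @ q) = ops p + ops q" by (simp add: ops_def)

lemma ops_loop: "ops (loop [a..<b] body) = (\<Sum>i\<in>{a..<b}. ops (body i))"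
  by (induction b) (auto simp: ops_append ops_Nil)

lemma ops_loop_rev: "ops (loop (rev [0..<m]) body) = (\<Sum>i\<in>{0..<m}. ops (body i))"
  by (induction m) (auto simp: ops_append ops_Nil)

lemma ops_poch_exp: "ops_aexp (poch_exp e k) = k * (ops_aexp e + 2)"
  by (induction k) simp_all

lemma ops_power_exp: "ops_aexp (power_exp e k) = k * (ops_aexp e + 1)"
  by (induction k) simp_all

lemma sum_le_count:
  fixes f :: "nat \<Rightarrow> nat"
  assumes "\<And>i. a \<le> i \<Longrightarrow> i < b \<Longrightarrow> f i \<le> K" "b - a \<le> m"
  shows "(\<Sum>i\<in>{a..<b}. f i) \<le> m * K"
proof -
  have "(\<Sum>i\<in>{a..<b}. f i) \<le> of_nat (card {a..<b}) * K"
    using assms(1) by (intro sum_bounded_above) auto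
  also have "\<dots> \<le> m * K" using assms(2) by (intro mult_right_mono) auto
  finally show ?thesis .
qed

text \<open>
  Each Pochhammer symbol is evaluated from scratch, at linear cost. Step 1 thereby costs \<open>O(n\<^sup>4)\<close>, no more than Step 2.
\<close>

lemma ops_c_star_exp:
  assumes "i \<le> n"
  shows "ops_aexp (c_star_exp n l1 i) \<le> 30 * (n + 1)"
  using assms by (auto simp: c_star_exp_def ops_poch_exp ops_power_exp)

lemma ops_clenshaw:
  assumes "N \<le> n" "\<And>i. i \<le> N \<Longrightarrow> ops_aexp (\<gamma> i) \<le> 30 * (n + 1)"
  shows "ops (clenshaw_hahn N \<gamma> (nat_const t) (Var Alpha2) (Var Alpha3) (nat_const N)) \<le> (n + 1) * (150 * (n + 1))"
proof -
  have A: "ops_aexp (hahn_A (nat_const t) (Var Alpha2) (Var Alpha3) (nat_const N) i) \<le> 60"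
    and B: "ops_aexp (hahn_B (Var Alpha2) (Var Alpha3) (nat_const N) i) \<le> 50" for i
    by (auto simp: hahn_A_def hahn_B_def hahn_C_def hahn_D_def hahn_E_def hahn_s_def ops_poch_exp)
  have "(\<Sum>i\<in>{0..<N + 1}. ops [Acc i \<leftarrow> \<gamma> i \<oplus> hahn_A (nat_const t) (Var Alpha2) (Var Alpha3) (nat_const N) i \<otimes> Var (Acc (i + 1))
                  \<oplus> hahn_B (Var Alpha2) (Var Alpha3) (nat_const N) (i + 1) \<otimes> Var (Acc (i + 2))])
      \<le> (n + 1) * (150 * (n + 1))"
  proof (rule sum_le_count)
    fix i assume "i < N + 1"
    then show "ops [Acc i \<leftarrow> \<gamma> i \<oplus> hahn_A (nat_const t) (Var Alpha2) (Var Alpha3) (nat_const N) i \<otimes> Var (Acc (i + 1))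
                  \<oplus> hahn_B (Var Alpha2) (Var Alpha3) (nat_const N) (i + 1) \<otimes> Var (Acc (i + 2))] \<le> 150 * (n + 1)"
      using assms(2)[of i] A[of i] B[of "i + 1"] by (simp add: ops_Cons ops_Nil)
  qed (use assms(1) in simp)
  then show ?thesis by (simp only: clenshaw_hahn_def ops_append ops_loop_rev) (simp add: ops_Cons ops_Nil)
qed

lemma ops_step1: "ops (step1 n) \<le> 170 * (n + 1) ^ 4"
proof -
  have "ops (step1 n) \<le> (n + 1) * ((n + 1) * ((n + 1) * (150 * (n + 1)) + 20 * (n + 1)))"
    unfolding step1_def ops_loop ops_append
  proof (intro sum_le_count add_mono)
    fix l1 l2 assume "l1 < n + 1"
    then show "ops (clenshaw_hahn (n - l1) (c_star_exp n l1) (nat_const l2) (Var Alpha2) (Var Alpha3) (nat_const (n - l1)))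
        \<le> (n + 1) * (150 * (n + 1))"
      by (intro ops_clenshaw ops_c_star_exp) auto
  qed (auto simp: ops_Cons ops_Nil ops_poch_exp ops_power_exp)
  also have "\<dots> = (n + 1) * (n + 1) * (n + 1) * (150 * (n + 1)) + 20 * (n + 1) * (n + 1) * (n + 1)"
    by (simp add: algebra_simps)
  also have "\<dots> \<le> 170 * (n + 1) ^ 4"
  proof -
    have "m * m * m * (150 * m) + 20 * m * m * m \<le> 170 * m ^ 4" if "m \<ge> 1" for m :: nat
    proof -
      have "m * m * m * 1 \<le> m * m * m * m" using that by (rule mult_left_mono) simp
      then show ?thesis by (simp add: power4_eq_xxxx)
    qed
    from this[of "n + 1"] show ?thesis by simp
  qed
  finally show ?thesis .
qed

lemma ops_recurrence:
  shows "ops_aexp (recurrence n (sigma0 n) (sigma1 n) (sigma2 n) v k l) \<le> 100"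
    and "ops_aexp (recurrence n (tau0 n) (tau1 n) (tau2 n) v k l) \<le> 100"
    and "ops_aexp (recurrence n (sigma0 n) (sigma1 n) (sigma2 n) v k l) \<ge> 1"
  by (auto simp: recurrence_def sigma0_def sigma1_def sigma2_def tau0_def tau1_def tau2_def entry_def)

lemma ops_step2: "ops (step2 n) \<le> 200 * (n + 1) ^ 4"
proof -
  have "ops (step2 n) \<le> (n + 1) * ((n + 1) * ((n + 1) * ((n + 1) * 100)) + (n + 1) * ((n + 1) * 100))"
    unfolding step2_def ops_loop ops_append
    by (intro sum_le_count add_mono) (auto simp: ops_Cons ops_Nil ops_recurrence)
  also have "\<dots> \<le> 200 * (n + 1) ^ 4"
  proof -
    have "(n + 1) ^ 3 * 1 \<le> (n + 1) ^ 3 * (n + 1)" by (intro mult_left_mono) simp_all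
    then show ?thesis by (simp add: power_numeral_reduce algebra_simps)
  qed
  finally show ?thesis .
qed

lemma ops_upper: "ops (procedure n) \<le> 370 * (n + 1) ^ 4"
  using ops_step1[of n] ops_step2[of n] by (simp add: procedure_def ops_append)

text \<open>
  The first recurrence of Step 2 is executed \<open>\<Sum>k1<n. (n - k1) (n - k1 + 1) (n - k1 + 2) / 2\<close> times, and each execution performs at least
  one operation.
\<close>

lemma ops_lower: "n ^ 4 \<le> 8 * ops (procedure n)"
proof -
  have gauss: "2 * (\<Sum>i\<in>{0..m}. i + 1) = (m + 1) * (m + 2)" for m :: nat
    by (induction m) simp_all
  have inner: "(n - k1) ^ 2 \<le> 2 * (\<Sum>l1\<in>{k1..<n + 1}. n - l1 + 1)" if "k1 < n" for k1
  proof -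
    have "(\<Sum>l1\<in>{k1..<n + 1}. n - l1 + 1) = (\<Sum>i\<in>{0..n - k1}. i + 1)"
      by (rule sum.reindex_bij_witness[of _ "\<lambda>i. n - i" "\<lambda>i. n - i"]) (use that in auto)
    also have "2 * \<dots> = (n - k1 + 1) * (n - k1 + 2)" by (rule gauss)
    finally show ?thesis by (simp add: power2_eq_square)
  qed
  have cube: "n ^ 4 \<le> 4 * (\<Sum>k1\<in>{0..<n}. (n - k1) ^ 3)"
  proof -
    have "(\<Sum>k1\<in>{0..<n}. (n - k1) ^ 3) = (\<Sum>i\<in>{1..n}. i ^ 3)"
      by (rule sum.reindex_bij_witness[of _ "\<lambda>i. n - i" "\<lambda>i. n - i"]) auto
    moreover have "m ^ 4 \<le> 4 * (\<Sum>i\<in>{1..m}. i ^ 3)" for m :: nat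
    proof -
      have "4 * (\<Sum>i\<in>{1..m}. i ^ 3) = (m * (m + 1)) ^ 2"
      proof (induction m)
        case (Suc m)
        then have "4 * (\<Sum>i\<in>{1..Suc m}. i ^ 3) = (m * (m + 1)) ^ 2 + 4 * (Suc m) ^ 3" by simp
        then show ?case by (simp add: power2_eq_square power3_eq_cube algebra_simps)
      qed simp
      then show ?thesis by (simp add: power_mult_distrib power_numeral_reduce algebra_simps)
    qed
    ultimately show ?thesis by simp
  qed
  have "(\<Sum>k1\<in>{0..<n}. (n - k1) ^ 3) \<le> (\<Sum>k1\<in>{0..<n}. 2 * (\<Sum>k2\<in>{0..<n - k1}. \<Sum>l1\<in>{k1..<n + 1}. \<Sum>l2\<in>{0..<n - l1 + 1}. 1))"
  proof (rule sum_mono)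
    fix k1 assume "k1 \<in> {0..<n}"
    then have "(n - k1) * (n - k1) ^ 2 \<le> (n - k1) * (2 * (\<Sum>l1\<in>{k1..<n + 1}. n - l1 + 1))"
      by (intro mult_left_mono inner) auto
    then show "(n - k1) ^ 3 \<le> 2 * (\<Sum>k2\<in>{0..<n - k1}. \<Sum>l1\<in>{k1..<n + 1}. \<Sum>l2\<in>{0..<n - l1 + 1}. 1)"
      by (simp add: power3_eq_cube power2_eq_square)
  qed
  also have "\<dots> \<le> 2 * ops (step2 n)"
    unfolding step2_def ops_loop ops_append sum_distrib_left[symmetric]
    by (intro mult_left_mono sum_mono trans_le_add1) (simp_all add: ops_Cons ops_recurrence[simplified] trans_le_add1)
  finally show ?thesis using cube by (simp add: procedure_def ops_append)
qed

lemma card_idx: "2 * card (idx n) = (n + 1) * (n + 2)"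
proof -
  have "idx n = Sigma {..n} (\<lambda>k1. {..n - k1})" by (auto simp: idx_def)
  then have "card (idx n) = (\<Sum>k1\<le>n. n - k1 + 1)" by simp
  also have "\<dots> = (\<Sum>i\<le>n. i + 1)"
    by (rule sum.reindex_bij_witness[of _ "\<lambda>i. n - i" "\<lambda>i. n - i"]) auto
  also have "2 * \<dots> = (n + 1) * (n + 2)" by (induction n) simp_all
  finally show ?thesis .
qed

lemma card_idx_square: "4 * card (idx n \<times> idx n) = ((n + 1) * (n + 2)) ^ 2"
  unfolding card_idx[symmetric] by (simp add: card_cartesian_product power2_eq_square)

lemma ops_bigo: "(\<lambda>n. real (ops (procedure n))) \<in> O(\<lambda>n. real n ^ 4)"
proof (rule bigoI[of _ "370 * 2 ^ 4"], rule eventually_sequentiallyI[of 1])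
  fix n :: nat assume "n \<ge> 1"
  then have "(n + 1) ^ 4 \<le> (2 * n) ^ 4" by (intro power_mono) auto
  then have "ops (procedure n) \<le> 370 * 2 ^ 4 * n ^ 4" using ops_upper[of n] by (simp add: power_mult_distrib)
  then have "real (ops (procedure n)) \<le> real (370 * 2 ^ 4 * n ^ 4)" by (rule of_nat_mono)
  then show "norm (real (ops (procedure n))) \<le> 370 * 2 ^ 4 * norm (real n ^ 4)" by simp
qed

lemma ops_bigtheta: "(\<lambda>n. real (ops (procedure n))) \<in> \<Theta>(\<lambda>n. real (card (idx n \<times> idx n)))"
proof (rule bigthetaI')
  show "\<forall>\<^sub>F n in sequentially.
      1 / 72 * norm (real (card (idx n \<times> idx n))) \<le> norm (real (ops (procedure n))) \<and>
      norm (real (ops (procedure n))) \<le> 1480 * norm (real (card (idx n \<times> idx n)))"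
  proof (rule eventually_sequentiallyI[of 1], intro conjI)
    fix n :: nat assume n: "n \<ge> 1"
    have "((n + 1) * (n + 2)) ^ 2 \<le> ((2 * n) * (3 * n)) ^ 2" using n by (intro power_mono mult_mono) auto
    also have "\<dots> = 36 * n ^ 4" by (simp add: power_mult_distrib power_numeral_reduce)
    also have "\<dots> \<le> 36 * (8 * ops (procedure n))" by (intro mult_left_mono ops_lower) simp
    finally have "card (idx n \<times> idx n) \<le> 72 * ops (procedure n)"
      unfolding card_idx_square[symmetric] by simp
    then have "real (card (idx n \<times> idx n)) \<le> real (72 * ops (procedure n))" by (rule of_nat_mono)
    then show "1 / 72 * norm (real (card (idx n \<times> idx n))) \<le> norm (real (ops (procedure n)))" by simp
    have "m ^ 4 = (m * m) ^ 2" for m :: nat by (simp add: power4_eq_xxxx power2_eq_square)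
    then have "(n + 1) ^ 4 = ((n + 1) * (n + 1)) ^ 2" .
    also have "\<dots> \<le> ((n + 1) * (n + 2)) ^ 2" by (intro power_mono mult_mono) auto
    finally have "ops (procedure n) \<le> 1480 * card (idx n \<times> idx n)"
      using ops_upper[of n] unfolding card_idx_square[symmetric] by linarith
    then have "real (ops (procedure n)) \<le> real (1480 * card (idx n \<times> idx n))" by (rule of_nat_mono)
    then show "norm (real (ops (procedure n))) \<le> 1480 * norm (real (card (idx n \<times> idx n)))" by simp
  qed
qed simp_all

theorem mainTheorem2:
  shows
    "(\<forall>(n :: nat) (\<alpha>1 :: real) (\<alpha>2 :: real) (\<alpha>3 :: real).
        \<alpha>1 > - 1 \<and> \<alpha>2 > - 1 \<and> \<alpha>3 > - 1 \<longrightarrow>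
          (\<forall>k\<in>idx n. (\<exists>!D. is_dual_bernstein n \<alpha>1 \<alpha>2 \<alpha>3 k D) \<and>
             (\<exists>!c. is_bezier_form n (dual_bernstein n \<alpha>1 \<alpha>2 \<alpha>3 k) c)) \<and>
          (\<exists>s1 s. exec (step1 n) (init_state \<alpha>1 \<alpha>2 \<alpha>3) = Some s1 \<and>
             (\<forall>l\<in>idx n. s1 (Coef (0, 0) l) = Some (step1_value n \<alpha>1 \<alpha>2 \<alpha>3 l)) \<and>
             exec (step2 n) s1 = Some s \<and>
             exec (procedure n) (init_state \<alpha>1 \<alpha>2 \<alpha>3) = Some s \<and>
             (\<forall>k\<in>idx n. \<forall>l\<in>idx n.
                s (Coef k l) = Some (bezier_coeff n \<alpha>1 \<alpha>2 \<alpha>3 k l)))) \<and>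
     (\<lambda>n. real (ops (procedure n))) \<in> O(\<lambda>n. real n ^ 4) \<and>
     (\<lambda>n. real (ops (procedure n))) \<in> \<Theta>(\<lambda>n. real (card (idx n \<times> idx n)))"
proof -
  have "(\<forall>k\<in>idx n. (\<exists>!D. is_dual_bernstein n \<alpha>1 \<alpha>2 \<alpha>3 k D) \<and>
           (\<exists>!c. is_bezier_form n (dual_bernstein n \<alpha>1 \<alpha>2 \<alpha>3 k) c)) \<and>
        (\<exists>s1 s. exec (step1 n) (init_state \<alpha>1 \<alpha>2 \<alpha>3) = Some s1 \<and>
           (\<forall>l\<in>idx n. s1 (Coef (0, 0) l) = Some (step1_value n \<alpha>1 \<alpha>2 \<alpha>3 l)) \<and>
           exec (step2 n) s1 = Some s \<and>
           exec (procedure n) (init_state \<alpha>1 \<alpha>2 \<alpha>3) = Some s \<and>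
           (\<forall>k\<in>idx n. \<forall>l\<in>idx n. s (Coef k l) = Some (bezier_coeff n \<alpha>1 \<alpha>2 \<alpha>3 k l)))"
    if a: "\<alpha>1 > - 1 \<and> \<alpha>2 > - 1 \<and> \<alpha>3 > - 1" for n :: nat and \<alpha>1 \<alpha>2 \<alpha>3 :: real
  proof (intro conjI ballI)
    interpret dual_procedure n \<alpha>1 \<alpha>2 \<alpha>3 using a by unfold_locales auto
    show "\<exists>!D. is_dual_bernstein n \<alpha>1 \<alpha>2 \<alpha>3 k D" if "k \<in> idx n" for k
      unfolding dual_bernstein_iff[OF gt that] by (rule ex1I, rule refl)
    show "\<exists>!c. is_bezier_form n (dual_bernstein n \<alpha>1 \<alpha>2 \<alpha>3 k) c" if "k \<in> idx n" for k
      unfolding bezier_form_iff[OF gt that] by (rule ex1I, rule refl)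
    show "\<exists>s1 s. exec (step1 n) (init_state \<alpha>1 \<alpha>2 \<alpha>3) = Some s1 \<and>
           (\<forall>l\<in>idx n. s1 (Coef (0, 0) l) = Some (step1_value n \<alpha>1 \<alpha>2 \<alpha>3 l)) \<and>
           exec (step2 n) s1 = Some s \<and>
           exec (procedure n) (init_state \<alpha>1 \<alpha>2 \<alpha>3) = Some s \<and>
           (\<forall>k\<in>idx n. \<forall>l\<in>idx n. s (Coef k l) = Some (bezier_coeff n \<alpha>1 \<alpha>2 \<alpha>3 k l))"
      by (rule procedure_correct)
  qed
  then show ?thesis
    by (intro conjI[OF _ conjI[OF ops_bigo ops_bigtheta]] allI impI)
qed

end
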